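(* Let $\Gamma=\Gamma_1\times\Gamma_2$ be a direct product of two infinite finitely generated groups. Then for every Cayley graph $G$ of $\Gamma$ (with respect to a finite generating set) and every $p\in[1,\infty)$, every harmonic function on the vertices of $G$ whose gradient belongs to $\ell^p$ is constant; moreover, the reduced $\ell^p$-cohomology in degree one of $G$ is trivial for every $p\in[1,\infty)$.
   Context: A real-valued function $f$ on the vertex set $V$ of a locally finite graph $G$ is harmonic if $f(v)=\frac{1}{\deg(v)}\sum_{w\sim v}f(w)$ for all $v\in V$, where $\deg(v)$ is the degree of $v$ and $w\sim v$ denotes adjacency. The gradient of $f$ is the function on edges $(v,w)$ given by $\nabla f(v,w)=f(w)-f(v)$; it is in $\ell^p$ if $\sum_{(v,w)}|f(w)-f(v)|^p<\infty$, the sum being over all edges. Let $\mathsf{D}^p(G)$ be the space of functions $f:V\to\mathbb{R}$ with $\nabla f\in\ell^p$, endowed with the seminorm $f\mapsto\|\nabla f\|_{\ell^p}$. For a connected graph $G$ of bounded valency, the reduced $\ell^p$-cohomology in degree one is the quotient of $\mathsf{D}^p(G)$ by the closure of $\ell^p(V)+\mathbb{R}$ (the $\ell^p$ functions plus constants) in this seminorm. It is trivial when every $f\in\mathsf{D}^p(G)$ is a limit, in this seminorm, of functions in $\ell^p(V)+\mathbb{R}$. *)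

theory Defs
  imports
    "HOL-Analysis.Analysis"
    "HOL-Algebra.Generated_Groups"
    "Graph_Theory.Pair_Digraph"
begin

text \<open>
  A simple, undirected, possibly infinite graph is a \<^term>\<open>G :: 'a pair_pre_digraph\<close> satisfying
  \<^locale>\<open>pair_bidirected_digraph\<close>: its arcs form a symmetric irreflexive relation, and each edge
  occurs as two opposite arcs.  A function on the vertices is a total function of which only
  the values on \<^term>\<open>pverts G\<close> matter.
\<close>

definition harmonic_on_graph :: "'a pair_pre_digraph \<Rightarrow> ('a \<Rightarrow> real) \<Rightarrow> bool" where
  "harmonic_on_graph G f \<longleftrightarrow>
     (\<forall>v\<in>pverts G. f v = 1 / real (out_degree G v) * (\<Sum>w | v \<rightarrow>\<^bsub>with_proj G\<^esub> w. f w))"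

definition gradient :: "('a \<Rightarrow> real) \<Rightarrow> 'a \<times> 'a \<Rightarrow> real" where
  "gradient f = (\<lambda>(v, w). f w - f v)"

definition lp_space :: "real \<Rightarrow> 'i set \<Rightarrow> ('i \<Rightarrow> real) set" where
  "lp_space p I = {u. (\<lambda>i. \<bar>u i\<bar> powr p) summable_on I}"

text \<open>Meaningful only for members of \<^term>\<open>lp_space p I\<close>, since \<^const>\<open>infsum\<close> is 0 on
  non-summable families.\<close>

definition lp_norm :: "real \<Rightarrow> 'i set \<Rightarrow> ('i \<Rightarrow> real) \<Rightarrow> real" where
  "lp_norm p I u = (\<Sum>\<^sub>\<infinity>i\<in>I. \<bar>u i\<bar> powr p) powr (1 / p)"

text \<open>Sums run over both orientations of each edge, which multiplies the \<open>p\<close>-th power of the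
  seminorm by 2.\<close>

definition Dp_space :: "real \<Rightarrow> 'a pair_pre_digraph \<Rightarrow> ('a \<Rightarrow> real) set" where
  "Dp_space p G = {f. gradient f \<in> lp_space p (parcs G)}"

definition Dp_seminorm :: "real \<Rightarrow> 'a pair_pre_digraph \<Rightarrow> ('a \<Rightarrow> real) \<Rightarrow> real" where
  "Dp_seminorm p G f = lp_norm p (parcs G) (gradient f)"

definition lp_plus_const :: "real \<Rightarrow> 'a pair_pre_digraph \<Rightarrow> ('a \<Rightarrow> real) set" where
  "lp_plus_const p G = {(\<lambda>v. u v + c) | u c. u \<in> lp_space p (pverts G)}"

text \<open>The intersection with \<^const>\<open>Dp_space\<close> is redundant for graphs of bounded valency; it keeps
  \<^const>\<open>Dp_seminorm\<close> from being applied where it is meaningless.\<close>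

definition Dp_closure :: "real \<Rightarrow> 'a pair_pre_digraph \<Rightarrow> ('a \<Rightarrow> real) set \<Rightarrow> ('a \<Rightarrow> real) set" where
  "Dp_closure p G A = {f \<in> Dp_space p G.
     \<exists>g. (\<forall>n::nat. g n \<in> A \<inter> Dp_space p G) \<and>
         (\<lambda>n. Dp_seminorm p G (\<lambda>v. f v - g n v)) \<longlonglongrightarrow> 0}"

definition reduced_lp_cohomology_trivial :: "real \<Rightarrow> 'a pair_pre_digraph \<Rightarrow> bool" where
  "reduced_lp_cohomology_trivial p G \<longleftrightarrow> Dp_space p G \<subseteq> Dp_closure p G (lp_plus_const p G)"

definition finite_generating_set :: "('a, 'b) monoid_scheme \<Rightarrow> 'a set \<Rightarrow> bool" where
  "finite_generating_set \<Gamma> S \<longleftrightarrow> finite S \<and> S \<subseteq> carrier \<Gamma> \<and> generate \<Gamma> S = carrier \<Gamma>"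

definition finitely_generated_group :: "('a, 'b) monoid_scheme \<Rightarrow> bool" where
  "finitely_generated_group \<Gamma> \<longleftrightarrow> group \<Gamma> \<and> (\<exists>S. finite_generating_set \<Gamma> S)"

text \<open>The generating set need not be symmetric and may contain the identity; loops and multiple
  edges are suppressed.\<close>

definition cayley_graph :: "('a, 'b) monoid_scheme \<Rightarrow> 'a set \<Rightarrow> 'a pair_pre_digraph" where
  "cayley_graph \<Gamma> S = \<lparr>pverts = carrier \<Gamma>,
     parcs = {(g, h). g \<in> carrier \<Gamma> \<and> h \<in> carrier \<Gamma> \<and> g \<noteq> h \<and>
                      (\<exists>s\<in>S. h = g \<otimes>\<^bsub>\<Gamma>\<^esub> s \<or> g = h \<otimes>\<^bsub>\<Gamma>\<^esub> s)}\<rparr>"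

lemma pair_bidirected_digraph_cayley_graph: "pair_bidirected_digraph (cayley_graph \<Gamma> S)"
  by unfold_locales (auto simp: cayley_graph_def symmetric_def sym_def)

lemma finite_neighbours_cayley_graph:
  assumes "group \<Gamma>" "finite_generating_set \<Gamma> S"
  shows "finite {w. v \<rightarrow>\<^bsub>with_proj (cayley_graph \<Gamma> S)\<^esub> w}"
proof -
  interpret group \<Gamma> by fact
  have S: "finite S" "S \<subseteq> carrier \<Gamma>"
    using assms(2) by (auto simp: finite_generating_set_def)
  have "h = v \<otimes>\<^bsub>\<Gamma>\<^esub> inv\<^bsub>\<Gamma>\<^esub> s" if "v = h \<otimes>\<^bsub>\<Gamma>\<^esub> s" "h \<in> carrier \<Gamma>" "s \<in> S" for h s
    using that S(2) by (auto simp: m_assoc)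
  then have "{w. v \<rightarrow>\<^bsub>with_proj (cayley_graph \<Gamma> S)\<^esub> w} \<subseteq>
      (\<lambda>s. v \<otimes>\<^bsub>\<Gamma>\<^esub> s) ` S \<union> (\<lambda>s. v \<otimes>\<^bsub>\<Gamma>\<^esub> inv\<^bsub>\<Gamma>\<^esub> s) ` S"
    by (auto simp: cayley_graph_def)
  then show ?thesis
    using S(1) by (meson finite_UnI finite_imageI finite_subset)
qed

end

theory Submission
  imports Defs
begin

text \<open>
  For a function \<open>f\<close> on a group put \<open>b y g = f (g y) - f g\<close>, the increment of \<open>f\<close> in direction
  \<open>y\<close>.  If the gradient of \<open>f\<close> is in \<open>\<ell>\<^sup>p\<close>, then \<open>b y\<close> is in \<open>\<ell>\<^sup>p\<close> for every \<open>y\<close>, with norm at most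
  a constant times the word length of \<open>y\<close>.  Everything is read off from the behaviour of \<open>f\<close> at
  infinity and from the growth of balls.

  Suppose first that \<open>f\<close> tends to a constant at infinity.  Then \<open>f\<close> is constant if it is harmonic,
  by the maximum principle (\<open>mean_value_property_constant_at_infinity\<close>), and cutting \<open>f\<close> off at
  height \<open>\<delta>\<close> shows that \<open>f\<close> is, up to a constant, a limit of finitely supported functions
  (\<open>lp_approximable_constant_at_infinity\<close>).

  For \<open>p = 1\<close> the product structure always brings us to this situation.  Outside a finite set \<open>Z\<close> the
  total gradient is less than \<open>\<epsilon>\<close>, so \<open>f\<close> varies by at most \<open>\<epsilon>\<close> along each coset of a factor that
  avoids \<open>Z\<close>, and any two points outside some finite set are joined by at most three such cosets
  (\<open>summable_gradient_constant_at_infinity\<close>).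

  For \<open>p > 1\<close> let \<open>B r\<close> be the balls of \<open>\<Gamma>\<close> for the product of two generating sets, so that each \<open>B r\<close>
  is the product of a ball in \<open>\<Gamma>1\<close> and a ball in \<open>\<Gamma>2\<close>.

  If \<open>B (2^k)\<close> has at least \<open>c 2^(4pk)\<close> elements for all \<open>k\<close> and some \<open>c > 0\<close>, then \<open>f\<close> again tends to a
  constant.  Averaging over \<open>B (2^k)\<close> changes \<open>f\<close> by a function whose \<open>\<ell>\<^sup>p\<close> norm is \<open>O(2^k)\<close>; a further
  average over the large ball \<open>B (2^(k-1))\<close> turns this into a supremum of size \<open>O(2^-k)\<close>.  So the
  successive averages of \<open>f\<close> converge uniformly, to some \<open>F\<close>, and \<open>f - F\<close> vanishes at infinity.  One of
  the two factors has many elements of length at most \<open>2^k\<close> for infinitely many \<open>k\<close>.  Averaging over this factor makes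
  the increments in the direction of the other factor, which commutes with it, uniformly small;
  hence \<open>F\<close> is invariant under the other factor, and then constant because the increments of \<open>f\<close>
  vanish at infinity (\<open>fast_growth_constant_at_infinity\<close>).

  Otherwise \<open>B (2^k)\<close> has at most \<open>2^(4pk)\<close> elements for infinitely many \<open>k\<close>, and the argument is one
  about arbitrary groups of slow growth.  There are large radii at which doubling the radius multiplies the
  number of elements by a bounded factor only, and near them balls of radius \<open>j\<close> whose boundary is a
  fraction \<open>O(1/j)\<close> of the ball.  The average of \<open>f\<close> over such a ball differs from \<open>f\<close> by an \<open>\<ell>\<^sup>p\<close>
  function, and its gradient is small because the norm of \<open>b y\<close> is even \<open>o(|y|)\<close> when \<open>p > 1\<close>
  (\<open>slow_growth_lp_approximable\<close>).  So the cohomology is trivial.  For a harmonic \<open>f\<close> run the uniform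
  random walk \<open>X n\<close> from the identity.  Comparing the walk with the walk after a fixed first step \<open>s\<close>
  bounds \<open>(f s - f 1)^2\<close> by a constant times \<open>(H (n+1) - H n) * E ((f (X (n+1)) - f 1)^2)\<close>, where \<open>H\<close>
  denotes entropy.  The entropy at time \<open>2^k\<close> is at most \<open>4pk ln 2\<close> infinitely often, so the first
  factor is \<open>O(1/n)\<close> for infinitely many \<open>n\<close>; the second one is a sum of \<open>n + 1\<close> expected squared
  increments and is \<open>o(n)\<close>, because the increments vanish at infinity and the walk leaves every finite set.
  So \<open>f s = f 1\<close> (\<open>slow_growth_mean_value_constant\<close>).
\<close>

section \<open>Bounded partial sums of p-th powers\<close>

text \<open>
  Convexity of the power function, applied to the nonzero terms only.
\<close>

lemma powr_abs_sum_le: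
  fixes x :: "'i \<Rightarrow> real"
  assumes "finite I" "p \<ge> 1"
  shows "\<bar>\<Sum>i\<in>I. x i\<bar> powr p \<le> real (card I) powr (p - 1) * (\<Sum>i\<in>I. \<bar>x i\<bar> powr p)"
proof -
  define J where "J = {i\<in>I. x i \<noteq> 0}"
  have J: "finite J" "J \<subseteq> I" using assms by (auto simp: J_def)
  have s1: "(\<Sum>i\<in>I. x i) = (\<Sum>i\<in>J. x i)"
    by (rule sum.mono_neutral_right) (use assms in \<open>auto simp: J_def\<close>)
  have s2: "(\<Sum>i\<in>I. \<bar>x i\<bar> powr p) = (\<Sum>i\<in>J. \<bar>x i\<bar> powr p)"
    by (rule sum.mono_neutral_right) (use assms in \<open>auto simp: J_def\<close>)
  show ?thesis
  proof (cases "J = {}")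
    case True
    then show ?thesis by (simp add: s1 s2)
  next
    case False
    define m where "m = real (card J)"
    have m: "m > 0" using False J by (simp add: m_def card_gt_0_iff)
    have "(\<Sum>i\<in>J. (1/m) *\<^sub>R \<bar>x i\<bar>) powr p \<le> (\<Sum>i\<in>J. (1/m) * \<bar>x i\<bar> powr p)"
      by (rule convex_on_sum[OF J(1) False powr_convex[OF assms(2)]])
        (use m in \<open>auto simp: m_def J_def\<close>)
    then have "((\<Sum>i\<in>J. \<bar>x i\<bar>) / m) powr p \<le> (\<Sum>i\<in>J. \<bar>x i\<bar> powr p) / m"
      by (simp add: sum_divide_distrib)
    then have "(\<Sum>i\<in>J. \<bar>x i\<bar>) powr p \<le> m powr p / m * (\<Sum>i\<in>J. \<bar>x i\<bar> powr p)"
      using m by (simp add: powr_divide sum_nonneg field_simps)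
    also have "m powr p / m = m powr (p - 1)"
      using m by (simp add: powr_diff)
    finally have *: "(\<Sum>i\<in>J. \<bar>x i\<bar>) powr p \<le> m powr (p - 1) * (\<Sum>i\<in>J. \<bar>x i\<bar> powr p)" .
    have "\<bar>\<Sum>i\<in>J. x i\<bar> powr p \<le> (\<Sum>i\<in>J. \<bar>x i\<bar>) powr p"
      by (rule powr_mono2) (use assms in auto)
    also have "\<dots> \<le> m powr (p - 1) * (\<Sum>i\<in>J. \<bar>x i\<bar> powr p)" by (rule *)
    also have "\<dots> \<le> real (card I) powr (p - 1) * (\<Sum>i\<in>J. \<bar>x i\<bar> powr p)"
      by (intro mult_right_mono powr_mono2 sum_nonneg)
        (use assms J m in \<open>auto simp: m_def card_mono\<close>)
    finally show ?thesis by (simp add: s1 s2)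
  qed
qed

lemma le_powr_inverse:
  fixes a b p :: real
  assumes "a powr p \<le> b" "0 \<le> a" "p \<ge> 1"
  shows "a \<le> b powr (1/p)"
proof -
  have "(a powr p) powr (1/p) \<le> b powr (1/p)" by (intro powr_mono2) (use assms in auto)
  then show ?thesis using assms by (simp add: powr_powr)
qed

text \<open>
  This is how a growth exponent \<open>2 * p\<close> turns a bound that is linear in the scale \<open>t\<close> into decay
  \<open>1 / t\<close>.
\<close>

lemma root_of_energy_quotient:
  fixes a c t C p :: real
  assumes "t > 0" "c > 0" "C \<ge> 0" "p \<ge> 1" "a \<ge> 0"
  shows "((a * t) powr p * C / (c * t powr (2 * p))) powr (1/p) = (a powr p * C / c) powr (1/p) / t"
proof -
  have 1: "(a * t) powr p = a powr p * t powr p" using assms by (simp add: powr_mult)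
  have 2: "t powr (2 * p) = t powr p * t powr p" by (simp add: powr_add[symmetric])
  have "t powr p > 0" using assms(1) by simp
  then have "(a * t) powr p * C / (c * t powr (2 * p)) = (a powr p * C / c) / t powr p"
    unfolding 1 2 using assms(2) by (simp add: field_simps)
  then show ?thesis
    using powr_divide[of "a powr p * C / c" "t powr p" "1/p"] assms by (simp add: powr_powr)
qed

lemma powr_abs_add_le:
  fixes a b :: real
  assumes "p \<ge> 1"
  shows "\<bar>a + b\<bar> powr p \<le> 2 powr p * (\<bar>a\<bar> powr p + \<bar>b\<bar> powr p)"
proof -
  have "\<bar>a + b\<bar> powr p \<le> (2 * max \<bar>a\<bar> \<bar>b\<bar>) powr p"
    by (rule powr_mono2) (use assms in auto)
  also have "\<dots> = 2 powr p * max \<bar>a\<bar> \<bar>b\<bar> powr p"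
    by (simp add: powr_mult)
  also have "max \<bar>a\<bar> \<bar>b\<bar> powr p \<le> \<bar>a\<bar> powr p + \<bar>b\<bar> powr p"
    by (auto simp: max_def)
  finally show ?thesis by simp
qed

text \<open>
  A bound on the sum of \<open>p\<close>-th powers over all finite subsets.  For some \<open>C\<close> this is membership in
  \<^const>\<open>lp_space\<close>; in terms of finite sums the constants can be followed through translations,
  sums and tails without any question of summability.  Note that \<open>C\<close> bounds the \<open>p\<close>-th power of the
  norm.
\<close>

definition lp_le :: "real \<Rightarrow> 'i set \<Rightarrow> ('i \<Rightarrow> real) \<Rightarrow> real \<Rightarrow> bool" where
  "lp_le p A v C \<longleftrightarrow> (\<forall>X. finite X \<and> X \<subseteq> A \<longrightarrow> (\<Sum>x\<in>X. \<bar>v x\<bar> powr p) \<le> C)"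

definition vanishes_at_infinity :: "'i set \<Rightarrow> ('i \<Rightarrow> real) \<Rightarrow> bool" where
  "vanishes_at_infinity A v \<longleftrightarrow> (\<forall>\<epsilon>>0. finite {x\<in>A. \<epsilon> \<le> \<bar>v x\<bar>})"

lemma vanishes_at_infinityD: "vanishes_at_infinity A v \<Longrightarrow> \<epsilon> > 0 \<Longrightarrow> finite {x\<in>A. \<epsilon> \<le> \<bar>v x\<bar>}"
  by (simp add: vanishes_at_infinity_def)

lemma lp_leD: "lp_le p A v C \<Longrightarrow> finite X \<Longrightarrow> X \<subseteq> A \<Longrightarrow> (\<Sum>x\<in>X. \<bar>v x\<bar> powr p) \<le> C"
  by (auto simp: lp_le_def)

lemma lp_leI: "(\<And>X. finite X \<Longrightarrow> X \<subseteq> A \<Longrightarrow> (\<Sum>x\<in>X. \<bar>v x\<bar> powr p) \<le> C) \<Longrightarrow> lp_le p A v C"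
  by (auto simp: lp_le_def)

lemma lp_le_nonneg: "lp_le p A v C \<Longrightarrow> C \<ge> 0"
  using lp_leD[of p A v C "{}"] by simp

lemma lp_le_mono: "lp_le p A v C \<Longrightarrow> C \<le> C' \<Longrightarrow> lp_le p A v C'"
  unfolding lp_le_def by force

lemma lp_le_cong: "(\<And>x. x \<in> A \<Longrightarrow> u x = v x) \<Longrightarrow> lp_le p A u C \<longleftrightarrow> lp_le p A v C"
  unfolding lp_le_def by (intro all_cong imp_cong refl arg_cong2[where f="(\<le>)"] sum.cong) auto

lemma lp_le_reindex:
  assumes "lp_le p A v C" "inj_on h B" "h ` B \<subseteq> A"
  shows "lp_le p B (\<lambda>x. v (h x)) C"
proof (rule lp_leI)
  fix X assume X: "finite X" "X \<subseteq> B"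
  have "(\<Sum>x\<in>X. \<bar>v (h x)\<bar> powr p) = (\<Sum>y\<in>h ` X. \<bar>v y\<bar> powr p)"
    by (subst sum.reindex) (use assms X in \<open>auto intro: inj_on_subset\<close>)
  also have "\<dots> \<le> C"
    by (rule lp_leD[OF assms(1)]) (use X assms in auto)
  finally show "(\<Sum>x\<in>X. \<bar>v (h x)\<bar> powr p) \<le> C" .
qed

text \<open>
  Minkowski's inequality for functions with a common norm bound, read for \<open>p\<close>-th powers of norms.
\<close>

lemma lp_le_sum:
  assumes "finite I" "\<And>i. i \<in> I \<Longrightarrow> lp_le p A (v i) C" "p \<ge> 1"
  shows "lp_le p A (\<lambda>x. \<Sum>i\<in>I. v i x) (real (card I) powr p * C)"
proof (cases "I = {}")
  case True
  then show ?thesis using assms(3) by (auto simp: lp_le_def)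
next
  case False
  then have cI: "real (card I) > 0" using assms(1) by (simp add: card_gt_0_iff)
  show ?thesis
  proof (rule lp_leI)
    fix X assume X: "finite X" "X \<subseteq> A"
    have "(\<Sum>x\<in>X. \<bar>\<Sum>i\<in>I. v i x\<bar> powr p)
        \<le> (\<Sum>x\<in>X. real (card I) powr (p - 1) * (\<Sum>i\<in>I. \<bar>v i x\<bar> powr p))"
      by (intro sum_mono powr_abs_sum_le) (use assms in auto)
    also have "\<dots> = real (card I) powr (p - 1) * (\<Sum>i\<in>I. \<Sum>x\<in>X. \<bar>v i x\<bar> powr p)"
      by (simp add: sum_distrib_left[symmetric] sum.swap[of _ I])
    also have "\<dots> \<le> real (card I) powr (p - 1) * (\<Sum>i\<in>I. C)"
      by (intro mult_left_mono sum_mono lp_leD[OF assms(2)]) (use X in auto)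
    also have "\<dots> = real (card I) powr p * C"
      using cI by (simp add: powr_diff)
    finally show "(\<Sum>x\<in>X. \<bar>\<Sum>i\<in>I. v i x\<bar> powr p) \<le> real (card I) powr p * C" .
  qed
qed

lemma lp_le_add:
  assumes "lp_le p A u C" "lp_le p A v D" "p \<ge> 1"
  shows "lp_le p A (\<lambda>x. u x + v x) (2 powr p * (C + D))"
proof (rule lp_leI)
  fix X assume X: "finite X" "X \<subseteq> A"
  have "(\<Sum>x\<in>X. \<bar>u x + v x\<bar> powr p)
      \<le> (\<Sum>x\<in>X. 2 powr p * (\<bar>u x\<bar> powr p + \<bar>v x\<bar> powr p))"
    by (intro sum_mono powr_abs_add_le assms)
  also have "\<dots> = 2 powr p * ((\<Sum>x\<in>X. \<bar>u x\<bar> powr p) + (\<Sum>x\<in>X. \<bar>v x\<bar> powr p))"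
    by (simp add: sum_distrib_left[symmetric] sum.distrib)
  also have "\<dots> \<le> 2 powr p * (C + D)"
    by (intro mult_left_mono add_mono lp_leD[OF assms(1)] lp_leD[OF assms(2)] X) auto
  finally show "(\<Sum>x\<in>X. \<bar>u x + v x\<bar> powr p) \<le> 2 powr p * (C + D)" .
qed

lemma lp_le_uminus: "lp_le p A v C \<Longrightarrow> lp_le p A (\<lambda>x. - v x) C"
  by (simp add: lp_le_def)

lemma lp_le_diff:
  assumes "lp_le p A u C" "lp_le p A v D" "p \<ge> 1"
  shows "lp_le p A (\<lambda>x. u x - v x) (2 powr p * (C + D))"
  using lp_le_add[OF assms(1) lp_le_uminus[OF assms(2)] assms(3)] by simp

lemma lp_le_divide:
  assumes "lp_le p A v C" "m > 0"
  shows "lp_le p A (\<lambda>x. v x / m) (C / m powr p)"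
proof (rule lp_leI)
  fix X assume X: "finite X" "X \<subseteq> A"
  have "(\<Sum>x\<in>X. \<bar>v x / m\<bar> powr p) = (\<Sum>x\<in>X. \<bar>v x\<bar> powr p) / m powr p"
    using assms(2) by (simp add: powr_divide sum_divide_distrib abs_divide)
  also have "\<dots> \<le> C / m powr p"
    by (intro divide_right_mono lp_leD[OF assms(1)] X) auto
  finally show "(\<Sum>x\<in>X. \<bar>v x / m\<bar> powr p) \<le> C / m powr p" .
qed

lemma lp_le_finite_support:
  assumes "finite Z" "\<And>x. x \<in> A - Z \<Longrightarrow> v x = 0"
  shows "lp_le p A v (\<Sum>x\<in>Z. \<bar>v x\<bar> powr p)"
proof (rule lp_leI)
  fix X assume X: "finite X" "X \<subseteq> A"
  have "(\<Sum>x\<in>X. \<bar>v x\<bar> powr p) = (\<Sum>x\<in>X \<inter> Z. \<bar>v x\<bar> powr p)"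
    by (rule sum.mono_neutral_right) (use X assms in auto)
  also have "\<dots> \<le> (\<Sum>x\<in>Z. \<bar>v x\<bar> powr p)"
    by (rule sum_mono2) (use assms in auto)
  finally show "(\<Sum>x\<in>X. \<bar>v x\<bar> powr p) \<le> (\<Sum>x\<in>Z. \<bar>v x\<bar> powr p)" .
qed

text \<open>
  A finite set on which the sum of \<open>p\<close>-th powers is within \<open>\<epsilon>\<close> of its supremum leaves only \<open>\<epsilon>\<close> for
  the complement.
\<close>

lemma lp_le_tail:
  assumes "lp_le p A v C" "\<epsilon> > 0"
  obtains Z where "finite Z" "Z \<subseteq> A" "lp_le p (A - Z) v \<epsilon>"
proof -
  define T where "T = (\<lambda>X. \<Sum>x\<in>X. \<bar>v x\<bar> powr p) ` {X. finite X \<and> X \<subseteq> A}"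
  have bdd: "bdd_above T" using assms(1) by (auto simp: T_def lp_le_def intro!: bdd_aboveI)
  have ne: "T \<noteq> {}" by (auto simp: T_def)
  obtain Z where Z: "finite Z" "Z \<subseteq> A" "Sup T - \<epsilon> < (\<Sum>x\<in>Z. \<bar>v x\<bar> powr p)"
    using less_cSup_iff[OF ne bdd, of "Sup T - \<epsilon>"] assms(2) by (auto simp: T_def)
  have "lp_le p (A - Z) v \<epsilon>"
  proof (rule lp_leI)
    fix X assume X: "finite X" "X \<subseteq> A - Z"
    have "(\<Sum>x\<in>X \<union> Z. \<bar>v x\<bar> powr p) \<le> Sup T"
      by (rule cSup_upper[OF _ bdd]) (use X Z in \<open>auto simp: T_def\<close>)
    moreover have "(\<Sum>x\<in>X \<union> Z. \<bar>v x\<bar> powr p)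
        = (\<Sum>x\<in>X. \<bar>v x\<bar> powr p) + (\<Sum>x\<in>Z. \<bar>v x\<bar> powr p)"
      by (rule sum.union_disjoint) (use X Z in auto)
    ultimately show "(\<Sum>x\<in>X. \<bar>v x\<bar> powr p) \<le> \<epsilon>" using Z(3) by simp
  qed
  then show ?thesis using that Z by blast
qed

lemma lp_le_vanishes:
  assumes "lp_le p A v C" "p \<ge> 1"
  shows "vanishes_at_infinity A v"
  unfolding vanishes_at_infinity_def
proof (intro allI impI)
  fix \<epsilon> :: real assume e: "\<epsilon> > 0"
  obtain Z where Z: "finite Z" "Z \<subseteq> A" "lp_le p (A - Z) v (\<epsilon> powr p / 2)"
    using lp_le_tail[OF assms(1), of "\<epsilon> powr p / 2"] e by auto
  have "x \<in> Z" if x: "x \<in> A" "\<epsilon> \<le> \<bar>v x\<bar>" for x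
  proof (rule ccontr)
    assume "x \<notin> Z"
    then have "\<bar>v x\<bar> powr p \<le> \<epsilon> powr p / 2"
      using lp_leD[OF Z(3), of "{x}"] x by simp
    moreover have "\<epsilon> powr p \<le> \<bar>v x\<bar> powr p"
      by (rule powr_mono2) (use e x assms in auto)
    moreover have "\<epsilon> powr p > 0" using e by simp
    ultimately show False by linarith
  qed
  then show "finite {x \<in> A. \<epsilon> \<le> \<bar>v x\<bar>}"
    using Z(1) by (auto intro: finite_subset)
qed

lemma lp_le_imp_lp_space: "lp_le p A v C \<Longrightarrow> v \<in> lp_space p A"
  unfolding lp_space_def lp_le_def
  by (auto intro!: nonneg_bdd_above_summable_on bdd_aboveI[where M=C])

lemma lp_space_imp_lp_le:
  "v \<in> lp_space p A \<Longrightarrow> lp_le p A v (\<Sum>\<^sub>\<infinity>i\<in>A. \<bar>v i\<bar> powr p)"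
  unfolding lp_space_def by (auto intro!: lp_leI finite_sum_le_infsum)

lemma lp_norm_le:
  assumes "lp_le p A v C" "p \<ge> 1"
  shows "lp_norm p A v \<le> C powr (1 / p)"
proof -
  have s: "(\<lambda>i. \<bar>v i\<bar> powr p) summable_on A"
    using lp_le_imp_lp_space[OF assms(1)] by (simp add: lp_space_def)
  show ?thesis unfolding lp_norm_def
    by (intro powr_mono2 infsum_le_finite_sums s infsum_nonneg)
      (use assms in \<open>auto simp: lp_le_def\<close>)
qed

text \<open>
  The source of all decay in the case of fast growth: by Jensen's inequality, the mean of an \<open>\<ell>\<^sup>p\<close>
  function over \<open>N\<close> distinct points is \<open>O(N^(-1/p))\<close>, wherever the points are.
\<close>

lemma lp_le_mean_le:
  assumes "lp_le p A v C" "finite I" "inj_on h I" "h ` I \<subseteq> A" "p \<ge> 1" "I \<noteq> {}"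
  shows "\<bar>(\<Sum>i\<in>I. v (h i)) / real (card I)\<bar> powr p \<le> C / real (card I)"
proof -
  have c: "real (card I) > 0" using assms by (simp add: card_gt_0_iff)
  have "\<bar>(\<Sum>i\<in>I. v (h i)) / real (card I)\<bar> powr p = \<bar>\<Sum>i\<in>I. v (h i)\<bar> powr p / real (card I) powr p"
    using c by (simp add: powr_divide abs_divide)
  also have "\<dots> \<le> real (card I) powr (p - 1) * (\<Sum>i\<in>I. \<bar>v (h i)\<bar> powr p) / real (card I) powr p"
    by (intro divide_right_mono powr_abs_sum_le assms) auto
  also have "\<dots> = (\<Sum>i\<in>I. \<bar>v (h i)\<bar> powr p) / real (card I)"
    using c by (simp add: powr_diff)
  also have "\<dots> \<le> C / real (card I)"
    by (intro divide_right_mono lp_leD[OF lp_le_reindex[OF assms(1,3,4)]]) (use assms in auto)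
  finally show ?thesis .
qed

lemma abs_mean_le:
  fixes u :: "'i \<Rightarrow> real"
  assumes "I \<noteq> {}" "finite I" "\<And>i. i \<in> I \<Longrightarrow> \<bar>u i\<bar> \<le> e"
  shows "\<bar>(\<Sum>i\<in>I. u i) / real (card I)\<bar> \<le> e"
proof -
  have c: "real (card I) > 0" using assms by (simp add: card_gt_0_iff)
  have "\<bar>\<Sum>i\<in>I. u i\<bar> \<le> (\<Sum>i\<in>I. \<bar>u i\<bar>)" by (rule sum_abs)
  also have "\<dots> \<le> real (card I) * e" using sum_bounded_above[of I "\<lambda>i. \<bar>u i\<bar>" e] assms(3) by simp
  finally show ?thesis using c by (simp add: abs_divide pos_divide_le_eq mult.commute)
qed

lemma vanishes_at_infinity_abs_mono:
  assumes "vanishes_at_infinity A v" "\<And>x. x \<in> A \<Longrightarrow> \<bar>u x\<bar> \<le> \<bar>v x\<bar>"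
  shows "vanishes_at_infinity A u"
  unfolding vanishes_at_infinity_def
proof (intro allI impI)
  fix \<epsilon> :: real assume "\<epsilon> > 0"
  then have "finite {x\<in>A. \<epsilon> \<le> \<bar>v x\<bar>}" using assms(1) by (auto simp: vanishes_at_infinity_def)
  moreover have "{x\<in>A. \<epsilon> \<le> \<bar>u x\<bar>} \<subseteq> {x\<in>A. \<epsilon> \<le> \<bar>v x\<bar>}" using assms(2) by force
  ultimately show "finite {x\<in>A. \<epsilon> \<le> \<bar>u x\<bar>}" by (rule rev_finite_subset)
qed

lemma vanishes_at_infinity_reindex:
  assumes "vanishes_at_infinity A v" "inj_on h B" "h ` B \<subseteq> A"
  shows "vanishes_at_infinity B (\<lambda>x. v (h x))"
  unfolding vanishes_at_infinity_def
proof (intro allI impI)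
  fix \<epsilon> :: real assume "\<epsilon> > 0"
  then have f: "finite {x\<in>A. \<epsilon> \<le> \<bar>v x\<bar>}" using assms(1) by (auto simp: vanishes_at_infinity_def)
  have "h ` {x\<in>B. \<epsilon> \<le> \<bar>v (h x)\<bar>} \<subseteq> {x\<in>A. \<epsilon> \<le> \<bar>v x\<bar>}" using assms(3) by auto
  then have "finite (h ` {x\<in>B. \<epsilon> \<le> \<bar>v (h x)\<bar>})" using f by (rule finite_subset)
  then show "finite {x\<in>B. \<epsilon> \<le> \<bar>v (h x)\<bar>}"
    by (rule finite_imageD) (use assms(2) in \<open>auto intro: inj_on_subset\<close>)
qed

lemma vanishes_at_infinity_add:
  assumes "vanishes_at_infinity A u" "vanishes_at_infinity A v"
  shows "vanishes_at_infinity A (\<lambda>x. u x + v x)"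
  unfolding vanishes_at_infinity_def
proof (intro allI impI)
  fix \<epsilon> :: real assume "\<epsilon> > 0"
  then have "finite ({x\<in>A. \<epsilon>/2 \<le> \<bar>u x\<bar>} \<union> {x\<in>A. \<epsilon>/2 \<le> \<bar>v x\<bar>})"
    using assms by (intro finite_UnI vanishes_at_infinityD) auto
  moreover have "{x\<in>A. \<epsilon> \<le> \<bar>u x + v x\<bar>} \<subseteq> {x\<in>A. \<epsilon>/2 \<le> \<bar>u x\<bar>} \<union> {x\<in>A. \<epsilon>/2 \<le> \<bar>v x\<bar>}" by auto
  ultimately show "finite {x\<in>A. \<epsilon> \<le> \<bar>u x + v x\<bar>}" by (rule rev_finite_subset)
qed

lemma vanishes_at_infinity_zero: "vanishes_at_infinity A (\<lambda>x. 0)"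
  by (simp add: vanishes_at_infinity_def)

lemma vanishes_at_infinity_sum:
  assumes "\<And>i. i \<in> I \<Longrightarrow> vanishes_at_infinity A (v i)"
  shows "vanishes_at_infinity A (\<lambda>x. \<Sum>i\<in>I. v i x)"
  using assms
  by (induction I rule: infinite_finite_induct)
    (auto simp: vanishes_at_infinity_zero intro: vanishes_at_infinity_add)

lemma vanishes_at_infinity_divide:
  assumes "vanishes_at_infinity A v" "m > 0"
  shows "vanishes_at_infinity A (\<lambda>x. v x / m)"
  unfolding vanishes_at_infinity_def
proof (intro allI impI)
  fix \<epsilon> :: real assume "\<epsilon> > 0"
  then have "finite {x\<in>A. \<epsilon> * m \<le> \<bar>v x\<bar>}" using assms by (auto simp: vanishes_at_infinity_def)
  then show "finite {x\<in>A. \<epsilon> \<le> \<bar>v x / m\<bar>}" using assms(2) by (simp add: abs_divide field_simps)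
qed

lemma vanishes_at_infinity_uniform_limit:
  assumes "\<And>\<epsilon>. \<epsilon> > 0 \<Longrightarrow> \<exists>u. vanishes_at_infinity A u \<and> (\<forall>x\<in>A. \<bar>v x - u x\<bar> \<le> \<epsilon>)"
  shows "vanishes_at_infinity A v"
  unfolding vanishes_at_infinity_def
proof (intro allI impI)
  fix \<epsilon> :: real assume "\<epsilon> > 0"
  then obtain u where u: "vanishes_at_infinity A u" "\<forall>x\<in>A. \<bar>v x - u x\<bar> \<le> \<epsilon>/2"
    using assms[of "\<epsilon>/2"] by auto
  have "finite {x\<in>A. \<epsilon>/2 \<le> \<bar>u x\<bar>}" using u(1) \<open>\<epsilon> > 0\<close> by (intro vanishes_at_infinityD) auto
  moreover have "{x\<in>A. \<epsilon> \<le> \<bar>v x\<bar>} \<subseteq> {x\<in>A. \<epsilon>/2 \<le> \<bar>u x\<bar>}"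
  proof
    fix x assume "x \<in> {x\<in>A. \<epsilon> \<le> \<bar>v x\<bar>}"
    then have x: "x \<in> A" "\<epsilon> \<le> \<bar>v x\<bar>" by auto
    then have "\<epsilon>/2 \<le> \<bar>u x\<bar>" using bspec[OF u(2) x(1)] by linarith
    then show "x \<in> {x\<in>A. \<epsilon>/2 \<le> \<bar>u x\<bar>}" using x by simp
  qed
  ultimately show "finite {x\<in>A. \<epsilon> \<le> \<bar>v x\<bar>}" by (rule rev_finite_subset)
qed

lemma vanishes_at_infinity_sequence:
  assumes "vanishes_at_infinity A v" "inj h" "\<And>n. h n \<in> A"
  shows "(\<lambda>n::nat. v (h n)) \<longlonglongrightarrow> 0"
proof (rule LIMSEQ_I)
  fix r :: real assume "0 < r"
  have "vanishes_at_infinity UNIV (\<lambda>n. v (h n))"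
    by (rule vanishes_at_infinity_reindex[OF assms(1)]) (use assms in auto)
  then have "finite {n. r \<le> \<bar>v (h n)\<bar>}" using \<open>0 < r\<close> by (auto simp: vanishes_at_infinity_def)
  then obtain N where "\<forall>n\<in>{n. r \<le> \<bar>v (h n)\<bar>}. n < N" using finite_nat_set_iff_bounded by blast
  then show "\<exists>no. \<forall>n\<ge>no. norm (v (h n) - 0) < r" by (intro exI[of _ N]) (auto simp: not_le[symmetric])
qed

section \<open>Word balls, geodesics and increments\<close>

text \<open>
  The set \<open>W\<close> need not generate \<open>G\<close>: for the factors of a product these are the balls of the
  subgroup that \<open>W\<close> generates.
\<close>

primrec word_ball :: "('a, 'b) monoid_scheme \<Rightarrow> 'a set \<Rightarrow> nat \<Rightarrow> 'a set" where
  "word_ball G W 0 = {\<one>\<^bsub>G\<^esub>}"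
| "word_ball G W (Suc n) = (\<lambda>(x, s). x \<otimes>\<^bsub>G\<^esub> s) ` (word_ball G W n \<times> W)"

text \<open>
  Right multiplication, so that the increments in the directions of the generators are the values of
  the gradient on the edges of the Cayley graph.
\<close>

definition increment :: "('a, 'b) monoid_scheme \<Rightarrow> ('a \<Rightarrow> real) \<Rightarrow> 'a \<Rightarrow> 'a \<Rightarrow> real" where
  "increment G f y = (\<lambda>g. f (g \<otimes>\<^bsub>G\<^esub> y) - f g)"

text \<open>
  Quantifying over all directions makes this condition independent of a generating set; by
  \<open>finite_energy_iff_generators\<close> below, generators suffice.
\<close>

definition finite_energy :: "real \<Rightarrow> ('a, 'b) monoid_scheme \<Rightarrow> ('a \<Rightarrow> real) \<Rightarrow> bool" where
  "finite_energy p G f \<longleftrightarrow> (\<forall>y\<in>carrier G. \<exists>C. lp_le p (carrier G) (increment G f y) C)"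

context group
begin

lemma inj_on_right_mult: "y \<in> carrier G \<Longrightarrow> X \<subseteq> carrier G \<Longrightarrow> inj_on (\<lambda>g. g \<otimes> y) X"
  by (rule inj_onI) (auto simp: subset_iff)

lemma inj_on_left_mult: "y \<in> carrier G \<Longrightarrow> X \<subseteq> carrier G \<Longrightarrow> inj_on (\<lambda>g. y \<otimes> g) X"
  by (rule inj_onI) (auto simp: subset_iff)

lemma lp_le_right_translate:
  "lp_le p (carrier G) v C \<Longrightarrow> y \<in> carrier G \<Longrightarrow> lp_le p (carrier G) (\<lambda>g. v (g \<otimes> y)) C"
  by (rule lp_le_reindex) (auto intro!: inj_on_right_mult)

lemma vanishes_at_infinity_right_translate:
  "vanishes_at_infinity (carrier G) v \<Longrightarrow> y \<in> carrier G \<Longrightarrow>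
    vanishes_at_infinity (carrier G) (\<lambda>g. v (g \<otimes> y))"
  by (rule vanishes_at_infinity_reindex) (auto intro!: inj_on_right_mult)

lemma mult_inv_mult: "x \<in> carrier G \<Longrightarrow> y \<in> carrier G \<Longrightarrow> x \<otimes> (inv x \<otimes> y) = y"
  by (simp add: m_assoc[symmetric])

lemma increment_mult:
  assumes "x \<in> carrier G" "y \<in> carrier G" "g \<in> carrier G"
  shows "increment G f (x \<otimes> y) g = increment G f x g + increment G f y (g \<otimes> x)"
  using assms by (simp add: increment_def m_assoc)

lemma finite_energy_vanishes:
  "finite_energy p G f \<Longrightarrow> p \<ge> 1 \<Longrightarrow> y \<in> carrier G \<Longrightarrow>
    vanishes_at_infinity (carrier G) (increment G f y)"
  unfolding finite_energy_def by (blast intro: lp_le_vanishes)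

lemma word_ball_subset_carrier: "W \<subseteq> carrier G \<Longrightarrow> word_ball G W n \<subseteq> carrier G"
  by (induction n) auto

lemma finite_word_ball: "finite W \<Longrightarrow> finite (word_ball G W n)"
  by (induction n) auto

lemma word_ball_mono_Suc:
  assumes "W \<subseteq> carrier G" "\<one> \<in> W"
  shows "word_ball G W n \<subseteq> word_ball G W (Suc n)"
proof
  fix x assume x: "x \<in> word_ball G W n"
  then have "x = x \<otimes> \<one>" using word_ball_subset_carrier[OF assms(1), of n] by auto
  then show "x \<in> word_ball G W (Suc n)" using x assms(2) by (force simp: image_iff)
qed

lemma word_ball_mono:
  assumes "W \<subseteq> carrier G" "\<one> \<in> W" "m \<le> n"
  shows "word_ball G W m \<subseteq> word_ball G W n"
  using lift_Suc_mono_le[of "word_ball G W", OF word_ball_mono_Suc[OF assms(1,2)] assms(3)] .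

lemma one_in_word_ball: "W \<subseteq> carrier G \<Longrightarrow> \<one> \<in> W \<Longrightarrow> \<one> \<in> word_ball G W n"
  using word_ball_mono[of W 0 n] by simp

lemma word_ball_SucI: "x \<in> word_ball G W n \<Longrightarrow> s \<in> W \<Longrightarrow> x \<otimes> s \<in> word_ball G W (Suc n)"
  by force

lemma word_ball_one: "W \<subseteq> carrier G \<Longrightarrow> word_ball G W (Suc 0) = W"
  by force

lemma word_ball_mult:
  assumes "W \<subseteq> carrier G" "x \<in> word_ball G W m" "y \<in> word_ball G W n"
  shows "x \<otimes> y \<in> word_ball G W (m + n)"
  using assms(3)
proof (induction n arbitrary: y)
  case 0
  then show ?case using assms word_ball_subset_carrier[OF assms(1), of m] by auto
next
  case (Suc n)
  then obtain z s where z: "z \<in> word_ball G W n" "s \<in> W" "y = z \<otimes> s" by auto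
  have "x \<in> carrier G" "z \<in> carrier G" "s \<in> carrier G"
    using z assms word_ball_subset_carrier[OF assms(1)] by blast+
  then have "x \<otimes> y = (x \<otimes> z) \<otimes> s"
    using z(3) by (simp add: m_assoc)
  then show ?case using Suc.IH[OF z(1)] z(2) word_ball_SucI by simp
qed

lemma word_ball_Suc_left:
  assumes "W \<subseteq> carrier G" "s \<in> W" "y \<in> word_ball G W n"
  shows "s \<otimes> y \<in> word_ball G W (Suc n)"
  using word_ball_mult[OF assms(1), of s "Suc 0" y n] assms word_ball_one[OF assms(1)] by simp

lemma word_ball_inv:
  assumes "W \<subseteq> carrier G" "\<And>s. s \<in> W \<Longrightarrow> inv s \<in> W" "x \<in> word_ball G W n"
  shows "inv x \<in> word_ball G W n"
  using assms(3)
proof (induction n arbitrary: x)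
  case 0
  then show ?case by auto
next
  case (Suc n)
  then obtain z s where z: "z \<in> word_ball G W n" "s \<in> W" "x = z \<otimes> s" by auto
  have "z \<in> carrier G" "s \<in> carrier G"
    using z assms(1) word_ball_subset_carrier[OF assms(1)] by blast+
  then have "inv x = inv s \<otimes> inv z"
    using z(3) by (simp add: inv_mult_group)
  then show ?case using word_ball_Suc_left[OF assms(1) assms(2)[OF z(2)] Suc.IH[OF z(1)]] by simp
qed

lemma generate_subset_word_balls:
  assumes "W \<subseteq> carrier G" "\<one> \<in> W" "\<And>s. s \<in> W \<Longrightarrow> inv s \<in> W" "S \<subseteq> W"
  shows "generate G S \<subseteq> (\<Union>n. word_ball G W n)"
proof
  fix x assume "x \<in> generate G S"
  then show "x \<in> (\<Union>n. word_ball G W n)"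
  proof induction
    case one
    then show ?case using one_in_word_ball[OF assms(1,2)] by auto
  next
    case (incl h)
    then show ?case using word_ball_one[OF assms(1)] assms(4) by blast
  next
    case (inv h)
    then show ?case using word_ball_one[OF assms(1)] assms(3,4) by blast
  next
    case (eng x y)
    then show ?case using word_ball_mult[OF assms(1)] by blast
  qed
qed

lemma geodesic_aux:
  assumes "W \<subseteq> carrier G" "\<one> \<in> W"
  shows "g \<in> word_ball G W n \<Longrightarrow> (\<And>m. m < n \<Longrightarrow> g \<notin> word_ball G W m) \<Longrightarrow>
    \<exists>w. w 0 = \<one> \<and> w n = g \<and> (\<forall>i\<le>n. w i \<in> word_ball G W i \<and> (\<forall>m<i. w i \<notin> word_ball G W m)) \<and>
      (\<forall>i<n. \<exists>s\<in>W. w (Suc i) = w i \<otimes> s)"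
proof (induction n arbitrary: g)
  case 0
  then show ?case by (intro exI[of _ "\<lambda>_. \<one>"]) auto
next
  case (Suc n)
  then obtain x s where x: "x \<in> word_ball G W n" "s \<in> W" "g = x \<otimes> s" by auto
  have min: "x \<notin> word_ball G W m" if "m < n" for m
    using Suc.prems(2)[of "Suc m"] word_ball_SucI[of x W m s] x that by auto
  obtain w where w: "w 0 = \<one>" "w n = x"
      "\<forall>i\<le>n. w i \<in> word_ball G W i \<and> (\<forall>m<i. w i \<notin> word_ball G W m)"
      "\<forall>i<n. \<exists>s\<in>W. w (Suc i) = w i \<otimes> s"
    using Suc.IH[OF x(1) min] by blast
  show ?case
  proof (intro exI[of _ "w(Suc n := g)"] conjI allI impI)
    fix i assume "i < Suc n"
    then show "\<exists>s\<in>W. (w(Suc n := g)) (Suc i) = (w(Suc n := g)) i \<otimes> s"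
      using w(2,4) x by (cases "i = n") auto
  qed (use w Suc.prems in \<open>auto simp: le_Suc_eq simp del: word_ball.simps\<close>)
qed

text \<open>
  A shortest word has pairwise different prefixes, since the \<open>i\<close>-th one has length exactly \<open>i\<close>.  This is
  the only property of geodesics that matters: along a translate \<open>\<lambda>i. g \<otimes> w i\<close> a function on the
  group is never evaluated twice at the same point.
\<close>

lemma geodesic:
  assumes "W \<subseteq> carrier G" "\<one> \<in> W" "g \<in> word_ball G W n"
  obtains m w s where "m \<le> n" "w 0 = \<one>" "w m = g" "inj_on w {..m}"
    "\<And>i. i \<le> m \<Longrightarrow> w i \<in> word_ball G W i"
    "\<And>i. i < m \<Longrightarrow> s i \<in> W" "\<And>i. i < m \<Longrightarrow> w (Suc i) = w i \<otimes> s i"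
proof -
  define m where "m = (LEAST m. g \<in> word_ball G W m)"
  have m: "g \<in> word_ball G W m" "m \<le> n"
    unfolding m_def using assms(3) by (auto intro: LeastI Least_le)
  have min: "g \<notin> word_ball G W k" if "k < m" for k
    using that not_less_Least unfolding m_def by blast
  obtain w where w: "w 0 = \<one>" "w m = g"
      "\<forall>i\<le>m. w i \<in> word_ball G W i \<and> (\<forall>k<i. w i \<notin> word_ball G W k)"
      "\<forall>i<m. \<exists>s\<in>W. w (Suc i) = w i \<otimes> s"
    using geodesic_aux[OF assms(1,2) m(1) min] by blast
  obtain s where s: "\<forall>i<m. s i \<in> W \<and> w (Suc i) = w i \<otimes> s i"
    using w(4) by metis
  have "inj_on w {..m}"
  proof (rule inj_onI)
    fix i j assume ij: "i \<in> {..m}" "j \<in> {..m}" "w i = w j"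
    have "\<not> i < j" "\<not> j < i"
      using w(3)[rule_format, of j] w(3)[rule_format, of i] ij by auto
    then show "i = j" by simp
  qed
  then show ?thesis using that[of m w s] m w s by blast
qed

text \<open>
  The cocycle identity \<open>increment_mult\<close>, summed along a path that starts at the identity.
\<close>

lemma increment_path:
  fixes m :: nat
  assumes "w 0 = \<one>" "\<And>i. i < m \<Longrightarrow> w (Suc i) = w i \<otimes> s i"
    "\<And>i. i \<le> m \<Longrightarrow> w i \<in> carrier G" "\<And>i. i < m \<Longrightarrow> s i \<in> carrier G" "g \<in> carrier G"
  shows "increment G f (w m) g = (\<Sum>i<m. increment G f (s i) (g \<otimes> w i))"
  using assms(2-4)
proof (induction m)
  case 0
  then show ?case using assms by (simp add: increment_def)
next
  case (Suc m)
  have "increment G f (w (Suc m)) g = increment G f (w m \<otimes> s m) g"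
    using Suc.prems(1)[of m] by simp
  also have "\<dots> = increment G f (w m) g + increment G f (s m) (g \<otimes> w m)"
    by (rule increment_mult) (use Suc.prems assms(5) in auto)
  finally show ?case using Suc by simp
qed

end

locale cayley = group G for G (structure) +
  fixes W
  assumes finite_W: "finite W" and W_subset: "W \<subseteq> carrier G" and one_in_W: "\<one> \<in> W"
    and inv_in_W: "s \<in> W \<Longrightarrow> inv s \<in> W"
    and word_balls_exhaust: "carrier G = (\<Union>n. word_ball G W n)"
begin

abbreviation ball :: "nat \<Rightarrow> 'a set" where "ball \<equiv> word_ball G W"
abbreviation vol :: "nat \<Rightarrow> real" where "vol n \<equiv> real (card (ball n))"

lemmas ball_subset_carrier = word_ball_subset_carrier[OF W_subset]
lemmas finite_ball = finite_word_ball[OF finite_W]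
lemmas ball_mono = word_ball_mono[OF W_subset one_in_W]
lemmas one_in_ball = one_in_word_ball[OF W_subset one_in_W]

lemma in_carrier_of_ball: "x \<in> ball n \<Longrightarrow> x \<in> carrier G"
  using ball_subset_carrier by blast

lemma in_carrier_of_W: "s \<in> W \<Longrightarrow> s \<in> carrier G"
  using W_subset by blast

lemma card_ball_pos: "card (ball n) > 0"
  using one_in_ball finite_ball by (auto simp: card_gt_0_iff)

lemma finite_subset_ball:
  assumes "finite X" "X \<subseteq> carrier G"
  obtains n where "X \<subseteq> ball n"
proof -
  have "\<forall>x\<in>X. \<exists>n. x \<in> ball n" using assms(2) word_balls_exhaust by auto
  then obtain k where k: "\<forall>x\<in>X. x \<in> ball (k x)" by metis
  have "x \<in> ball (Max (k ` X))" if "x \<in> X" for x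
    using k ball_mono[of "k x" "Max (k ` X)"] assms(1) that by auto
  then have "X \<subseteq> ball (Max (k ` X))" by blast
  then show ?thesis using that by blast
qed

lemma card_ball_unbounded:
  assumes "infinite (carrier G)"
  obtains n where "card (ball n) \<ge> N"
proof -
  obtain X where X: "X \<subseteq> carrier G" "finite X" "card X = N"
    using infinite_arbitrarily_large[OF assms] by blast
  obtain n where "X \<subseteq> ball n" using finite_subset_ball[OF X(2,1)] by blast
  then show ?thesis using that card_mono[OF finite_ball] X(3) by metis
qed

text \<open>
  The triangle inequality along a path of generators from the identity to \<open>y\<close>.
\<close>

lemma lp_le_increment_ball:
  assumes "\<And>s. s \<in> W \<Longrightarrow> lp_le p (carrier G) (increment G f s) C" "y \<in> ball n" "p \<ge> 1"
  shows "lp_le p (carrier G) (increment G f y) (real n powr p * C)"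
proof -
  obtain m w s where w: "m \<le> n" "w 0 = \<one>" "w m = y" "inj_on w {..m}"
    "\<And>i. i \<le> m \<Longrightarrow> w i \<in> ball i"
    "\<And>i. i < m \<Longrightarrow> s i \<in> W" "\<And>i. i < m \<Longrightarrow> w (Suc i) = w i \<otimes> s i"
    using geodesic[OF W_subset one_in_W assms(2)] by blast
  have wc: "\<And>i. i \<le> m \<Longrightarrow> w i \<in> carrier G" using w(5) in_carrier_of_ball by blast
  have C: "C \<ge> 0" using lp_le_nonneg[OF assms(1)[OF one_in_W]] .
  have "lp_le p (carrier G) (\<lambda>g. \<Sum>i<m. increment G f (s i) (g \<otimes> w i)) (real (card {..<m}) powr p * C)"
    by (intro lp_le_sum lp_le_right_translate assms) (use w wc in auto)
  then have "lp_le p (carrier G) (increment G f y) (real m powr p * C)"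
    using increment_path[of w m s _ f] w wc in_carrier_of_W
    by (subst lp_le_cong[where v="\<lambda>g. \<Sum>i<m. increment G f (s i) (g \<otimes> w i)"]) auto
  then show ?thesis
    by (rule lp_le_mono) (use w C assms(3) in \<open>auto intro!: mult_right_mono powr_mono2\<close>)
qed

lemma finite_energy_iff_generators:
  assumes "p \<ge> 1"
  shows "finite_energy p G f \<longleftrightarrow> (\<exists>C. \<forall>s\<in>W. lp_le p (carrier G) (increment G f s) C)"
proof
  assume "finite_energy p G f"
  then have "\<forall>s\<in>W. \<exists>C. lp_le p (carrier G) (increment G f s) C"
    using in_carrier_of_W by (auto simp: finite_energy_def)
  then obtain C where C: "\<forall>s\<in>W. lp_le p (carrier G) (increment G f s) (C s)" by metis
  have "lp_le p (carrier G) (increment G f s) (Max (C ` W))" if "s \<in> W" for s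
    using lp_le_mono[OF bspec[OF C that]] finite_W that by simp
  then show "\<exists>C. \<forall>s\<in>W. lp_le p (carrier G) (increment G f s) C" by (intro exI ballI)
next
  assume "\<exists>C. \<forall>s\<in>W. lp_le p (carrier G) (increment G f s) C"
  then obtain C where C: "\<And>s. s \<in> W \<Longrightarrow> lp_le p (carrier G) (increment G f s) C" by blast
  show "finite_energy p G f"
    unfolding finite_energy_def
  proof
    fix y assume "y \<in> carrier G"
    then obtain n where "y \<in> ball n" using word_balls_exhaust by blast
    from lp_le_increment_ball[OF C this assms]
    show "\<exists>C. lp_le p (carrier G) (increment G f y) C" by blast
  qed
qed

text \<open>
  For \<open>p > 1\<close> the norm grows slower than linearly.  Write each generator increment as a part that lives
  on a finite set \<open>Z\<close> and a part of norm at most \<open>\<epsilon>^(1/p)\<close>.  Along a geodesic of length \<open>m\<close> the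
  second parts add up to norm at most \<open>m \<epsilon>^(1/p)\<close>.  Of the first parts, at most \<open>card Z\<close> contribute at each
  point because the path never repeats a point, so the \<open>p\<close>-th power of the norm of their sum is
  \<open>O(m)\<close>, instead of the general \<open>O(m\<^sup>p)\<close>.
\<close>

lemma lp_le_increment_sublinear:
  assumes "\<And>s. s \<in> W \<Longrightarrow> lp_le p (carrier G) (increment G f s) C" "p \<ge> 1" "\<epsilon> > 0"
  obtains D where "D \<ge> 0" "\<And>n y. y \<in> ball n \<Longrightarrow>
    lp_le p (carrier G) (increment G f y) (2 powr p * (D * real n + \<epsilon> * real n powr p))"
proof -
  have "\<forall>s\<in>W. \<exists>Z. finite Z \<and> Z \<subseteq> carrier G \<and> lp_le p (carrier G - Z) (increment G f s) \<epsilon>"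
  proof
    fix s assume "s \<in> W"
    from lp_le_tail[OF assms(1)[OF this] assms(3)]
    show "\<exists>Z. finite Z \<and> Z \<subseteq> carrier G \<and> lp_le p (carrier G - Z) (increment G f s) \<epsilon>" by blast
  qed
  then obtain Zs where Zs: "\<And>s. s \<in> W \<Longrightarrow> finite (Zs s) \<and> Zs s \<subseteq> carrier G \<and>
      lp_le p (carrier G - Zs s) (increment G f s) \<epsilon>" by metis
  define Z where "Z = (\<Union>s\<in>W. Zs s)"
  have Z: "finite Z" "Z \<subseteq> carrier G" using Zs finite_W by (auto simp: Z_def)
  have tail: "lp_le p (carrier G - Z) (increment G f s) \<epsilon>" if "s \<in> W" for s
    using Zs[OF that] that by (auto simp: lp_le_def Z_def)
  define D where "D = real (card Z) powr (p - 1) * C"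
  have C: "C \<ge> 0" using lp_le_nonneg[OF assms(1)[OF one_in_W]] .
  have "lp_le p (carrier G) (increment G f y) (2 powr p * (D * real n + \<epsilon> * real n powr p))"
    if y: "y \<in> ball n" for n y
  proof -
    obtain m w s where w: "m \<le> n" "w 0 = \<one>" "w m = y" "inj_on w {..m}"
      "\<And>i. i \<le> m \<Longrightarrow> w i \<in> ball i"
      "\<And>i. i < m \<Longrightarrow> s i \<in> W" "\<And>i. i < m \<Longrightarrow> w (Suc i) = w i \<otimes> s i"
      using geodesic[OF W_subset one_in_W y] by blast
    have wc: "\<And>i. i \<le> m \<Longrightarrow> w i \<in> carrier G" using w(5) in_carrier_of_ball by blast
    define near where "near i x = (if x \<in> Z then increment G f (s i) x else 0)" for i x
    define far where "far i x = (if x \<in> Z then 0 else increment G f (s i) x)" for i x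
    have far: "lp_le p (carrier G) (far i) \<epsilon>" if "i < m" for i
    proof (rule lp_leI)
      fix X assume X: "finite X" "X \<subseteq> carrier G"
      have "(\<Sum>x\<in>X. \<bar>far i x\<bar> powr p) = (\<Sum>x\<in>X - Z. \<bar>increment G f (s i) x\<bar> powr p)"
        by (rule sum.mono_neutral_cong_right) (use X in \<open>auto simp: far_def\<close>)
      also have "\<dots> \<le> \<epsilon>" by (rule lp_leD[OF tail]) (use X w(6)[OF that] in auto)
      finally show "(\<Sum>x\<in>X. \<bar>far i x\<bar> powr p) \<le> \<epsilon>" .
    qed
    have 1: "lp_le p (carrier G) (\<lambda>g. \<Sum>i<m. far i (g \<otimes> w i)) (real (card {..<m}) powr p * \<epsilon>)"
      by (intro lp_le_sum lp_le_right_translate far assms) (use wc in auto)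
    have 2: "lp_le p (carrier G) (\<lambda>g. \<Sum>i<m. near i (g \<otimes> w i)) (D * m)"
    proof (rule lp_leI)
      fix X assume X: "finite X" "X \<subseteq> carrier G"
      have "\<bar>\<Sum>i<m. near i (g \<otimes> w i)\<bar> powr p
          \<le> real (card Z) powr (p - 1) * (\<Sum>i<m. \<bar>increment G f (s i) (g \<otimes> w i)\<bar> powr p)"
        if g: "g \<in> X" for g
      proof -
        define I where "I = {i. i < m \<and> g \<otimes> w i \<in> Z}"
        have "inj_on (\<lambda>i. g \<otimes> w i) I"
          using w(4) inj_on_left_mult[of g "carrier G"] X g wc
          by (auto simp: I_def inj_on_def)
        then have cI: "card I \<le> card Z"
          by (rule card_inj_on_le) (use Z in \<open>auto simp: I_def\<close>)
        have "(\<Sum>i<m. near i (g \<otimes> w i)) = (\<Sum>i\<in>I. near i (g \<otimes> w i))"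
          by (rule sum.mono_neutral_right) (auto simp: I_def near_def)
        then have "\<bar>\<Sum>i<m. near i (g \<otimes> w i)\<bar> powr p
            \<le> real (card I) powr (p - 1) * (\<Sum>i\<in>I. \<bar>near i (g \<otimes> w i)\<bar> powr p)"
          using powr_abs_sum_le[of I p "\<lambda>i. near i (g \<otimes> w i)"] assms(2) by (simp add: I_def)
        also have "\<dots> \<le> real (card Z) powr (p - 1) * (\<Sum>i\<in>I. \<bar>near i (g \<otimes> w i)\<bar> powr p)"
          by (intro mult_right_mono powr_mono2 sum_nonneg) (use cI assms(2) in auto)
        also have "\<dots> \<le> real (card Z) powr (p - 1) * (\<Sum>i<m. \<bar>increment G f (s i) (g \<otimes> w i)\<bar> powr p)"
        proof (intro mult_left_mono)
          have "(\<Sum>i\<in>I. \<bar>near i (g \<otimes> w i)\<bar> powr p)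
              = (\<Sum>i\<in>I. \<bar>increment G f (s i) (g \<otimes> w i)\<bar> powr p)"
            by (rule sum.cong) (auto simp: I_def near_def)
          also have "\<dots> \<le> (\<Sum>i<m. \<bar>increment G f (s i) (g \<otimes> w i)\<bar> powr p)"
            by (rule sum_mono2) (auto simp: I_def)
          finally show "(\<Sum>i\<in>I. \<bar>near i (g \<otimes> w i)\<bar> powr p)
              \<le> (\<Sum>i<m. \<bar>increment G f (s i) (g \<otimes> w i)\<bar> powr p)" .
        qed auto
        finally show ?thesis .
      qed
      then have "(\<Sum>g\<in>X. \<bar>\<Sum>i<m. near i (g \<otimes> w i)\<bar> powr p)
          \<le> (\<Sum>g\<in>X. real (card Z) powr (p - 1) * (\<Sum>i<m. \<bar>increment G f (s i) (g \<otimes> w i)\<bar> powr p))"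
        by (intro sum_mono)
      also have "\<dots> = real (card Z) powr (p - 1) * (\<Sum>i<m. \<Sum>g\<in>X. \<bar>increment G f (s i) (g \<otimes> w i)\<bar> powr p)"
        by (simp add: sum_distrib_left[symmetric] sum.swap[of _ "{..<m}"])
      also have "\<dots> \<le> real (card Z) powr (p - 1) * (\<Sum>i<m. C)"
        by (intro mult_left_mono sum_mono lp_leD[OF lp_le_right_translate[OF assms(1)]])
          (use X w wc in auto)
      also have "\<dots> = D * m" by (simp add: D_def)
      finally show "(\<Sum>g\<in>X. \<bar>\<Sum>i<m. near i (g \<otimes> w i)\<bar> powr p) \<le> D * m" .
    qed
    have "lp_le p (carrier G) (\<lambda>g. (\<Sum>i<m. near i (g \<otimes> w i)) + (\<Sum>i<m. far i (g \<otimes> w i)))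
        (2 powr p * (D * m + real m powr p * \<epsilon>))"
      using lp_le_add[OF 2 1 assms(2)] by simp
    moreover have "increment G f y g = (\<Sum>i<m. near i (g \<otimes> w i)) + (\<Sum>i<m. far i (g \<otimes> w i))"
      if "g \<in> carrier G" for g
      using increment_path[of w m s g f] w wc in_carrier_of_W that
      by (auto simp: near_def far_def sum.distrib[symmetric] intro!: sum.cong)
    ultimately have "lp_le p (carrier G) (increment G f y) (2 powr p * (D * m + real m powr p * \<epsilon>))"
      by (subst lp_le_cong) auto
    then show ?thesis
      by (rule lp_le_mono)
        (use w(1) C assms in \<open>auto simp: D_def mult.commute[of \<epsilon>] intro!: mult_left_mono mult_right_mono add_mono powr_mono2\<close>)
  qed
  then show ?thesis using that[of D] C by (simp add: D_def)
qed

end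

section \<open>Functions that are constant at infinity\<close>

definition constant_at_infinity :: "'i set \<Rightarrow> ('i \<Rightarrow> real) \<Rightarrow> bool" where
  "constant_at_infinity A f \<longleftrightarrow> (\<exists>c. vanishes_at_infinity A (\<lambda>x. f x - c))"

text \<open>
  A Cauchy criterion.  The constant is the limit along an arbitrary injective sequence.
\<close>

lemma constant_at_infinity_of_oscillation:
  assumes "infinite A"
    "\<And>\<epsilon>. \<epsilon> > 0 \<Longrightarrow> \<exists>Z. finite Z \<and> (\<forall>x\<in>A - Z. \<forall>y\<in>A - Z. \<bar>f x - f y\<bar> \<le> \<epsilon>)"
  shows "constant_at_infinity A f"
proof -
  obtain h :: "nat \<Rightarrow> 'a" where h: "inj h" "range h \<subseteq> A"
    using infinite_countable_subset[OF assms(1)] by blast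
  have ev: "\<exists>N. \<forall>n\<ge>N. h n \<notin> Z" if "finite Z" for Z
  proof -
    have "finite (h -` Z)" by (rule finite_vimageI[OF that h(1)])
    then obtain N where "\<forall>n\<in>h -` Z. n < N" using finite_nat_set_iff_bounded by blast
    then show ?thesis by (intro exI[of _ N]) (auto simp: not_less[symmetric])
  qed
  have "Cauchy (\<lambda>n. f (h n))"
  proof (rule metric_CauchyI)
    fix e :: real assume "e > 0"
    then obtain Z where Z: "finite Z" "\<forall>x\<in>A - Z. \<forall>y\<in>A - Z. \<bar>f x - f y\<bar> \<le> e/2"
      using assms(2)[of "e/2"] by auto
    obtain N where N: "\<forall>n\<ge>N. h n \<notin> Z" using ev[OF Z(1)] by blast
    show "\<exists>M. \<forall>m\<ge>M. \<forall>n\<ge>M. dist (f (h m)) (f (h n)) < e"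
    proof (intro exI[of _ N] allI impI)
      fix m n assume "N \<le> m" "N \<le> n"
      then have "h m \<in> A - Z" "h n \<in> A - Z" using N h(2) by auto
      then have "\<bar>f (h m) - f (h n)\<bar> \<le> e/2" using Z(2) by blast
      then show "dist (f (h m)) (f (h n)) < e" using \<open>e > 0\<close> by (simp add: dist_real_def)
    qed
  qed
  then obtain c where c: "(\<lambda>n. f (h n)) \<longlonglongrightarrow> c"
    using Cauchy_convergent_iff convergent_def by blast
  have "vanishes_at_infinity A (\<lambda>x. f x - c)"
    unfolding vanishes_at_infinity_def
  proof (intro allI impI)
    fix \<epsilon> :: real assume e: "\<epsilon> > 0"
    then obtain Z where Z: "finite Z" "\<forall>x\<in>A - Z. \<forall>y\<in>A - Z. \<bar>f x - f y\<bar> \<le> \<epsilon>/2"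
      using assms(2)[of "\<epsilon>/2"] by auto
    obtain N where N: "\<forall>n\<ge>N. h n \<notin> Z" using ev[OF Z(1)] by blast
    have "x \<in> Z" if x: "x \<in> A" "\<epsilon> \<le> \<bar>f x - c\<bar>" for x
    proof (rule ccontr)
      assume "x \<notin> Z"
      have "(\<lambda>n. \<bar>f x - f (h n)\<bar>) \<longlonglongrightarrow> \<bar>f x - c\<bar>"
        by (intro tendsto_intros c)
      then have "\<bar>f x - c\<bar> \<le> \<epsilon>/2"
      proof (rule Lim_bounded[of _ _ N], intro allI impI)
        fix n assume "N \<le> n"
        then have "h n \<in> A - Z" using N h(2) by auto
        then show "\<bar>f x - f (h n)\<bar> \<le> \<epsilon>/2" using Z(2) x(1) \<open>x \<notin> Z\<close> by blast
      qed
      then show False using x(2) e by linarith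
    qed
    then show "finite {x\<in>A. \<epsilon> \<le> \<bar>f x - c\<bar>}"
      using Z(1) by (auto intro: finite_subset)
  qed
  then show ?thesis by (auto simp: constant_at_infinity_def)
qed

context cayley
begin

text \<open>
  Since \<open>W\<close> contains the identity, the mean includes the value at \<open>g\<close> itself.  This does not change
  the class of functions with the property, and it lets the associated random walk stand still, so
  that its support at time \<open>n\<close> is the whole ball of radius \<open>n\<close>.
\<close>

definition mean_value_property :: "('a \<Rightarrow> real) \<Rightarrow> bool" where
  "mean_value_property f \<longleftrightarrow>
    (\<forall>g\<in>carrier G. real (card W) * f g = (\<Sum>s\<in>W. f (g \<otimes> s)))"

text \<open>
  If \<open>f\<close> exceeded \<open>c\<close> somewhere, the set of points with at least that value would be finite, so \<open>f\<close>
  would attain its maximum \<open>M\<close>.  By the mean value property \<open>f\<close> is then \<open>M\<close> at all neighbours of a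
  maximum point, hence everywhere, which contradicts finiteness.
\<close>

lemma maximum_principle:
  assumes "infinite (carrier G)" "mean_value_property f"
    "vanishes_at_infinity (carrier G) (\<lambda>x. f x - c)" "g \<in> carrier G"
  shows "f g \<le> c"
proof (rule ccontr)
  assume "\<not> f g \<le> c"
  then have gc: "f g - c > 0" by simp
  define Y where "Y = {x\<in>carrier G. f g \<le> f x}"
  have "Y \<subseteq> {x\<in>carrier G. f g - c \<le> \<bar>f x - c\<bar>}" by (auto simp: Y_def)
  then have finY: "finite Y"
    using vanishes_at_infinityD[OF assms(3) gc] by (rule finite_subset)
  have gY: "g \<in> Y" using assms(4) by (simp add: Y_def)
  define M where "M = Max (f ` Y)"
  obtain x0 where x0: "x0 \<in> Y" "f x0 = M"
    using Max_in[of "f ` Y"] finY gY unfolding M_def by (metis empty_iff finite_imageI image_iff image_is_empty)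
  have fM: "f x \<le> M" if "x \<in> carrier G" for x
  proof (cases "x \<in> Y")
    case True
    then show ?thesis using finY by (simp add: M_def)
  next
    case False
    then have "f x < f g" using that by (auto simp: Y_def)
    also have "f g \<le> M" using finY gY by (simp add: M_def)
    finally show ?thesis by simp
  qed
  have step: "f (x \<otimes> s) = M" if "x \<in> carrier G" "f x = M" "s \<in> W" for x s
  proof -
    have "(\<Sum>s\<in>W. M - f (x \<otimes> s)) = real (card W) * M - real (card W) * f x"
      using assms(2) that(1) by (simp add: sum_subtractf mean_value_property_def)
    then have "(\<Sum>s\<in>W. M - f (x \<otimes> s)) = 0" using that(2) by simp
    moreover have "M - f (x \<otimes> s) \<ge> 0" if "s \<in> W" for s
      using fM[of "x \<otimes> s"] that \<open>x \<in> carrier G\<close> in_carrier_of_W by simp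
    ultimately show ?thesis
      using sum_nonneg_0[OF finite_W, of "\<lambda>s. M - f (x \<otimes> s)" s] that(3) by simp
  qed
  have x0c: "x0 \<in> carrier G" using x0 by (simp add: Y_def)
  have all: "f (x0 \<otimes> y) = M" if "y \<in> ball n" for n y
    using that
  proof (induction n arbitrary: y)
    case 0
    then show ?case using x0 x0c by simp
  next
    case (Suc n)
    then obtain z s where z: "z \<in> ball n" "s \<in> W" "y = z \<otimes> s" by auto
    have "f ((x0 \<otimes> z) \<otimes> s) = M"
      by (rule step) (use Suc.IH[OF z(1)] z x0c in_carrier_of_ball in auto)
    then show ?case using z x0c in_carrier_of_ball in_carrier_of_W by (simp add: m_assoc)
  qed
  have "carrier G \<subseteq> Y"
  proof
    fix x assume x: "x \<in> carrier G"
    then have "inv x0 \<otimes> x \<in> carrier G" using x0c by simp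
    then obtain n where "inv x0 \<otimes> x \<in> ball n" using word_balls_exhaust by blast
    from all[OF this] have "f x = M" using x x0c by (simp add: m_assoc[symmetric])
    then show "x \<in> Y" using x fM[OF assms(4)] by (simp add: Y_def)
  qed
  then show False using finY assms(1) finite_subset by blast
qed

lemma mean_value_property_constant_at_infinity:
  assumes "infinite (carrier G)" "mean_value_property f" "constant_at_infinity (carrier G) f"
  shows "f constant_on carrier G"
proof -
  obtain c where c: "vanishes_at_infinity (carrier G) (\<lambda>x. f x - c)"
    using assms(3) by (auto simp: constant_at_infinity_def)
  have "mean_value_property (\<lambda>x. - f x)"
    using assms(2) by (simp add: mean_value_property_def sum_negf)
  moreover have "vanishes_at_infinity (carrier G) (\<lambda>x. - f x - - c)"
    by (rule vanishes_at_infinity_abs_mono[OF c]) auto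
  ultimately have "- f g \<le> - c" if "g \<in> carrier G" for g
    using maximum_principle[OF assms(1)] that by blast
  moreover have "f g \<le> c" if "g \<in> carrier G" for g
    using maximum_principle[OF assms(1,2) c that] .
  ultimately have "\<forall>g\<in>carrier G. f g = c" by force
  then show ?thesis by (auto simp: constant_on_def)
qed

text \<open>
  Triviality of the class of \<open>f\<close> in reduced cohomology, in terms of increments.  Constants need not be
  mentioned because increments do not see them.
\<close>

definition lp_approximable :: "real \<Rightarrow> ('a \<Rightarrow> real) \<Rightarrow> bool" where
  "lp_approximable p f \<longleftrightarrow> (\<forall>\<epsilon>>0. \<exists>u. (\<exists>C. lp_le p (carrier G) u C) \<and>
     (\<forall>s\<in>W. lp_le p (carrier G) (increment G (\<lambda>g. f g - u g) s) \<epsilon>))"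

text \<open>
  Let \<open>h\<close> be \<open>f - c\<close> cut off to the interval \<open>{-\<delta>..\<delta>}\<close>.  Then \<open>f - c - h\<close> has finite support.  The
  increments of \<open>h\<close> are dominated by those of \<open>f\<close>, whose tails are small, and are at most \<open>2 * \<delta>\<close> on
  the finite sets that remain.
\<close>

lemma lp_approximable_constant_at_infinity:
  assumes "finite_energy p G f" "constant_at_infinity (carrier G) f" "p \<ge> 1"
  shows "lp_approximable p f"
  unfolding lp_approximable_def
proof (intro allI impI)
  fix \<epsilon> :: real assume e: "\<epsilon> > 0"
  obtain c where c: "vanishes_at_infinity (carrier G) (\<lambda>x. f x - c)"
    using assms(2) by (auto simp: constant_at_infinity_def)
  have "\<forall>s\<in>W. \<exists>Z. finite Z \<and> lp_le p (carrier G - Z) (increment G f s) (\<epsilon>/2)"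
  proof
    fix s assume "s \<in> W"
    then obtain C where "lp_le p (carrier G) (increment G f s) C"
      using assms(1) in_carrier_of_W by (auto simp: finite_energy_def)
    from lp_le_tail[OF this, of "\<epsilon>/2"] e
    show "\<exists>Z. finite Z \<and> lp_le p (carrier G - Z) (increment G f s) (\<epsilon>/2)" by auto
  qed
  then obtain Z where Z: "\<And>s. s \<in> W \<Longrightarrow> finite (Z s) \<and> lp_le p (carrier G - Z s) (increment G f s) (\<epsilon>/2)"
    by metis
  define N where "N = 1 + (\<Sum>s\<in>W. real (card (Z s)))"
  have N: "N > 0" unfolding N_def by (intro add_pos_nonneg sum_nonneg) auto
  have cN: "real (card (Z s)) \<le> N" if "s \<in> W" for s
    using member_le_sum[OF that, of "\<lambda>s. real (card (Z s))"] finite_W by (simp add: N_def)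
  \<comment> \<open>Chosen so that \<open>N\<close> terms of size \<open>(2 * \<delta>) powr p\<close> add up to \<open>\<epsilon> / 2\<close>.\<close>
  define \<delta> where "\<delta> = (\<epsilon> / (2 * N)) powr (1/p) / 2"
  have \<delta>: "\<delta> > 0" using e N by (simp add: \<delta>_def)
  have \<delta>p: "(2 * \<delta>) powr p = \<epsilon> / (2 * N)" using e N assms(3) by (simp add: \<delta>_def powr_powr)
  define h where "h g = max (- \<delta>) (min \<delta> (f g - c))" for g
  define u where "u g = f g - c - h g" for g
  show "\<exists>u. (\<exists>C. lp_le p (carrier G) u C) \<and>
     (\<forall>s\<in>W. lp_le p (carrier G) (increment G (\<lambda>g. f g - u g) s) \<epsilon>)"
  proof (intro exI[of _ u] conjI ballI)
    show "\<exists>C. lp_le p (carrier G) u C"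
      by (rule exI, rule lp_le_finite_support[OF vanishes_at_infinityD[OF c \<delta>]])
        (auto simp: u_def h_def)
  next
    fix s assume s: "s \<in> W"
    show "lp_le p (carrier G) (increment G (\<lambda>g. f g - u g) s) \<epsilon>"
    proof (rule lp_leI)
      fix X assume X: "finite X" "X \<subseteq> carrier G"
      have inc: "increment G (\<lambda>g. f g - u g) s g = h (g \<otimes> s) - h g" for g
        by (simp add: increment_def u_def)
      have 1: "\<bar>h (g \<otimes> s) - h g\<bar> \<le> \<bar>increment G f s g\<bar>" for g
        by (auto simp: h_def increment_def max_def min_def)
      have 2: "\<bar>h (g \<otimes> s) - h g\<bar> \<le> 2 * \<delta>" for g
        using \<delta> by (auto simp: h_def max_def min_def)
      have "(\<Sum>g\<in>X. \<bar>h (g \<otimes> s) - h g\<bar> powr p)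
          = (\<Sum>g\<in>X - Z s. \<bar>h (g \<otimes> s) - h g\<bar> powr p) + (\<Sum>g\<in>X \<inter> Z s. \<bar>h (g \<otimes> s) - h g\<bar> powr p)"
        using sum.Int_Diff[OF X(1), of "\<lambda>g. \<bar>h (g \<otimes> s) - h g\<bar> powr p" "Z s"] by simp
      also have "\<dots> \<le> (\<Sum>g\<in>X - Z s. \<bar>increment G f s g\<bar> powr p) + (\<Sum>g\<in>X \<inter> Z s. (2 * \<delta>) powr p)"
        by (intro add_mono sum_mono powr_mono2 1 2) (use assms(3) in auto)
      also have "\<dots> \<le> \<epsilon>/2 + real (card (X \<inter> Z s)) * (\<epsilon> / (2 * N))"
        using lp_leD[OF conjunct2[OF Z[OF s]], of "X - Z s"] X \<delta>p by auto
      also have "\<dots> \<le> \<epsilon>/2 + N * (\<epsilon> / (2 * N))"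
      proof -
        have "card (X \<inter> Z s) \<le> card (Z s)" by (rule card_mono) (use Z[OF s] in auto)
        then have "real (card (X \<inter> Z s)) \<le> N" using cN[OF s] by linarith
        then show ?thesis by (intro add_left_mono mult_right_mono) (use e N in auto)
      qed
      also have "\<dots> = \<epsilon>" using N by simp
      finally show "(\<Sum>g\<in>X. \<bar>increment G (\<lambda>g. f g - u g) s g\<bar> powr p) \<le> \<epsilon>"
        by (simp add: inc)
    qed
  qed
qed

end

section \<open>Two commuting infinite factors\<close>

text \<open>
  An internal direct product of two infinite subgroups, generated by \<open>A\<close> and \<open>B\<close>.  The assumptions are
  symmetric in \<open>A\<close> and \<open>B\<close>, so every lemma of this locale is also available with the two factors
  exchanged (lemma \<open>swap\<close>).  That is the reason for not working with pairs.
\<close>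

locale commuting_factors = group G for G (structure) +
  fixes A B
  assumes finite_A: "finite A" and finite_B: "finite B"
    and A_subset: "A \<subseteq> carrier G" and B_subset: "B \<subseteq> carrier G"
    and one_in_A: "\<one> \<in> A" and one_in_B: "\<one> \<in> B"
    and inv_in_A: "a \<in> A \<Longrightarrow> inv a \<in> A" and inv_in_B: "b \<in> B \<Longrightarrow> inv b \<in> B"
    and A_B_commute: "a \<in> A \<Longrightarrow> b \<in> B \<Longrightarrow> a \<otimes> b = b \<otimes> a"
    and infinite_A_balls: "infinite (\<Union>n. word_ball G A n)"
    and infinite_B_balls: "infinite (\<Union>n. word_ball G B n)"
    and balls_inter: "(\<Union>n. word_ball G A n) \<inter> (\<Union>n. word_ball G B n) = {\<one>}"
    and balls_prod: "\<And>g. g \<in> carrier G \<Longrightarrow>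
      \<exists>h\<in>(\<Union>n. word_ball G A n). \<exists>k\<in>(\<Union>n. word_ball G B n). g = h \<otimes> k"
begin

definition H where "H = (\<Union>n. word_ball G A n)"
definition K where "K = (\<Union>n. word_ball G B n)"
text \<open>
  For this generating set the ball of radius \<open>n\<close> is the product of the balls of radius \<open>n\<close> in the factors.
\<close>

definition U where "U = (\<lambda>(a, b). a \<otimes> b) ` (A \<times> B)"

lemma H_subset: "H \<subseteq> carrier G" and K_subset: "K \<subseteq> carrier G"
  using word_ball_subset_carrier[OF A_subset] word_ball_subset_carrier[OF B_subset]
  by (auto simp: H_def K_def)

lemma HK_commute:
  assumes "h \<in> H" "k \<in> K"
  shows "h \<otimes> k = k \<otimes> h"
proof -
  have 1: "a \<otimes> k = k \<otimes> a" if "a \<in> A" "k \<in> word_ball G B n" for a n k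
    using that(2)
  proof (induction n arbitrary: k)
    case 0
    then show ?case using that(1) A_subset by auto
  next
    case (Suc n)
    then obtain z b where z: "z \<in> word_ball G B n" "b \<in> B" "k = z \<otimes> b" by auto
    have c: "a \<in> carrier G" "z \<in> carrier G" "b \<in> carrier G"
      using that(1) z A_subset B_subset word_ball_subset_carrier[OF B_subset] by blast+
    have "a \<otimes> k = (a \<otimes> z) \<otimes> b" using c z by (simp add: m_assoc)
    also have "\<dots> = z \<otimes> (a \<otimes> b)" using c Suc.IH[OF z(1)] by (simp add: m_assoc)
    also have "\<dots> = k \<otimes> a" using c z A_B_commute[OF that(1) z(2)] by (simp add: m_assoc)
    finally show ?case .
  qed
  have 2: "h \<otimes> k = k \<otimes> h" if "h \<in> word_ball G A m" "k \<in> K" for m h k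
    using that(1)
  proof (induction m arbitrary: h)
    case 0
    then show ?case using that(2) K_subset by auto
  next
    case (Suc m)
    then obtain z a where z: "z \<in> word_ball G A m" "a \<in> A" "h = z \<otimes> a" by auto
    have c: "a \<in> carrier G" "z \<in> carrier G" "k \<in> carrier G"
      using that(2) z A_subset K_subset word_ball_subset_carrier[OF A_subset] by blast+
    have ak: "a \<otimes> k = k \<otimes> a" using 1[OF z(2)] that(2) by (auto simp: K_def)
    have "h \<otimes> k = z \<otimes> (k \<otimes> a)" using c z ak by (simp add: m_assoc)
    also have "\<dots> = (z \<otimes> k) \<otimes> a" using c by (simp add: m_assoc)
    also have "\<dots> = k \<otimes> h" using c z Suc.IH[OF z(1)] by (simp add: m_assoc)
    finally show ?case .
  qed
  show ?thesis using 2 assms by (auto simp: H_def)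
qed

lemma subgroup_H: "subgroup H G"
proof (rule subgroupI)
  show "H \<noteq> {}" using one_in_word_ball[OF A_subset one_in_A] by (auto simp: H_def)
  show "inv a \<in> H" if "a \<in> H" for a
    using that word_ball_inv[OF A_subset inv_in_A] unfolding H_def by blast
  show "a \<otimes> b \<in> H" if "a \<in> H" "b \<in> H" for a b
    using that word_ball_mult[OF A_subset] unfolding H_def by blast
qed (rule H_subset)

lemma swap: "commuting_factors G B A"
proof (intro commuting_factors.intro commuting_factors_axioms.intro)
  show "b \<otimes> a = a \<otimes> b" if "b \<in> B" "a \<in> A" for b a
    using A_B_commute[OF that(2,1)] by simp
  show "(\<Union>n. word_ball G B n) \<inter> (\<Union>n. word_ball G A n) = {\<one>}"
    using balls_inter by (simp add: Int_commute)
  show "\<exists>k\<in>(\<Union>n. word_ball G B n). \<exists>h\<in>(\<Union>n. word_ball G A n). g = k \<otimes> h"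
    if "g \<in> carrier G" for g
    using balls_prod[OF that] HK_commute unfolding H_def K_def by metis
qed (use finite_A finite_B A_subset B_subset one_in_A one_in_B inv_in_A inv_in_B
      infinite_A_balls infinite_B_balls is_group in auto)

lemma swap_H: "commuting_factors.H G B = K"
  unfolding commuting_factors.H_def[OF swap] K_def ..

lemma swap_K: "commuting_factors.K G A = H"
  unfolding commuting_factors.K_def[OF swap] H_def ..

lemma swap_U: "commuting_factors.U G B A = U"
  unfolding commuting_factors.U_def[OF swap] U_def
proof (rule subset_antisym; rule subsetI)
  fix x assume "x \<in> (\<lambda>(a, b). a \<otimes> b) ` (B \<times> A)"
  then obtain a b where "a \<in> A" "b \<in> B" "x = b \<otimes> a" by auto
  then show "x \<in> (\<lambda>(a, b). a \<otimes> b) ` (A \<times> B)"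
    using A_B_commute[of a b] by (intro image_eqI[of _ _ "(a, b)"]) auto
next
  fix x assume "x \<in> (\<lambda>(a, b). a \<otimes> b) ` (A \<times> B)"
  then obtain a b where "a \<in> A" "b \<in> B" "x = a \<otimes> b" by auto
  then show "x \<in> (\<lambda>(a, b). a \<otimes> b) ` (B \<times> A)"
    using A_B_commute[of a b] by (intro image_eqI[of _ _ "(b, a)"]) auto
qed

lemma subgroup_K: "subgroup K G"
  using commuting_factors.subgroup_H[OF swap] by (simp add: swap_H)

lemma HK_inter: "h \<in> H \<Longrightarrow> h \<in> K \<Longrightarrow> h = \<one>"
  using balls_inter by (auto simp: H_def K_def)

lemma HK_decompose:
  assumes "g \<in> carrier G" obtains h k where "h \<in> H" "k \<in> K" "g = h \<otimes> k"
  using balls_prod[OF assms] by (auto simp: H_def K_def)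

lemma HK_unique:
  assumes "h \<in> H" "k \<in> K" "h' \<in> H" "k' \<in> K" "h \<otimes> k = h' \<otimes> k'"
  shows "h = h' \<and> k = k'"
proof -
  have c: "h \<in> carrier G" "k \<in> carrier G" "h' \<in> carrier G" "k' \<in> carrier G"
    using assms H_subset K_subset by auto
  have "inv h' \<otimes> h = k' \<otimes> inv k"
  proof -
    have "inv h' \<otimes> h = inv h' \<otimes> (h \<otimes> k) \<otimes> inv k" using c by (simp add: m_assoc)
    also have "\<dots> = inv h' \<otimes> (h' \<otimes> k') \<otimes> inv k" using assms(5) by simp
    also have "\<dots> = k' \<otimes> inv k" using c by (simp add: m_assoc[symmetric])
    finally show ?thesis .
  qed
  moreover have "inv h' \<otimes> h \<in> H"
    using assms subgroup.m_closed[OF subgroup_H] subgroup.m_inv_closed[OF subgroup_H] by blast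
  moreover have "k' \<otimes> inv k \<in> K"
    using assms subgroup.m_closed[OF subgroup_K] subgroup.m_inv_closed[OF subgroup_K] by blast
  ultimately have "inv h' \<otimes> h = \<one>" using HK_inter by metis
  then have "h' \<otimes> (inv h' \<otimes> h) = h' \<otimes> \<one>" by simp
  then have "h = h'" using c by (simp add: m_assoc[symmetric])
  then show ?thesis using assms(5) c by simp
qed

lemma word_ball_U: "word_ball G U n = (\<lambda>(h, k). h \<otimes> k) ` (word_ball G A n \<times> word_ball G B n)"
proof (induction n)
  case 0
  then show ?case by simp
next
  case (Suc n)
  have *: "(h \<otimes> k) \<otimes> (a \<otimes> b) = (h \<otimes> a) \<otimes> (k \<otimes> b)"
    if "h \<in> word_ball G A n" "k \<in> word_ball G B n" "a \<in> A" "b \<in> B" for h k a b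
  proof -
    have c: "h \<in> carrier G" "k \<in> carrier G" "a \<in> carrier G" "b \<in> carrier G"
      using that A_subset B_subset word_ball_subset_carrier[OF A_subset]
        word_ball_subset_carrier[OF B_subset] by blast+
    have "a \<in> H" "k \<in> K"
      using that word_ball_one[OF A_subset] unfolding H_def K_def by blast+
    then have "a \<otimes> k = k \<otimes> a" by (rule HK_commute)
    then have "k \<otimes> (a \<otimes> b) = a \<otimes> (k \<otimes> b)" using c by (metis m_assoc)
    then show ?thesis using c by (simp add: m_assoc)
  qed
  show ?case
  proof (rule subset_antisym; rule subsetI)
    fix x assume "x \<in> word_ball G U (Suc n)"
    then obtain y u where y: "y \<in> word_ball G U n" "u \<in> U" "x = y \<otimes> u" by auto
    obtain h k where hk: "h \<in> word_ball G A n" "k \<in> word_ball G B n" "y = h \<otimes> k"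
      using y(1) unfolding Suc.IH by auto
    obtain a b where ab: "a \<in> A" "b \<in> B" "u = a \<otimes> b" using y(2) by (auto simp: U_def)
    have "x = (h \<otimes> a) \<otimes> (k \<otimes> b)" using *[OF hk(1,2) ab(1,2)] y hk ab by simp
    then show "x \<in> (\<lambda>(h, k). h \<otimes> k) ` (word_ball G A (Suc n) \<times> word_ball G B (Suc n))"
      using word_ball_SucI[OF hk(1) ab(1)] word_ball_SucI[OF hk(2) ab(2)] by blast
  next
    fix x assume "x \<in> (\<lambda>(h, k). h \<otimes> k) ` (word_ball G A (Suc n) \<times> word_ball G B (Suc n))"
    then obtain h k a b where hk: "h \<in> word_ball G A n" "k \<in> word_ball G B n" "a \<in> A" "b \<in> B"
      "x = (h \<otimes> a) \<otimes> (k \<otimes> b)" by auto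
    have "h \<otimes> k \<in> word_ball G U n" using hk unfolding Suc.IH by blast
    moreover have "a \<otimes> b \<in> U" using hk by (auto simp: U_def)
    ultimately show "x \<in> word_ball G U (Suc n)"
      using *[OF hk(1-4)] hk(5) word_ball_SucI by metis
  qed
qed

lemma inj_on_HK: "inj_on (\<lambda>(h, k). h \<otimes> k) (word_ball G A n \<times> word_ball G B n)"
proof (rule inj_onI)
  fix x y
  assume "x \<in> word_ball G A n \<times> word_ball G B n" "y \<in> word_ball G A n \<times> word_ball G B n"
    "(case x of (h, k) \<Rightarrow> h \<otimes> k) = (case y of (h, k) \<Rightarrow> h \<otimes> k)"
  then show "x = y"
    using HK_unique[of "fst x" "snd x" "fst y" "snd y"]
    by (cases x; cases y) (auto simp: H_def K_def)
qed

lemma card_word_ball_U: "card (word_ball G U n) = card (word_ball G A n) * card (word_ball G B n)"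
  unfolding word_ball_U by (subst card_image[OF inj_on_HK]) (simp add: card_cartesian_product)

lemma cayley_U: "cayley G U"
proof
  show "finite U" using finite_A finite_B by (simp add: U_def)
  show "U \<subseteq> carrier G" using A_subset B_subset by (auto simp: U_def)
  show "\<one> \<in> U" using one_in_A one_in_B by (force simp: U_def)
  show "inv s \<in> U" if s: "s \<in> U" for s
  proof -
    obtain a b where ab: "a \<in> A" "b \<in> B" "s = a \<otimes> b" using s by (auto simp: U_def)
    have c: "a \<in> carrier G" "b \<in> carrier G" using ab A_subset B_subset by blast+
    have "inv s = inv (b \<otimes> a)" using A_B_commute[OF ab(1,2)] ab(3) by metis
    also have "\<dots> = inv a \<otimes> inv b" by (rule inv_mult_group[OF c(2,1)])
    finally show ?thesis using inv_in_A[OF ab(1)] inv_in_B[OF ab(2)] by (auto simp: U_def)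
  qed
  show "carrier G = (\<Union>n. word_ball G U n)"
  proof
    show "carrier G \<subseteq> (\<Union>n. word_ball G U n)"
    proof
      fix g assume "g \<in> carrier G"
      then obtain h k where hk: "h \<in> H" "k \<in> K" "g = h \<otimes> k" using HK_decompose by blast
      obtain m n where mn: "h \<in> word_ball G A m" "k \<in> word_ball G B n"
        using hk by (auto simp: H_def K_def)
      have "h \<in> word_ball G A (max m n)" "k \<in> word_ball G B (max m n)"
        using mn word_ball_mono[OF A_subset one_in_A, of m "max m n"]
          word_ball_mono[OF B_subset one_in_B, of n "max m n"] by auto
      then have "g \<in> word_ball G U (max m n)" using hk(3) unfolding word_ball_U by blast
      then show "g \<in> (\<Union>n. word_ball G U n)" by blast
    qed
    have "U \<subseteq> carrier G" using A_subset B_subset by (auto simp: U_def)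
    then show "(\<Union>n. word_ball G U n) \<subseteq> carrier G" using word_ball_subset_carrier by blast
  qed
qed

lemma infinite_H: "infinite H" using infinite_A_balls by (simp add: H_def)
lemma infinite_carrier: "infinite (carrier G)" using infinite_H H_subset finite_subset by blast

end

context commuting_factors
begin

section \<open>Summable gradients\<close>

text \<open>
  A path inside the coset \<open>gH\<close> that avoids \<open>Z\<close> and visits no point twice picks up at most the total
  gradient outside \<open>Z\<close>.
\<close>

lemma row_oscillation:
  assumes "lp_le 1 (carrier G - Z) (\<lambda>x. \<Sum>a\<in>A \<union> B. \<bar>increment G f a x\<bar>) \<epsilon>"
    "g \<in> carrier G" "h \<in> H" "\<And>h. h \<in> H \<Longrightarrow> g \<otimes> h \<notin> Z"
  shows "\<bar>f (g \<otimes> h) - f g\<bar> \<le> \<epsilon>"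
proof -
  obtain n where "h \<in> word_ball G A n" using assms(3) by (auto simp: H_def)
  then obtain m w s where w: "m \<le> n" "w 0 = \<one>" "w m = h" "inj_on w {..m}"
    "\<And>i. i \<le> m \<Longrightarrow> w i \<in> word_ball G A i"
    "\<And>i. i < m \<Longrightarrow> s i \<in> A" "\<And>i. i < m \<Longrightarrow> w (Suc i) = w i \<otimes> s i"
    using geodesic[OF A_subset one_in_A] by metis
  have wH: "w i \<in> H" if "i \<le> m" for i using w(5)[OF that] by (auto simp: H_def)
  then have wc: "w i \<in> carrier G" if "i \<le> m" for i using that H_subset by blast
  have sc: "s i \<in> carrier G" if "i < m" for i using w(6)[OF that] A_subset by blast
  have inj: "inj_on (\<lambda>i. g \<otimes> w i) {..<m}"
    using w(4) wc assms(2) by (auto simp: inj_on_def)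
  have "f (g \<otimes> h) - f g = increment G f (w m) g" using w(3) by (simp add: increment_def)
  also have "\<dots> = (\<Sum>i<m. increment G f (s i) (g \<otimes> w i))"
    by (rule increment_path) (use w(2,7) wc sc assms(2) in auto)
  finally have "\<bar>f (g \<otimes> h) - f g\<bar> \<le> (\<Sum>i<m. \<bar>increment G f (s i) (g \<otimes> w i)\<bar>)" by simp
  also have "\<dots> \<le> (\<Sum>i<m. \<Sum>a\<in>A \<union> B. \<bar>increment G f a (g \<otimes> w i)\<bar>)"
  proof (rule sum_mono)
    fix i assume "i \<in> {..<m}"
    then have "s i \<in> A \<union> B" using w(6) by auto
    then show "\<bar>increment G f (s i) (g \<otimes> w i)\<bar> \<le> (\<Sum>a\<in>A \<union> B. \<bar>increment G f a (g \<otimes> w i)\<bar>)"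
      using member_le_sum[of "s i" "A \<union> B" "\<lambda>a. \<bar>increment G f a (g \<otimes> w i)\<bar>"] finite_A finite_B
      by simp
  qed
  also have "\<dots> = (\<Sum>x\<in>(\<lambda>i. g \<otimes> w i) ` {..<m}. \<bar>\<Sum>a\<in>A \<union> B. \<bar>increment G f a x\<bar>\<bar> powr 1)"
    by (subst sum.reindex[OF inj]) (simp add: sum_nonneg)
  also have "\<dots> \<le> \<epsilon>"
    by (rule lp_leD[OF assms(1)]) (use assms(2,4) wH wc in auto)
  finally show ?thesis .
qed

text \<open>
  Each coset of \<open>H\<close> meets each coset of \<open>K\<close>.
\<close>

lemma good_row_meets_good_column:
  fixes f :: "'a \<Rightarrow> real"
  assumes "x \<in> carrier G" "y \<in> carrier G"
    "\<And>h. h \<in> H \<Longrightarrow> \<bar>f (x \<otimes> h) - f x\<bar> \<le> \<epsilon>" "\<And>k. k \<in> K \<Longrightarrow> \<bar>f (y \<otimes> k) - f y\<bar> \<le> \<epsilon>"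
  shows "\<bar>f x - f y\<bar> \<le> 2 * \<epsilon>"
proof -
  obtain h k where hk: "h \<in> H" "k \<in> K" "x = h \<otimes> k" using HK_decompose[OF assms(1)] .
  obtain h' k' where hk': "h' \<in> H" "k' \<in> K" "y = h' \<otimes> k'" using HK_decompose[OF assms(2)] .
  have c: "h \<in> carrier G" "k \<in> carrier G" "h' \<in> carrier G" "k' \<in> carrier G"
    using hk hk' H_subset K_subset by auto
  have "inv h \<otimes> h' \<in> H" "inv k' \<otimes> k \<in> K"
    using hk hk' subgroup.m_closed[OF subgroup_H] subgroup.m_inv_closed[OF subgroup_H]
      subgroup.m_closed[OF subgroup_K] subgroup.m_inv_closed[OF subgroup_K] by blast+
  moreover have "x \<otimes> (inv h \<otimes> h') = h' \<otimes> k"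
  proof -
    have "x \<otimes> (inv h \<otimes> h') = k \<otimes> h \<otimes> (inv h \<otimes> h')"
      using hk(3) HK_commute[OF hk(1,2)] by simp
    also have "\<dots> = k \<otimes> h'" using c by (simp add: m_assoc mult_inv_mult)
    also have "\<dots> = h' \<otimes> k" using HK_commute[OF hk'(1) hk(2)] by simp
    finally show ?thesis .
  qed
  moreover have "y \<otimes> (inv k' \<otimes> k) = h' \<otimes> k"
  proof -
    show ?thesis using hk'(3) c by (simp add: m_assoc mult_inv_mult)
  qed
  ultimately have "\<bar>f (h' \<otimes> k) - f x\<bar> \<le> \<epsilon>" "\<bar>f (h' \<otimes> k) - f y\<bar> \<le> \<epsilon>"
    using assms(3,4) by metis+
  then show ?thesis by linarith
qed

lemma good_column_exists:
  assumes "finite Z"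
  obtains h where "h \<in> H" "\<And>k. k \<in> K \<Longrightarrow> h \<otimes> k \<notin> Z"
proof -
  define X where "X = {h\<in>H. \<exists>k\<in>K. h \<otimes> k \<in> Z}"
  have "\<forall>h\<in>X. \<exists>k. k \<in> K \<and> h \<otimes> k \<in> Z" by (auto simp: X_def)
  then obtain k where k: "\<forall>h\<in>X. k h \<in> K \<and> h \<otimes> k h \<in> Z" by (rule bchoice[THEN exE])
  have "inj_on (\<lambda>h. h \<otimes> k h) X"
  proof (rule inj_onI)
    fix h h' assume "h \<in> X" "h' \<in> X" "h \<otimes> k h = h' \<otimes> k h'"
    then show "h = h'" using HK_unique[of h "k h" h' "k h'"] k by (auto simp: X_def)
  qed
  then have "finite X" by (rule inj_on_finite[OF _ _ assms]) (use k in auto)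
  then have "\<not> H \<subseteq> X" using infinite_H finite_subset by blast
  then obtain h where "h \<in> H" "h \<notin> X" by blast
  then show ?thesis using that by (auto simp: X_def)
qed

text \<open>
  Two good cosets of \<open>H\<close> need not meet, but both of them meet any good coset of \<open>K\<close>, and all but
  finitely many cosets of \<open>K\<close> avoid \<open>Z\<close>.
\<close>

lemma good_rows_close:
  fixes f :: "'a \<Rightarrow> real"
  assumes "finite Z"
    "\<And>x h. x \<in> carrier G \<Longrightarrow> (\<And>h. h \<in> H \<Longrightarrow> x \<otimes> h \<notin> Z) \<Longrightarrow> h \<in> H \<Longrightarrow> \<bar>f (x \<otimes> h) - f x\<bar> \<le> \<epsilon>"
    "\<And>x k. x \<in> carrier G \<Longrightarrow> (\<And>k. k \<in> K \<Longrightarrow> x \<otimes> k \<notin> Z) \<Longrightarrow> k \<in> K \<Longrightarrow> \<bar>f (x \<otimes> k) - f x\<bar> \<le> \<epsilon>"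
    "x \<in> carrier G" "y \<in> carrier G"
    "\<And>h. h \<in> H \<Longrightarrow> x \<otimes> h \<notin> Z" "\<And>h. h \<in> H \<Longrightarrow> y \<otimes> h \<notin> Z"
  shows "\<bar>f x - f y\<bar> \<le> 4 * \<epsilon>"
proof -
  obtain z where z: "z \<in> H" "\<And>k. k \<in> K \<Longrightarrow> z \<otimes> k \<notin> Z"
    using good_column_exists[OF assms(1)] by blast
  have zc: "z \<in> carrier G" using z H_subset by blast
  have "\<bar>f x - f z\<bar> \<le> 2 * \<epsilon>"
    by (rule good_row_meets_good_column) (use assms z zc in auto)
  moreover have "\<bar>f y - f z\<bar> \<le> 2 * \<epsilon>"
    by (rule good_row_meets_good_column) (use assms z zc in auto)
  ultimately show ?thesis by linarith
qed

text \<open>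
  A point is determined by a point of its \<open>H\<close>-coset and a point of its \<open>K\<close>-coset, so there is an
  injection of the bad points into \<open>Z \<times> Z\<close>.
\<close>

lemma finite_bad_points:
  assumes "finite Z"
  shows "finite {x\<in>carrier G. (\<exists>h\<in>H. x \<otimes> h \<in> Z) \<and> (\<exists>k\<in>K. x \<otimes> k \<in> Z)}" (is "finite ?X")
proof -
  have "\<forall>x\<in>?X. \<exists>h. h \<in> H \<and> x \<otimes> h \<in> Z" "\<forall>x\<in>?X. \<exists>k. k \<in> K \<and> x \<otimes> k \<in> Z"
    by blast+
  then obtain h k where hk': "\<forall>x\<in>?X. h x \<in> H \<and> x \<otimes> h x \<in> Z" "\<forall>x\<in>?X. k x \<in> K \<and> x \<otimes> k x \<in> Z"
    using bchoice[of ?X "\<lambda>x h. h \<in> H \<and> x \<otimes> h \<in> Z"] bchoice[of ?X "\<lambda>x k. k \<in> K \<and> x \<otimes> k \<in> Z"]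
    by blast
  have hk: "h x \<in> H \<and> x \<otimes> h x \<in> Z \<and> k x \<in> K \<and> x \<otimes> k x \<in> Z" if "x \<in> ?X" for x
    using bspec[OF hk'(1) that] bspec[OF hk'(2) that] by simp
  have "inj_on (\<lambda>x. (x \<otimes> h x, x \<otimes> k x)) ?X"
  proof (rule inj_onI)
    fix x y assume x: "x \<in> ?X" and y: "y \<in> ?X" and "(x \<otimes> h x, x \<otimes> k x) = (y \<otimes> h y, y \<otimes> k y)"
    then have e: "x \<otimes> h x = y \<otimes> h y" "x \<otimes> k x = y \<otimes> k y" by auto
    have c: "x \<in> carrier G" "y \<in> carrier G" "h x \<in> carrier G" "k x \<in> carrier G"
      "h y \<in> carrier G" "k y \<in> carrier G"
      using x y hk[OF x] hk[OF y] H_subset K_subset by blast+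
    have *: "inv x \<otimes> y = a \<otimes> inv b" if "x \<otimes> a = y \<otimes> b" "a \<in> carrier G" "b \<in> carrier G" for a b
    proof -
      have "a = inv x \<otimes> (x \<otimes> a)" using c(1) that(2) by (simp add: m_assoc[symmetric])
      also have "\<dots> = inv x \<otimes> y \<otimes> b" using c(1,2) that by (simp add: m_assoc[symmetric])
      finally show ?thesis using c(1,2) that(2,3) by (simp add: m_assoc)
    qed
    have "inv x \<otimes> y \<in> H"
      unfolding *[OF e(1) c(3,5)] using hk[OF x] hk[OF y]
      by (intro subgroup.m_closed[OF subgroup_H] subgroup.m_inv_closed[OF subgroup_H]) blast+
    moreover have "inv x \<otimes> y \<in> K"
      unfolding *[OF e(2) c(4,6)] using hk[OF x] hk[OF y]
      by (intro subgroup.m_closed[OF subgroup_K] subgroup.m_inv_closed[OF subgroup_K]) blast+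
    ultimately have "inv x \<otimes> y = \<one>" by (rule HK_inter)
    then have "x \<otimes> (inv x \<otimes> y) = x \<otimes> \<one>" by simp
    then show "x = y" using c(1,2) by (simp add: m_assoc[symmetric])
  qed
  moreover have "(\<lambda>x. (x \<otimes> h x, x \<otimes> k x)) ` ?X \<subseteq> Z \<times> Z"
    by (rule image_subsetI) (use hk in blast)
  moreover have "finite (Z \<times> Z)" using assms by simp
  ultimately show ?thesis by (rule inj_on_finite)
qed

text \<open>
  Here \<open>p = 1\<close> is essential: the oscillation along a path is controlled by a plain sum of increments,
  whatever the length of the path.
\<close>

lemma summable_gradient_constant_at_infinity:
  assumes "finite_energy 1 G f"
  shows "constant_at_infinity (carrier G) f"
proof (rule constant_at_infinity_of_oscillation[OF infinite_carrier])
  fix \<epsilon> :: real assume e: "\<epsilon> > 0"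
  let ?v = "\<lambda>x. \<Sum>a\<in>A \<union> B. \<bar>increment G f a x\<bar>"
  have "\<forall>a\<in>A \<union> B. \<exists>C. lp_le 1 (carrier G) (increment G f a) C"
    using assms A_subset B_subset by (auto simp: finite_energy_def)
  then obtain C where C: "\<forall>a\<in>A \<union> B. lp_le 1 (carrier G) (increment G f a) (C a)" by metis
  have "lp_le 1 (carrier G) ?v (real (card (A \<union> B)) powr 1 * Max (C ` (A \<union> B)))"
  proof (rule lp_le_sum)
    fix a assume a: "a \<in> A \<union> B"
    have "lp_le 1 (carrier G) (increment G f a) (Max (C ` (A \<union> B)))"
      by (rule lp_le_mono[OF bspec[OF C a]]) (use a finite_A finite_B in auto)
    then show "lp_le 1 (carrier G) (\<lambda>x. \<bar>increment G f a x\<bar>) (Max (C ` (A \<union> B)))"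
      by (simp add: lp_le_def)
  qed (use finite_A finite_B in auto)
  then obtain Z where Z: "finite Z" "lp_le 1 (carrier G - Z) ?v (\<epsilon>/4)"
    by (rule lp_le_tail[of 1 "carrier G" ?v _ "\<epsilon>/4"]) (use e in auto)
  interpret swap: commuting_factors G B A by (rule swap)
  have Z': "lp_le 1 (carrier G - Z) (\<lambda>x. \<Sum>a\<in>B \<union> A. \<bar>increment G f a x\<bar>) (\<epsilon>/4)"
    using Z(2) by (simp add: Un_commute)
  note row = row_oscillation[OF Z(2)]
  note column = swap.row_oscillation[OF Z', unfolded swap_H]
  define X where "X = {x\<in>carrier G. (\<exists>h\<in>H. x \<otimes> h \<in> Z) \<and> (\<exists>k\<in>K. x \<otimes> k \<in> Z)}"
  have "\<bar>f x - f y\<bar> \<le> \<epsilon>" if x: "x \<in> carrier G - X" and y: "y \<in> carrier G - X" for x y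
  proof -
    have xc: "x \<in> carrier G" "y \<in> carrier G" using x y by auto
    consider (rr) "\<forall>h\<in>H. x \<otimes> h \<notin> Z" "\<forall>h\<in>H. y \<otimes> h \<notin> Z"
      | (cc) "\<forall>k\<in>K. x \<otimes> k \<notin> Z" "\<forall>k\<in>K. y \<otimes> k \<notin> Z"
      | (rc) "\<forall>h\<in>H. x \<otimes> h \<notin> Z" "\<forall>k\<in>K. y \<otimes> k \<notin> Z"
      | (cr) "\<forall>k\<in>K. x \<otimes> k \<notin> Z" "\<forall>h\<in>H. y \<otimes> h \<notin> Z"
      using x y by (auto simp: X_def)
    then show ?thesis
    proof cases
      case rr
      then have "\<bar>f x - f y\<bar> \<le> 4 * (\<epsilon>/4)"
        using good_rows_close[OF Z(1) row column xc] by blast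
      then show ?thesis by simp
    next
      case cc
      then have "\<bar>f x - f y\<bar> \<le> 4 * (\<epsilon>/4)"
        using swap.good_rows_close[unfolded swap_H swap_K, OF Z(1) column row xc] by blast
      then show ?thesis by simp
    next
      case rc
      then have "\<bar>f x - f y\<bar> \<le> 2 * (\<epsilon>/4)"
        by (intro good_row_meets_good_column xc row column) auto
      then show ?thesis using e by simp
    next
      case cr
      then have "\<bar>f y - f x\<bar> \<le> 2 * (\<epsilon>/4)"
        by (intro good_row_meets_good_column xc row column) auto
      then show ?thesis using e by linarith
    qed
  qed
  then show "\<exists>Z. finite Z \<and> (\<forall>x\<in>carrier G - Z. \<forall>y\<in>carrier G - Z. \<bar>f x - f y\<bar> \<le> \<epsilon>)"
    using finite_bad_points[OF Z(1)] unfolding X_def by blast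
qed

section \<open>Limits invariant under one factor\<close>

text \<open>
  For \<open>k \<in> K\<close> compare \<open>F (g \<otimes> k)\<close> with \<open>F g\<close> by moving both points to infinity along \<open>H\<close>.  This
  changes neither value since \<open>F\<close> is \<open>H\<close>-invariant and \<open>k\<close> commutes with \<open>H\<close>, while at infinity the
  difference is that of \<open>f\<close>, namely 0.
\<close>

lemma constant_at_infinity_of_invariant_limit:
  assumes "vanishes_at_infinity (carrier G) (\<lambda>x. f x - F x)"
    "\<And>g h. g \<in> carrier G \<Longrightarrow> h \<in> H \<Longrightarrow> F (g \<otimes> h) = F g"
    "\<And>k. k \<in> K \<Longrightarrow> vanishes_at_infinity (carrier G) (increment G f k)"
  shows "constant_at_infinity (carrier G) f"
proof -
  obtain h :: "nat \<Rightarrow> 'a" where h: "inj h" "range h \<subseteq> H"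
    using infinite_countable_subset[OF infinite_H] by blast
  have hH: "h n \<in> H" "h n \<in> carrier G" for n using h(2) H_subset by auto
  have FK: "F (g \<otimes> k) = F g" if g: "g \<in> carrier G" and k: "k \<in> K" for g k
  proof -
    have kc: "k \<in> carrier G" using k K_subset by blast
    define v where "v x = increment G f k x + (- (f (x \<otimes> k) - F (x \<otimes> k)) + (f x - F x))" for x
    have v: "v x = F (x \<otimes> k) - F x" for x by (simp add: v_def increment_def)
    have "vanishes_at_infinity (carrier G) (\<lambda>x. - (f (x \<otimes> k) - F (x \<otimes> k)))"
      by (rule vanishes_at_infinity_abs_mono[OF vanishes_at_infinity_right_translate[OF assms(1) kc]]) auto
    then have "vanishes_at_infinity (carrier G) v"
      unfolding v_def by (intro vanishes_at_infinity_add assms(3)[OF k] assms(1))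
    then have "(\<lambda>n. v (g \<otimes> h n)) \<longlonglongrightarrow> 0"
      by (rule vanishes_at_infinity_sequence) (use h(1) hH g in \<open>auto simp: inj_def\<close>)
    moreover have "v (g \<otimes> h n) = F (g \<otimes> k) - F g" for n
    proof -
      have "g \<otimes> h n \<otimes> k = g \<otimes> k \<otimes> h n"
        using HK_commute[OF hH(1)[of n] k] g kc hH by (simp add: m_assoc)
      then show ?thesis using assms(2) g kc hH by (simp add: v)
    qed
    ultimately show ?thesis by (simp add: LIMSEQ_const_iff)
  qed
  have F_const: "F g = F \<one>" if g: "g \<in> carrier G" for g
  proof -
    obtain x k where xk: "x \<in> H" "k \<in> K" "g = x \<otimes> k" using HK_decompose[OF g] .
    have xc: "x \<in> carrier G" using xk H_subset by blast
    have "F g = F x" using FK[OF xc xk(2)] xk(3) by simp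
    also have "\<dots> = F (\<one> \<otimes> x)" using xc by simp
    also have "\<dots> = F \<one>" using assms(2) xk(1) by blast
    finally show ?thesis .
  qed
  have "vanishes_at_infinity (carrier G) (\<lambda>x. f x - F \<one>)"
  proof (rule vanishes_at_infinity_abs_mono[OF assms(1)])
    fix g assume "g \<in> carrier G"
    from F_const[OF this] show "\<bar>f g - F \<one>\<bar> \<le> \<bar>f g - F g\<bar>" by (simp only: order_refl)
  qed
  then show ?thesis by (auto simp: constant_at_infinity_def)
qed

end

section \<open>Fast growth\<close>

context cayley
begin

definition average :: "nat \<Rightarrow> ('a \<Rightarrow> real) \<Rightarrow> 'a \<Rightarrow> real" where
  "average r f g = (\<Sum>w\<in>ball r. f (g \<otimes> w)) / vol r"

text \<open>
  The averages over the balls of radius \<open>1, 2, 4, \<dots>\<close> are composed with the largest ball innermost.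
  Thus passing from \<open>k\<close> to \<open>Suc k\<close> means applying the fixed operator \<open>smooth k\<close> to
  \<open>average (2 ^ k) f - f\<close>, an \<open>\<ell>\<^sup>p\<close> function if \<open>f\<close> has finite energy.
\<close>

primrec smooth :: "nat \<Rightarrow> ('a \<Rightarrow> real) \<Rightarrow> 'a \<Rightarrow> real" where
  "smooth 0 f = f"
| "smooth (Suc k) f = smooth k (average (2 ^ k) f)"

lemma card_ball_pos_real: "vol r > 0"
  using card_ball_pos by simp

lemma ball_nonempty: "ball r \<noteq> {}"
  using one_in_ball by blast

lemma average_abs_le:
  assumes "\<And>x. x \<in> carrier G \<Longrightarrow> \<bar>u x\<bar> \<le> e" "g \<in> carrier G"
  shows "\<bar>average r u g\<bar> \<le> e"
  unfolding average_def
proof (rule abs_mean_le)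
  show "\<bar>u (g \<otimes> w)\<bar> \<le> e" if "w \<in> ball r" for w
    using assms(1)[of "g \<otimes> w"] assms(2) in_carrier_of_ball[OF that] by simp
qed (rule ball_nonempty finite_ball)+

lemma smooth_abs_le:
  "(\<And>x. x \<in> carrier G \<Longrightarrow> \<bar>u x\<bar> \<le> e) \<Longrightarrow> g \<in> carrier G \<Longrightarrow> \<bar>smooth k u g\<bar> \<le> e"
proof (induction k arbitrary: u)
  case (Suc k)
  have "\<bar>average (2 ^ k) u x\<bar> \<le> e" if "x \<in> carrier G" for x
    by (rule average_abs_le[OF Suc.prems(1) that])
  from Suc.IH[OF this Suc.prems(2)] show ?case by simp
qed simp

lemma average_diff: "average r (\<lambda>x. u x - v x) = (\<lambda>x. average r u x - average r v x)"
  by (rule ext) (simp add: average_def sum_subtractf diff_divide_distrib)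

lemma smooth_diff: "smooth k (\<lambda>x. u x - v x) = (\<lambda>x. smooth k u x - smooth k v x)"
  by (induction k arbitrary: u v) (simp_all add: average_diff)

lemma average_vanishes:
  "vanishes_at_infinity (carrier G) u \<Longrightarrow> vanishes_at_infinity (carrier G) (average r u)"
  unfolding average_def
  by (intro vanishes_at_infinity_divide vanishes_at_infinity_sum
      vanishes_at_infinity_right_translate card_ball_pos_real)
    (auto intro: in_carrier_of_ball)

lemma smooth_vanishes:
  "vanishes_at_infinity (carrier G) u \<Longrightarrow> vanishes_at_infinity (carrier G) (smooth k u)"
  by (induction k arbitrary: u) (auto intro: average_vanishes)

lemma average_minus:
  "average r f g - f g = (\<Sum>w\<in>ball r. increment G f w g) / vol r"
  using card_ball_pos_real[of r]
  by (simp add: average_def increment_def sum_subtractf diff_divide_distrib)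

lemma lp_le_average_minus:
  assumes "\<And>s. s \<in> W \<Longrightarrow> lp_le p (carrier G) (increment G f s) C" "p \<ge> 1"
  shows "lp_le p (carrier G) (\<lambda>g. average r f g - f g) (real r powr p * C)"
proof -
  have "lp_le p (carrier G) (\<lambda>g. (\<Sum>w\<in>ball r. increment G f w g) / vol r)
      (vol r powr p * (real r powr p * C) / vol r powr p)"
    by (intro lp_le_divide lp_le_sum finite_ball card_ball_pos_real lp_le_increment_ball assms)
  then show ?thesis using card_ball_pos_real[of r] by (simp add: average_minus)
qed

lemma smooth_minus_vanishes:
  assumes "finite_energy p G f" "p \<ge> 1"
  shows "vanishes_at_infinity (carrier G) (\<lambda>g. smooth k f g - f g)"
proof (induction k)
  case 0
  then show ?case by (simp add: vanishes_at_infinity_zero)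
next
  case (Suc k)
  obtain C where C: "\<And>s. s \<in> W \<Longrightarrow> lp_le p (carrier G) (increment G f s) C"
    using assms finite_energy_iff_generators by blast
  have "vanishes_at_infinity (carrier G) (smooth k (\<lambda>g. average (2 ^ k) f g - f g))"
    by (intro smooth_vanishes lp_le_vanishes[OF lp_le_average_minus[OF C assms(2)] assms(2)])
  from vanishes_at_infinity_add[OF this Suc.IH] show ?case by (simp add: smooth_diff)
qed

text \<open>
  With \<open>v = average (2 ^ Suc k) f - f\<close>, the difference of consecutive smoothings is
  \<open>smooth k (average (2 ^ k) v)\<close>.  The \<open>\<ell>\<^sup>p\<close> norm of \<open>v\<close> is \<open>O(2 ^ k)\<close>, and the average over
  \<open>2 ^ k\<close>-balls, which have at least \<open>c (2 ^ k) powr (2 * p)\<close> elements, divides this by \<open>(2 ^ k)\<^sup>2\<close> when passing to the supremum.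
  Smoothing does not increase suprema.
\<close>

lemma smooth_Cauchy:
  assumes "\<And>s. s \<in> W \<Longrightarrow> lp_le p (carrier G) (increment G f s) C" "p \<ge> 1" "c > 0"
    "\<And>k. c * (2 powr real k) powr (2 * p) \<le> vol (2 ^ k)" "g \<in> carrier G"
  shows "\<bar>smooth (Suc (Suc k)) f g - smooth (Suc k) f g\<bar> \<le> (2 powr p * C / c) powr (1/p) / 2 ^ k"
proof -
  define v where "v x = average (2 ^ Suc k) f x - f x" for x
  have C: "C \<ge> 0" using lp_le_nonneg[OF assms(1)[OF one_in_W]] .
  have v: "lp_le p (carrier G) v (real (2 ^ Suc k) powr p * C)"
    unfolding v_def by (rule lp_le_average_minus[OF assms(1,2)])
  have av: "\<bar>average (2 ^ k) v x\<bar> \<le> (2 powr p * C / c) powr (1/p) / 2 ^ k" if x: "x \<in> carrier G" for x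
  proof -
    have "\<bar>average (2 ^ k) v x\<bar> powr p \<le> (real (2 ^ Suc k) powr p * C) / vol (2 ^ k)"
      unfolding average_def
      by (rule lp_le_mean_le[OF v])
        (use finite_ball ball_nonempty assms(2) x in_carrier_of_ball in \<open>auto intro!: inj_on_left_mult ball_subset_carrier\<close>)
    also have "\<dots> \<le> (2 * 2 powr real k) powr p * C / (c * (2 powr real k) powr (2 * p))"
    proof (rule frac_le)
      show "real (2 ^ Suc k) powr p * C \<le> (2 * 2 powr real k) powr p * C" by (simp add: powr_realpow)
    qed (use C assms(3) assms(4)[of k] in auto)
    finally have "\<bar>average (2 ^ k) v x\<bar>
        \<le> ((2 * 2 powr real k) powr p * C / (c * (2 powr real k) powr (2 * p))) powr (1/p)"
      by (rule le_powr_inverse) (use assms(2) in auto)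
    also have "\<dots> = (2 powr p * C / c) powr (1/p) / 2 powr real k"
      by (rule root_of_energy_quotient) (use assms(2,3) C in auto)
    finally show ?thesis by (simp add: powr_realpow)
  qed
  have "smooth (Suc (Suc k)) f g - smooth (Suc k) f g = smooth (Suc k) v g"
    unfolding v_def by (subst smooth_diff) simp
  also have "\<dots> = smooth k (average (2 ^ k) v) g" by simp
  finally show ?thesis using smooth_abs_le[OF av assms(5)] by simp
qed

text \<open>
  \<open>f - F\<close> vanishes at infinity as a uniform limit of the functions \<open>f - smooth k f\<close>, which do so
  because they are finite sums of smoothed \<open>\<ell>\<^sup>p\<close> functions.
\<close>

lemma smooth_uniform_limit:
  assumes "finite_energy p G f" "p \<ge> 1" "c > 0"
    "\<And>k. c * (2 powr real k) powr (2 * p) \<le> vol (2 ^ k)"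
  obtains F where "vanishes_at_infinity (carrier G) (\<lambda>g. f g - F g)"
    "\<And>g. g \<in> carrier G \<Longrightarrow> (\<lambda>k. smooth (Suc k) f g) \<longlonglongrightarrow> F g"
proof -
  obtain C where C: "\<And>s. s \<in> W \<Longrightarrow> lp_le p (carrier G) (increment G f s) C"
    using assms(1,2) finite_energy_iff_generators by blast
  define M where "M = (2 powr p * C / c) powr (1/p)"
  have M: "M \<ge> 0" by (simp add: M_def)
  have step: "\<bar>smooth (Suc (Suc k)) f g - smooth (Suc k) f g\<bar> \<le> M / 2 ^ k" if "g \<in> carrier G" for g k
    unfolding M_def by (rule smooth_Cauchy[OF C assms(2,3,4) that])
  have tail: "\<bar>smooth (Suc (n + d)) f g - smooth (Suc n) f g\<bar> \<le> 2 * M / 2 ^ n" if g: "g \<in> carrier G" for g n d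
  proof -
    have "\<bar>smooth (Suc (n + d)) f g - smooth (Suc n) f g\<bar> \<le> 2 * M / 2 ^ n - 2 * M / 2 ^ (n + d)"
    proof (induction d)
      case (Suc d)
      have "2 * M / 2 ^ (n + d) - 2 * M / 2 ^ (n + Suc d) = M / 2 ^ (n + d)" by (simp add: field_simps)
      moreover have "\<bar>smooth (Suc (n + Suc d)) f g - smooth (Suc (n + d)) f g\<bar> \<le> M / 2 ^ (n + d)"
        using step[OF g, of "n + d"] by simp
      ultimately show ?case using Suc by linarith
    qed simp
    moreover have "2 * M / 2 ^ (n + d) \<ge> 0" using M by simp
    ultimately show ?thesis by linarith
  qed
  have lim0: "(\<lambda>n. 2 * M / 2 ^ n) \<longlonglongrightarrow> 0"
    using tendsto_mult_right_zero[OF LIMSEQ_power_zero[of "1/2::real"], of "2 * M"]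
    by (simp add: power_divide)
  have conv: "convergent (\<lambda>k. smooth (Suc k) f g)" if g: "g \<in> carrier G" for g
  proof -
    have "Cauchy (\<lambda>k. smooth (Suc k) f g)"
    proof (rule CauchyI')
      fix e :: real assume "e > 0"
      then obtain N where N: "\<And>n. n \<ge> N \<Longrightarrow> \<bar>2 * M / 2 ^ n\<bar> < e"
        using LIMSEQ_D[OF lim0, of e] by auto
      show "\<exists>N. \<forall>m\<ge>N. \<forall>n>m. dist (smooth (Suc m) f g) (smooth (Suc n) f g) < e"
      proof (intro exI[of _ N] allI impI)
        fix m n assume mn: "N \<le> m" "m < n"
        have "\<bar>smooth (Suc n) f g - smooth (Suc m) f g\<bar> \<le> 2 * M / 2 ^ m"
          using tail[OF g, of m "n - m"] mn by simp
        also have "\<dots> < e" using N[OF mn(1)] by linarith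
        finally show "dist (smooth (Suc m) f g) (smooth (Suc n) f g) < e"
          by (simp only: dist_real_def abs_minus_commute)
      qed
    qed
    then show ?thesis by (rule Cauchy_convergent)
  qed
  define F where "F g = lim (\<lambda>k. smooth (Suc k) f g)" for g
  have F: "(\<lambda>k. smooth (Suc k) f g) \<longlonglongrightarrow> F g" if "g \<in> carrier G" for g
    using conv[OF that] by (simp only: F_def convergent_LIMSEQ_iff)
  have FT: "\<bar>F g - smooth (Suc n) f g\<bar> \<le> 2 * M / 2 ^ n" if g: "g \<in> carrier G" for g n
  proof (rule Lim_bounded)
    show "(\<lambda>k. \<bar>smooth (Suc k) f g - smooth (Suc n) f g\<bar>) \<longlonglongrightarrow> \<bar>F g - smooth (Suc n) f g\<bar>"
      by (intro tendsto_intros F[OF g])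
    show "\<forall>k\<ge>n. \<bar>smooth (Suc k) f g - smooth (Suc n) f g\<bar> \<le> 2 * M / 2 ^ n"
    proof (intro allI impI)
      fix k assume "n \<le> k"
      then show "\<bar>smooth (Suc k) f g - smooth (Suc n) f g\<bar> \<le> 2 * M / 2 ^ n"
        using tail[OF g, of n "k - n"] by simp
    qed
  qed
  have "vanishes_at_infinity (carrier G) (\<lambda>g. f g - F g)"
  proof (rule vanishes_at_infinity_uniform_limit)
    fix \<epsilon> :: real assume "\<epsilon> > 0"
    then obtain n where n: "\<bar>2 * M / 2 ^ n\<bar> < \<epsilon>" using LIMSEQ_D[OF lim0, of \<epsilon>] by auto
    have "vanishes_at_infinity (carrier G) (\<lambda>g. f g - smooth (Suc n) f g)"
      by (rule vanishes_at_infinity_abs_mono[OF smooth_minus_vanishes[OF assms(1,2), of "Suc n"]])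
        (simp only: abs_minus_commute order_refl)
    moreover have "\<bar>(f g - F g) - (f g - smooth (Suc n) f g)\<bar> \<le> \<epsilon>" if g: "g \<in> carrier G" for g
      using FT[OF g, of n] n by linarith
    ultimately show "\<exists>u. vanishes_at_infinity (carrier G) u \<and> (\<forall>x\<in>carrier G. \<bar>(f x - F x) - u x\<bar> \<le> \<epsilon>)"
      by blast
  qed
  then show ?thesis using that F by blast
qed

end

context commuting_factors
begin

text \<open>
  The length \<open>L\<close> is recorded because averaging conjugates \<open>h\<close> and thereby consumes some of it.
\<close>

definition nearly_invariant :: "('a \<Rightarrow> real) \<Rightarrow> nat \<Rightarrow> real \<Rightarrow> bool" where
  "nearly_invariant f L e \<longleftrightarrow>
    (\<forall>g\<in>carrier G. \<forall>h\<in>word_ball G A L. \<bar>f (g \<otimes> h) - f g\<bar> \<le> e)"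

lemma conjugate_in_word_ball_A:
  assumes "h \<in> word_ball G A L" "x \<in> word_ball G A r"
  shows "inv x \<otimes> h \<otimes> x \<in> word_ball G A (L + 2 * r)"
proof -
  have "inv x \<otimes> h \<otimes> x \<in> word_ball G A (r + L + r)"
    using word_ball_mult[OF A_subset] word_ball_inv[OF A_subset inv_in_A] assms by blast
  moreover have "r + L + r = L + 2 * r" by simp
  ultimately show ?thesis by simp
qed

lemma move_past_word:
  assumes "h \<in> H" "x \<in> H" "k \<in> K"
  shows "h \<otimes> (x \<otimes> k) = (x \<otimes> k) \<otimes> (inv x \<otimes> h \<otimes> x)"
proof -
  have c: "h \<in> carrier G" "x \<in> carrier G" "k \<in> carrier G" using assms H_subset K_subset by auto
  have "inv x \<otimes> h \<otimes> x \<in> H"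
    using assms by (intro subgroup.m_closed[OF subgroup_H] subgroup.m_inv_closed[OF subgroup_H])
  from HK_commute[OF this assms(3)]
  have "(x \<otimes> k) \<otimes> (inv x \<otimes> h \<otimes> x) = x \<otimes> ((inv x \<otimes> h \<otimes> x) \<otimes> k)"
    using c by (simp add: m_assoc)
  also have "\<dots> = h \<otimes> (x \<otimes> k)" using c by (simp add: m_assoc mult_inv_mult)
  finally show ?thesis by simp
qed

interpretation cayley G U by (rule cayley_U)

lemma average_nearly_invariant:
  assumes "nearly_invariant f (L + 2 * r) e"
  shows "nearly_invariant (average r f) L e"
  unfolding nearly_invariant_def
proof (intro ballI)
  fix g h assume g: "g \<in> carrier G" and h: "h \<in> word_ball G A L"
  have hc: "h \<in> carrier G" "h \<in> H" using h H_subset by (auto simp: H_def)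
  have "\<bar>(\<Sum>w\<in>ball r. f (g \<otimes> h \<otimes> w) - f (g \<otimes> w)) / vol r\<bar> \<le> e"
  proof (rule abs_mean_le)
    fix w assume w: "w \<in> ball r"
    then obtain x k where xk: "x \<in> word_ball G A r" "k \<in> word_ball G B r" "w = x \<otimes> k"
      unfolding word_ball_U by auto
    have xH: "x \<in> H" "k \<in> K" using xk by (auto simp: H_def K_def)
    have xc: "x \<in> carrier G" "w \<in> carrier G" using xH H_subset in_carrier_of_ball[OF w] by auto
    have "g \<otimes> h \<otimes> w = g \<otimes> w \<otimes> (inv x \<otimes> h \<otimes> x)"
      using move_past_word[OF hc(2) xH] xk(3) g hc xc by (simp add: m_assoc)
    moreover have "\<bar>f (g \<otimes> w \<otimes> (inv x \<otimes> h \<otimes> x)) - f (g \<otimes> w)\<bar> \<le> e"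
      using assms g xc conjugate_in_word_ball_A[OF h xk(1)] unfolding nearly_invariant_def by simp
    ultimately show "\<bar>f (g \<otimes> h \<otimes> w) - f (g \<otimes> w)\<bar> \<le> e" by simp
  qed (use one_in_ball finite_ball in auto)
  then show "\<bar>average r f (g \<otimes> h) - average r f g\<bar> \<le> e"
    by (simp add: average_def sum_subtractf diff_divide_distrib)
qed

lemma smooth_nearly_invariant:
  "nearly_invariant f (L + 2 * 2 ^ k) e \<Longrightarrow> nearly_invariant (smooth k f) L e"
proof (induction k arbitrary: f)
  case 0
  have "word_ball G A L \<subseteq> word_ball G A (L + 2)" by (rule word_ball_mono[OF A_subset one_in_A]) simp
  then show ?case using 0 by (auto simp: nearly_invariant_def)
next
  case (Suc k)
  have "nearly_invariant (average (2 ^ k) f) (L + 2 * 2 ^ k) e"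
    by (rule average_nearly_invariant) (use Suc.prems in \<open>simp add: algebra_simps\<close>)
  from Suc.IH[OF this] show ?case by simp
qed

text \<open>
  Split the mean over a ball into means over the \<open>B\<close>-balls \<open>x \<otimes> word_ball G B r\<close>.  On each of them,
  passing from \<open>g\<close> to \<open>g \<otimes> h\<close> changes \<open>f\<close> by the increment in the fixed direction \<open>inv x \<otimes> h \<otimes> x\<close>,
  because the elements of \<open>B\<close>-balls commute with \<open>H\<close>.  So the change of the mean is small when
  \<open>B\<close>-balls are large.
\<close>

lemma average_nearly_invariant_of_energy:
  assumes "\<And>s. s \<in> U \<Longrightarrow> lp_le p (carrier G) (increment G f s) C" "p \<ge> 1"
  shows "nearly_invariant (average r f) L
    ((real (L + 2 * r) powr p * C / real (card (word_ball G B r))) powr (1/p))"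
  unfolding nearly_invariant_def
proof (intro ballI)
  fix g h assume g: "g \<in> carrier G" and h: "h \<in> word_ball G A L"
  let ?a = "real (card (word_ball G A r))" and ?b = "real (card (word_ball G B r))"
  let ?E = "real (L + 2 * r) powr p * C"
  have hc: "h \<in> carrier G" "h \<in> H" using h H_subset by (auto simp: H_def)
  have finA: "finite (word_ball G A r)" and finB: "finite (word_ball G B r)"
    using finite_word_ball finite_A finite_B by auto
  have neA: "word_ball G A r \<noteq> {}" and neB: "word_ball G B r \<noteq> {}"
    using one_in_word_ball A_subset one_in_A B_subset one_in_B by blast+
  have inner: "\<bar>(\<Sum>k\<in>word_ball G B r. f (g \<otimes> h \<otimes> (x \<otimes> k)) - f (g \<otimes> (x \<otimes> k))) / ?b\<bar> \<le> (?E / ?b) powr (1/p)"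
    if x: "x \<in> word_ball G A r" for x
  proof -
    let ?c = "inv x \<otimes> h \<otimes> x"
    have xH: "x \<in> H" using x by (auto simp: H_def)
    have xc: "x \<in> carrier G" using xH H_subset by blast
    have "?c = ?c \<otimes> \<one>" using xc hc by simp
    then have "?c \<in> word_ball G U (L + 2 * r)"
      unfolding word_ball_U
      using conjugate_in_word_ball_A[OF h x] one_in_word_ball[OF B_subset one_in_B]
      by (intro image_eqI[of _ _ "(?c, \<one>)"]) auto
    then have E: "lp_le p (carrier G) (increment G f ?c) ?E"
      using lp_le_increment_ball[OF assms(1) _ assms(2)] by blast
    have "(\<Sum>k\<in>word_ball G B r. f (g \<otimes> h \<otimes> (x \<otimes> k)) - f (g \<otimes> (x \<otimes> k)))
        = (\<Sum>k\<in>word_ball G B r. increment G f ?c (g \<otimes> x \<otimes> k))"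
    proof (rule sum.cong[OF refl])
      fix k assume "k \<in> word_ball G B r"
      then have kK: "k \<in> K" by (auto simp: K_def)
      have kc: "k \<in> carrier G" using kK K_subset by blast
      have "g \<otimes> h \<otimes> (x \<otimes> k) = g \<otimes> x \<otimes> k \<otimes> ?c"
        using move_past_word[OF hc(2) xH kK] g hc xc kc by (simp add: m_assoc)
      then show "f (g \<otimes> h \<otimes> (x \<otimes> k)) - f (g \<otimes> (x \<otimes> k)) = increment G f ?c (g \<otimes> x \<otimes> k)"
        using g xc kc by (simp add: increment_def m_assoc)
    qed
    moreover have "\<bar>(\<Sum>k\<in>word_ball G B r. increment G f ?c (g \<otimes> x \<otimes> k)) / ?b\<bar> powr p \<le> ?E / ?b"
      by (rule lp_le_mean_le[OF E finB _ _ assms(2) neB])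
        (use g xc word_ball_subset_carrier[OF B_subset] in \<open>auto intro!: inj_on_left_mult\<close>)
    ultimately have "\<bar>(\<Sum>k\<in>word_ball G B r. f (g \<otimes> h \<otimes> (x \<otimes> k)) - f (g \<otimes> (x \<otimes> k))) / ?b\<bar> powr p \<le> ?E / ?b"
      (is "?X powr p \<le> _") by simp
    then show ?thesis by (rule le_powr_inverse) (use assms(2) in auto)
  qed
  have "average r f (g \<otimes> h) - average r f g
      = (\<Sum>w\<in>ball r. f (g \<otimes> h \<otimes> w) - f (g \<otimes> w)) / vol r"
    by (simp add: average_def sum_subtractf diff_divide_distrib)
  also have "(\<Sum>w\<in>ball r. f (g \<otimes> h \<otimes> w) - f (g \<otimes> w))
      = (\<Sum>x\<in>word_ball G A r. \<Sum>k\<in>word_ball G B r. f (g \<otimes> h \<otimes> (x \<otimes> k)) - f (g \<otimes> (x \<otimes> k)))"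
    unfolding word_ball_U
    by (subst sum.reindex[OF inj_on_HK]) (simp add: sum.cartesian_product case_prod_unfold o_def)
  also have "\<dots> / vol r
      = (\<Sum>x\<in>word_ball G A r. (\<Sum>k\<in>word_ball G B r. f (g \<otimes> h \<otimes> (x \<otimes> k)) - f (g \<otimes> (x \<otimes> k))) / ?b) / ?a"
    by (simp add: card_word_ball_U sum_divide_distrib[symmetric])
  finally show "\<bar>average r f (g \<otimes> h) - average r f g\<bar> \<le> (?E / ?b) powr (1/p)"
    using abs_mean_le[OF neA finA inner] by simp
qed

text \<open>
  At the infinitely many scales at which \<open>B\<close>-balls are large, \<open>smooth (Suc k) f\<close> is invariant under \<open>A\<close>
  up to \<open>O(1 / 2 ^ k)\<close>: the innermost average makes it so, with enough length to spare for the
  others.  So the limit \<open>F\<close> is invariant under \<open>H\<close>.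
\<close>

lemma fast_growth_constant_at_infinity_aux:
  assumes "finite_energy p G f" "p \<ge> 1" "c > 0" "d > 0"
    "\<And>k. c * (2 powr real k) powr (2 * p) \<le> real (card (word_ball G U (2 ^ k)))"
    "\<exists>\<^sub>\<infinity>k. d * (2 powr real k) powr (2 * p) \<le> real (card (word_ball G B (2 ^ k)))"
  shows "constant_at_infinity (carrier G) f"
proof -
  obtain C where C: "\<And>s. s \<in> U \<Longrightarrow> lp_le p (carrier G) (increment G f s) C"
    using assms(1,2) finite_energy_iff_generators by blast
  have C0: "C \<ge> 0" using lp_le_nonneg[OF C[OF one_in_W]] .
  obtain F where F: "vanishes_at_infinity (carrier G) (\<lambda>g. f g - F g)"
    "\<And>g. g \<in> carrier G \<Longrightarrow> (\<lambda>k. smooth (Suc k) f g) \<longlonglongrightarrow> F g"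
    using smooth_uniform_limit[OF assms(1,2,3,5)] by blast
  define M where "M = (5 powr p * C / d) powr (1/p)"
  have small: "nearly_invariant (smooth (Suc k) f) 1 (M / 2 ^ k)"
    if k: "d * (2 powr real k) powr (2 * p) \<le> real (card (word_ball G B (2 ^ k)))" for k
  proof -
    \<comment> \<open>The averages in \<open>smooth k\<close> have radii \<open>1, 2, \<dots>, 2 ^ (k - 1)\<close> and consume less than
      \<open>2 * 2 ^ k\<close> of the length in total; the innermost average consumes as much once more.\<close>
    let ?e = "(real (1 + 2 * 2 ^ k + 2 * 2 ^ k) powr p * C / real (card (word_ball G B (2 ^ k)))) powr (1/p)"
    have inv: "nearly_invariant (smooth (Suc k) f) 1 ?e"
      using smooth_nearly_invariant[OF average_nearly_invariant_of_energy[OF C assms(2), of "2 ^ k" "1 + 2 * 2 ^ k"]]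
      by simp
    have "?e \<le> ((5 * 2 powr real k) powr p * C / (d * (2 powr real k) powr (2 * p))) powr (1/p)"
    proof (intro powr_mono2 frac_le mult_right_mono)
      have "(1::real) \<le> 2 ^ k" by simp
      then show "real (1 + 2 * 2 ^ k + 2 * 2 ^ k) \<le> 5 * 2 powr real k"
        by (simp add: powr_realpow)
    qed (use assms(2,4) C0 k in auto)
    also have "\<dots> = M / 2 powr real k"
      unfolding M_def by (rule root_of_energy_quotient) (use assms(2,4) C0 in auto)
    also have "\<dots> = M / 2 ^ k" by (simp add: powr_realpow)
    finally have "?e \<le> M / 2 ^ k" .
    then show ?thesis using inv by (meson nearly_invariant_def order_trans)
  qed
  have lim0: "(\<lambda>k. M / 2 ^ k) \<longlonglongrightarrow> 0"
    using tendsto_mult_right_zero[OF LIMSEQ_power_zero[of "1/2::real"], of M]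
    by (simp add: power_divide)
  have FA: "F (g \<otimes> a) = F g" if g: "g \<in> carrier G" and a: "a \<in> A" for g a
  proof (rule ccontr)
    assume ne: "F (g \<otimes> a) \<noteq> F g"
    let ?D = "\<lambda>k. smooth (Suc k) f (g \<otimes> a) - smooth (Suc k) f g"
    have ac: "a \<in> carrier G" using a A_subset by blast
    have "(\<lambda>k. \<bar>?D k\<bar> - M / 2 ^ k) \<longlonglongrightarrow> \<bar>F (g \<otimes> a) - F g\<bar> - 0"
      by (intro tendsto_intros lim0 F(2)) (use g ac in auto)
    moreover have "\<bar>F (g \<otimes> a) - F g\<bar> - 0 > 0" using ne by simp
    ultimately have "\<forall>\<^sub>F k in sequentially. 0 < \<bar>?D k\<bar> - M / 2 ^ k" by (rule order_tendstoD(1))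
    then obtain N where N: "\<And>k. k \<ge> N \<Longrightarrow> 0 < \<bar>?D k\<bar> - M / 2 ^ k"
      unfolding eventually_sequentially by blast
    obtain k where k: "k \<ge> N" "d * (2 powr real k) powr (2 * p) \<le> real (card (word_ball G B (2 ^ k)))"
      using assms(6) unfolding INFM_nat_le by blast
    have "a \<in> word_ball G A 1" using a word_ball_one[OF A_subset] by simp
    then have "\<bar>?D k\<bar> \<le> M / 2 ^ k" using small[OF k(2)] g unfolding nearly_invariant_def by blast
    then show False using N[OF k(1)] by linarith
  qed
  have FH: "F (g \<otimes> h) = F g" if g: "g \<in> carrier G" and h: "h \<in> word_ball G A n" for g h n
    using h
  proof (induction n arbitrary: h)
    case 0
    then show ?case using g by simp
  next
    case (Suc n)
    then obtain z a where z: "z \<in> word_ball G A n" "a \<in> A" "h = z \<otimes> a" by auto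
    have c: "z \<in> carrier G" "a \<in> carrier G"
      using z A_subset word_ball_subset_carrier[OF A_subset] by blast+
    have "F (g \<otimes> h) = F ((g \<otimes> z) \<otimes> a)" using z(3) c g by (simp add: m_assoc)
    also have "\<dots> = F (g \<otimes> z)" by (rule FA) (use c g z in auto)
    also have "\<dots> = F g" by (rule Suc.IH[OF z(1)])
    finally show ?case .
  qed
  show ?thesis
  proof (rule constant_at_infinity_of_invariant_limit[OF F(1)])
    show "F (g \<otimes> h) = F g" if "g \<in> carrier G" "h \<in> H" for g h
      using FH that by (auto simp: H_def)
    show "vanishes_at_infinity (carrier G) (increment G f k)" if "k \<in> K" for k
      by (rule finite_energy_vanishes[OF assms(1,2)]) (use that K_subset in blast)
  qed
qed

text \<open>
  The balls of the product are the products of the balls of the factors.  Hence at each scale one of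
  the factors has at least the square root of the number of elements, and one of them does so
  infinitely often.
\<close>

lemma fast_growth_constant_at_infinity:
  assumes "finite_energy p G f" "p \<ge> 1" "c > 0"
    "\<And>k. c * (2 powr real k) powr (4 * p) \<le> real (card (word_ball G U (2 ^ k)))"
  shows "constant_at_infinity (carrier G) f"
proof -
  let ?t = "\<lambda>k::nat. (2 powr real k) powr (2 * p)"
  have t: "?t k \<ge> 1" for k using assms(2) by (simp add: powr_powr ge_one_powr_ge_zero)
  have tt: "(2 powr real k) powr (4 * p) = ?t k * ?t k" for k by (simp add: powr_add[symmetric])
  have slow: "c * ?t k \<le> real (card (word_ball G U (2 ^ k)))" for k
  proof -
    have "c * ?t k \<le> c * (?t k * ?t k)"
      using t[of k] assms(3) by (intro mult_left_mono) auto
    then show ?thesis using assms(4)[of k] by (simp only: tt)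
  qed
  define d where "d = sqrt c"
  have d: "d > 0" "d * d = c" using assms(3) by (auto simp: d_def)
  have "d * ?t k \<le> real (card (word_ball G B (2 ^ k))) \<or> d * ?t k \<le> real (card (word_ball G A (2 ^ k)))" for k
  proof (rule ccontr)
    assume "\<not> ?thesis"
    then have "real (card (word_ball G A (2 ^ k))) * real (card (word_ball G B (2 ^ k))) < (d * ?t k) * (d * ?t k)"
      by (intro mult_strict_mono') auto
    also have "\<dots> = (d * d) * (?t k * ?t k)" by (simp only: ac_simps)
    also have "\<dots> = c * (2 powr real k) powr (4 * p)" by (simp only: d(2) tt)
    finally show False using assms(4)[of k] by (simp add: card_word_ball_U)
  qed
  then have "\<exists>\<^sub>\<infinity>k. d * ?t k \<le> real (card (word_ball G B (2 ^ k))) \<or> d * ?t k \<le> real (card (word_ball G A (2 ^ k)))"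
    by (auto simp: INFM_nat_le)
  then consider "\<exists>\<^sub>\<infinity>k. d * ?t k \<le> real (card (word_ball G B (2 ^ k)))"
    | "\<exists>\<^sub>\<infinity>k. d * ?t k \<le> real (card (word_ball G A (2 ^ k)))"
    unfolding frequently_disj_iff by blast
  then show ?thesis
  proof cases
    case 1
    show ?thesis by (rule fast_growth_constant_at_infinity_aux[OF assms(1,2,3) d(1) slow 1])
  next
    case 2
    interpret swap: commuting_factors G B A by (rule swap)
    show ?thesis
      by (rule swap.fast_growth_constant_at_infinity_aux[OF assms(1,2,3) d(1) _ 2, unfolded swap_U, OF slow])
  qed
qed

end

section \<open>Slow growth: averaging over balls\<close>

context cayley
begin

text \<open>
  Taking \<open>c\<close> very small rules out small \<open>k\<close>, as balls are nonempty.
\<close>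

lemma slow_growth_infinitely_often:
  assumes "\<And>c. c > 0 \<Longrightarrow> \<exists>k. vol (2 ^ k) < c * (2 powr real k) powr D" "D \<ge> 0"
  shows "\<exists>k\<ge>N. vol (2 ^ k) \<le> (2 powr real k) powr D"
proof -
  define c where "c = 1 / (2 powr real N) powr D"
  have c: "c > 0" by (simp add: c_def)
  obtain k where k: "vol (2 ^ k) < c * (2 powr real k) powr D" using assms(1)[OF c] by blast
  have p1: "(2 powr real N) powr D \<ge> 1" using assms(2) by (simp add: powr_powr ge_one_powr_ge_zero)
  have pos: "(2 powr real k) powr D \<ge> 0" by simp
  have "k \<ge> N"
  proof (rule ccontr)
    assume "\<not> k \<ge> N"
    then have "(2 powr real k) powr D \<le> (2 powr real N) powr D"
      by (intro powr_mono2) (use assms(2) in auto)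
    then have "c * (2 powr real k) powr D \<le> 1" using p1 by (simp add: c_def)
    moreover have "vol (2 ^ k) \<ge> 1" using card_ball_pos[of "2 ^ k"] by simp
    ultimately show False using k by linarith
  qed
  moreover have "c \<le> 1" using p1 by (simp add: c_def)
  then have "c * (2 powr real k) powr D \<le> (2 powr real k) powr D"
    using pos by (simp add: mult_left_le_one_le c less_imp_le)
  ultimately show ?thesis using k by (intro exI[of _ k]) linarith
qed

text \<open>
  If the number of elements grew by a factor \<open>2 powr (D + 1)\<close> at each doubling from radius \<open>2 ^ R\<close> on,
  it would eventually exceed the bound with exponent \<open>D\<close> for good.
\<close>

lemma doubling_scale:
  assumes "\<And>N. \<exists>k\<ge>N. vol (2 ^ k) \<le> (2 powr real k) powr D"
  shows "\<exists>r\<ge>R. r > 0 \<and> vol (2 * r) \<le> 2 powr (D + 1) * vol r"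
proof (rule ccontr)
  assume "\<not> ?thesis"
  then have no: "2 powr (D + 1) * vol r < vol (2 * r)" if "r \<ge> R" "r > 0" for r
    using that by (meson not_le)
  have "2 ^ R \<ge> R" by (simp add: less_imp_le)
  have grow: "(2 powr (D + 1)) ^ i \<le> vol (2 ^ (R + i))" for i
  proof (induction i)
    case 0
    then show ?case using card_ball_pos[of "2 ^ R"] by simp
  next
    case (Suc i)
    have "R \<le> 2 ^ (R + i)"
      using \<open>2 ^ R \<ge> R\<close> by (rule order_trans) simp
    then have "2 powr (D + 1) * vol (2 ^ (R + i)) < vol (2 * 2 ^ (R + i))"
      by (rule no) simp
    moreover have "2 powr (D + 1) * (2 powr (D + 1)) ^ i \<le> 2 powr (D + 1) * vol (2 ^ (R + i))"
      by (intro mult_left_mono Suc.IH) simp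
    ultimately show ?case unfolding power_Suc add_Suc_right by linarith
  qed
  obtain m :: nat where m: "2 powr (real R * D) < 2 ^ m"
    using real_arch_pow[of 2 "2 powr (real R * D)"] by auto
  obtain k where k: "k \<ge> R + m" "vol (2 ^ k) \<le> (2 powr real k) powr D"
    using assms by blast
  define i where "i = k - R"
  have i: "k = R + i" "i \<ge> m" using k by (auto simp: i_def)
  have "(2 powr (D + 1)) ^ i \<le> (2 powr real k) powr D" using grow[of i] k(2) i(1) by simp
  also have "(2 powr real k) powr D = 2 powr (real R * D) * 2 powr (real i * D)"
    by (simp add: powr_powr i(1) powr_add[symmetric] algebra_simps)
  also have "(2 powr (D + 1)) ^ i = 2 powr (real i * D) * 2 powr real i"
    by (simp add: powr_realpow[symmetric] powr_powr powr_add[symmetric] algebra_simps)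
  finally have "2 powr real i \<le> 2 powr (real R * D)" by simp
  moreover have "(2::real) ^ m \<le> 2 ^ i" using i(2) by (intro power_increasing) auto
  ultimately show False using m by (simp add: powr_realpow)
qed

text \<open>
  The shells between \<open>r\<close> and \<open>2 * r\<close> are disjoint and have at most \<open>Q * vol r\<close> elements together, so
  one of the \<open>r\<close> shells is at most the average.
\<close>

lemma small_boundary_radius:
  assumes "r > 0" "vol (2 * r) \<le> Q * vol r"
  shows "\<exists>j\<ge>r. j < 2 * r \<and>
    vol (Suc j) - vol j \<le> Q / real r * vol j"
proof (rule ccontr)
  assume "\<not> ?thesis"
  then have no: "Q / real r * vol j < vol (Suc j) - vol j"
    if "r \<le> j" "j < 2 * r" for j
    using that by (meson not_le)
  have Q: "Q > 0"
  proof -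
    have "0 < Q * vol r" using assms(2) card_ball_pos_real[of "2 * r"] by linarith
    then show ?thesis using card_ball_pos_real[of r] by (simp add: zero_less_mult_iff)
  qed
  have "Q * vol r = (\<Sum>j=r..<2*r. Q / real r * vol r)"
    using assms(1) by simp
  also have "\<dots> \<le> (\<Sum>j=r..<2*r. Q / real r * vol j)"
    using Q by (intro sum_mono mult_left_mono) (auto intro!: card_mono finite_ball ball_mono)
  also have "\<dots> < (\<Sum>j=r..<2*r. vol (Suc j) - vol j)"
    by (rule sum_strict_mono) (use assms(1) no in auto)
  also have "\<dots> = vol (2 * r) - vol r"
    by (rule sum_Suc_diff') simp
  finally show False using assms(2) card_ball_pos_real[of r] by linarith
qed

text \<open>
  Passing from \<open>g\<close> to \<open>g \<otimes> s\<close> replaces the ball \<open>ball j\<close> in the mean by its translate, of the same size.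
  Therefore one may subtract \<open>f g\<close> from all values, and only increments of \<open>f\<close> in the
  directions of the symmetric difference remain.  These directions lie in \<open>ball (Suc j)\<close>, and their
  number is at most \<open>2 * \<delta> * vol j\<close>.
\<close>

lemma lp_le_increment_average:
  assumes "\<And>y. y \<in> ball (Suc j) \<Longrightarrow> lp_le p (carrier G) (increment G f y) E" "p \<ge> 1" "s \<in> W"
    "vol (Suc j) - vol j \<le> \<delta> * vol j"
  shows "lp_le p (carrier G) (increment G (average j f) s) (2 powr p * 2 * \<delta> powr p * E)"
proof -
  let ?B = "ball j" and ?V = "vol j"
  define sB where "sB = (\<lambda>w. s \<otimes> w) ` ?B"
  have sc: "s \<in> carrier G" using assms(3) in_carrier_of_W by blast
  have inj: "inj_on (\<lambda>w. s \<otimes> w) ?B" using sc ball_subset_carrier by (intro inj_on_left_mult)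
  have fin: "finite sB" "finite ?B" using finite_ball by (auto simp: sB_def)
  have card_eq: "card sB = card ?B" unfolding sB_def by (rule card_image[OF inj])
  have sub: "sB \<subseteq> ball (Suc j)"
    using word_ball_Suc_left[OF W_subset assms(3)] by (auto simp: sB_def)
  have sub': "?B \<subseteq> ball (Suc j)" by (rule ball_mono) simp
  have E: "E \<ge> 0" using lp_le_nonneg[OF assms(1)[OF one_in_ball]] .
  have "card (sB - ?B) \<le> card (ball (Suc j) - ?B)"
    by (rule card_mono[OF finite_Diff[OF finite_ball] Diff_mono[OF sub order_refl]])
  also have "\<dots> = card (ball (Suc j)) - card ?B" by (rule card_Diff_subset[OF fin(2) sub'])
  finally have "real (card (sB - ?B)) \<le> vol (Suc j) - ?V"
    using card_mono[OF finite_ball sub'] by linarith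
  then have c1: "real (card (sB - ?B)) \<le> \<delta> * ?V" using assms(4) by linarith
  have "card (?B - sB) = card (sB - ?B)"
    using card_eq fin by (simp add: card_Diff_subset_Int Int_commute)
  then have c2: "real (card (?B - sB)) \<le> \<delta> * ?V" using c1 by simp
  have V: "?V > 0" by (rule card_ball_pos_real)
  have d0: "\<delta> \<ge> 0" using order_trans[OF _ c1, of 0] V by (simp add: zero_le_mult_iff)
  have yc: "y \<in> carrier G" if "y \<in> sB \<union> ?B" for y
    using that sub sub' in_carrier_of_ball by blast
  have eq: "increment G (average j f) s g
      = ((\<Sum>y\<in>sB - ?B. increment G f y g) - (\<Sum>y\<in>?B - sB. increment G f y g)) / ?V"
    if g: "g \<in> carrier G" for g
  proof -
    have "(\<Sum>w\<in>?B. f (g \<otimes> s \<otimes> w)) = (\<Sum>y\<in>sB. f (g \<otimes> y))"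
      unfolding sB_def by (subst sum.reindex[OF inj])
        (use g sc in_carrier_of_ball in \<open>auto simp: m_assoc intro!: sum.cong\<close>)
    also have "\<dots> = (\<Sum>y\<in>sB. increment G f y g) + ?V * f g"
      using card_eq by (simp add: increment_def sum_subtractf)
    finally have 1: "(\<Sum>w\<in>?B. f (g \<otimes> s \<otimes> w)) = (\<Sum>y\<in>sB. increment G f y g) + ?V * f g" .
    have 2: "(\<Sum>w\<in>?B. f (g \<otimes> w)) = (\<Sum>y\<in>?B. increment G f y g) + ?V * f g"
      by (simp add: increment_def sum_subtractf)
    have 3: "(\<Sum>y\<in>sB. increment G f y g)
        = (\<Sum>y\<in>sB \<inter> ?B. increment G f y g) + (\<Sum>y\<in>sB - ?B. increment G f y g)"
      by (rule sum.Int_Diff[OF fin(1)])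
    have 4: "(\<Sum>y\<in>?B. increment G f y g)
        = (\<Sum>y\<in>sB \<inter> ?B. increment G f y g) + (\<Sum>y\<in>?B - sB. increment G f y g)"
      by (subst sum.Int_Diff[OF fin(2), of _ sB]) (simp add: Int_commute)
    have "increment G (average j f) s g
        = ((\<Sum>w\<in>?B. f (g \<otimes> s \<otimes> w)) - (\<Sum>w\<in>?B. f (g \<otimes> w))) / ?V"
      by (simp add: increment_def average_def diff_divide_distrib)
    then show ?thesis unfolding 1 2 3 4 by simp
  qed
  have part: "lp_le p (carrier G) (\<lambda>g. \<Sum>y\<in>Y. increment G f y g) ((\<delta> * ?V) powr p * E)"
    if "finite Y" "Y \<subseteq> ball (Suc j)" "real (card Y) \<le> \<delta> * ?V" for Y
  proof -
    have "lp_le p (carrier G) (\<lambda>g. \<Sum>y\<in>Y. increment G f y g) (real (card Y) powr p * E)"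
      by (rule lp_le_sum[OF that(1) assms(1) assms(2)]) (use that in auto)
    then show ?thesis
      by (rule lp_le_mono) (use that E assms(2) in \<open>auto intro!: mult_right_mono powr_mono2\<close>)
  qed
  have "lp_le p (carrier G)
      (\<lambda>g. ((\<Sum>y\<in>sB - ?B. increment G f y g) - (\<Sum>y\<in>?B - sB. increment G f y g)) / ?V)
      (2 powr p * ((\<delta> * ?V) powr p * E + (\<delta> * ?V) powr p * E) / ?V powr p)"
    by (intro lp_le_divide lp_le_diff part c1 c2 V assms(2)) (use fin sub sub' in auto)
  also have "2 powr p * ((\<delta> * ?V) powr p * E + (\<delta> * ?V) powr p * E) / ?V powr p = 2 powr p * 2 * \<delta> powr p * E"
    using V d0 by (simp add: powr_mult)
  finally show ?thesis by (subst lp_le_cong[OF eq])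
qed

text \<open>
  The fraction of boundary points, \<open>O(1 / r)\<close>, meets increments of norm \<open>o(r)\<close>.
\<close>

lemma slow_growth_lp_approximable:
  assumes "finite_energy p G f" "p > 1"
    "\<And>N. \<exists>k\<ge>N. vol (2 ^ k) \<le> (2 powr real k) powr D"
  shows "lp_approximable p f"
  unfolding lp_approximable_def
proof (intro allI impI)
  fix \<epsilon> :: real assume e: "\<epsilon> > 0"
  have p: "p \<ge> 1" using assms(2) by simp
  obtain C where C: "\<And>s. s \<in> W \<Longrightarrow> lp_le p (carrier G) (increment G f s) C"
    using assms(1) p finite_energy_iff_generators by blast
  define Q where "Q = 2 powr (D + 1)"
  define M where "M = 2 powr p * 2 * Q powr p * 2 powr p"
  have Q: "Q > 0" by (simp add: Q_def)
  have M: "M > 0" using Q by (simp add: M_def)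
  \<comment> \<open>The final bound is \<open>M * (2 * D' * r powr (1 - p)) + M * \<eta> * 2 powr p\<close>; this \<open>\<eta>\<close> makes
    the second summand \<open>\<epsilon> / 2\<close>.\<close>
  define \<eta> where "\<eta> = \<epsilon> / (2 * M * 2 powr p)"
  have eta: "\<eta> > 0" using e M by (simp add: \<eta>_def)
  obtain D' where D': "D' \<ge> 0" "\<And>n y. y \<in> ball n \<Longrightarrow>
    lp_le p (carrier G) (increment G f y) (2 powr p * (D' * real n + \<eta> * real n powr p))"
    using lp_le_increment_sublinear[OF C p eta] by blast
  have "((\<lambda>x. x powr (1 - p)) \<longlongrightarrow> 0) at_top"
    using assms(2) by (intro tendsto_neg_powr filterlim_ident) auto
  then have "((\<lambda>n. real n powr (1 - p)) \<longlongrightarrow> 0) sequentially"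
    using filterlim_compose filterlim_real_sequentially by blast
  then have "((\<lambda>n. M * (2 * D' * real n powr (1 - p))) \<longlongrightarrow> M * (2 * D' * 0)) sequentially"
    by (intro tendsto_intros)
  then have "\<forall>\<^sub>F n in sequentially. M * (2 * D' * real n powr (1 - p)) < \<epsilon> / 2"
    using e by (intro order_tendstoD(2)) auto
  then obtain R where R: "\<And>n. n \<ge> R \<Longrightarrow> M * (2 * D' * real n powr (1 - p)) < \<epsilon> / 2"
    unfolding eventually_sequentially by blast
  obtain r where r: "r \<ge> R" "r > 0" "vol (2 * r) \<le> Q * vol r"
    using doubling_scale[OF assms(3)] unfolding Q_def by blast
  obtain j where j: "r \<le> j" "j < 2 * r"
    "vol (Suc j) - vol j \<le> Q / real r * vol j"
    using small_boundary_radius[OF r(2,3)] by blast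
  have E: "lp_le p (carrier G) (increment G f y) (2 powr p * (D' * real (2 * r) + \<eta> * real (2 * r) powr p))"
    if "y \<in> ball (Suc j)" for y
    by (rule D'(2)) (use that ball_mono[of "Suc j" "2 * r"] j in auto)
  have bound: "2 powr p * 2 * (Q / real r) powr p * (2 powr p * (D' * real (2 * r) + \<eta> * real (2 * r) powr p)) \<le> \<epsilon>"
  proof -
    have "2 powr p * 2 * (Q / real r) powr p * (2 powr p * (D' * real (2 * r) + \<eta> * real (2 * r) powr p))
        = M * (2 * D' * (real r / real r powr p)) + M * \<eta> * 2 powr p"
      using Q r(2) by (simp add: M_def powr_divide powr_mult field_simps)
    also have "real r / real r powr p = real r powr (1 - p)"
      using r(2) by (simp add: powr_diff)
    also have "M * \<eta> * 2 powr p = \<epsilon> / 2" using M by (simp add: \<eta>_def)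
    finally show ?thesis using R[OF r(1)] by linarith
  qed
  show "\<exists>u. (\<exists>C. lp_le p (carrier G) u C) \<and>
     (\<forall>s\<in>W. lp_le p (carrier G) (increment G (\<lambda>g. f g - u g) s) \<epsilon>)"
  proof (intro exI[of _ "\<lambda>g. f g - average j f g"] conjI ballI)
    have "lp_le p (carrier G) (\<lambda>g. - (average j f g - f g)) (real j powr p * C)"
      by (rule lp_le_uminus[OF lp_le_average_minus[OF C p]])
    then show "\<exists>C. lp_le p (carrier G) (\<lambda>g. f g - average j f g) C" by auto
    fix s assume "s \<in> W"
    from lp_le_mono[OF lp_le_increment_average[OF E p this j(3)] bound]
    show "lp_le p (carrier G) (increment G (\<lambda>g. f g - (f g - average j f g)) s) \<epsilon>" by simp
  qed
qed

end

section \<open>The uniform random walk\<close>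

context cayley
begin

text \<open>
  The distribution at time \<open>n\<close> of the walk from the identity with independent uniform steps in \<open>W\<close>.
  The recursion conditions on the first step; by \<open>walk_Suc_last\<close> one may also condition on the
  last one.  Entropy needs the former and the martingale property the latter.
\<close>

primrec walk :: "nat \<Rightarrow> 'a \<Rightarrow> real" where
  "walk 0 x = (if x = \<one> then 1 else 0)"
| "walk (Suc n) x = (\<Sum>s\<in>W. walk n (inv s \<otimes> x)) / real (card W)"

definition expect :: "nat \<Rightarrow> ('a \<Rightarrow> real) \<Rightarrow> real" where
  "expect n \<phi> = (\<Sum>x\<in>ball n. walk n x * \<phi> x)"

lemma card_W_pos: "real (card W) > 0"
  using finite_W one_in_W by (auto simp: card_gt_0_iff)

lemma walk_nonneg: "walk n x \<ge> 0"
  by (induction n arbitrary: x) (auto intro!: divide_nonneg_nonneg sum_nonneg)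

lemma walk_zero: "x \<in> carrier G \<Longrightarrow> x \<notin> ball n \<Longrightarrow> walk n x = 0"
proof (induction n arbitrary: x)
  case (Suc n)
  have "walk n (inv s \<otimes> x) = 0" if s: "s \<in> W" for s
  proof (rule Suc.IH)
    have sc: "s \<in> carrier G" using s in_carrier_of_W by blast
    then show "inv s \<otimes> x \<in> carrier G" using Suc.prems(1) by simp
    show "inv s \<otimes> x \<notin> ball n"
      using word_ball_Suc_left[OF W_subset s, of "inv s \<otimes> x" n] Suc.prems sc mult_inv_mult by auto
  qed
  then show ?case by simp
qed simp

lemma sum_translate_ball:
  assumes "\<And>x. x \<in> carrier G \<Longrightarrow> \<sigma> x \<in> carrier G \<and> \<tau> (\<sigma> x) = x"
    "\<And>y. y \<in> ball n \<Longrightarrow> \<sigma> (\<tau> y) = y \<and> \<tau> y \<in> ball (Suc n)"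
    "\<And>y. y \<in> carrier G \<Longrightarrow> y \<notin> ball n \<Longrightarrow> \<psi> y = 0"
  shows "(\<Sum>x\<in>ball (Suc n). \<psi> (\<sigma> x)) = (\<Sum>y\<in>ball n. \<psi> y)"
proof -
  have inj: "inj_on \<tau> (ball n)" by (rule inj_on_inverseI[where g=\<sigma>]) (use assms(2) in blast)
  have sub: "\<tau> ` ball n \<subseteq> ball (Suc n)" using assms(2) by blast
  have "(\<Sum>x\<in>ball (Suc n). \<psi> (\<sigma> x)) = (\<Sum>x\<in>\<tau> ` ball n. \<psi> (\<sigma> x))"
  proof (rule sum.mono_neutral_right[OF finite_ball sub], rule ballI)
    fix x assume x: "x \<in> ball (Suc n) - \<tau> ` ball n"
    then have xc: "x \<in> carrier G" using in_carrier_of_ball by blast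
    have "\<sigma> x \<notin> ball n" using x assms(1)[OF xc] by (metis DiffD2 imageI)
    then show "\<psi> (\<sigma> x) = 0" using assms(3) assms(1)[OF xc] by blast
  qed
  also have "\<dots> = (\<Sum>y\<in>ball n. \<psi> (\<sigma> (\<tau> y)))" by (simp only: sum.reindex[OF inj] o_def)
  also have "\<dots> = (\<Sum>y\<in>ball n. \<psi> y)"
    by (rule sum.cong[OF refl]) (simp only: assms(2))
  finally show ?thesis .
qed

lemma sum_left_translate_ball:
  assumes "s \<in> W" "\<And>y. y \<in> carrier G \<Longrightarrow> y \<notin> ball n \<Longrightarrow> \<psi> y = 0"
  shows "(\<Sum>x\<in>ball (Suc n). \<psi> (inv s \<otimes> x)) = (\<Sum>y\<in>ball n. \<psi> y)"
proof (rule sum_translate_ball[where \<tau>="\<lambda>y. s \<otimes> y"])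
  have sc: "s \<in> carrier G" using assms(1) in_carrier_of_W by blast
  show "inv s \<otimes> x \<in> carrier G \<and> s \<otimes> (inv s \<otimes> x) = x" if "x \<in> carrier G" for x
    using that sc mult_inv_mult by simp
  show "inv s \<otimes> (s \<otimes> y) = y \<and> s \<otimes> y \<in> ball (Suc n)" if "y \<in> ball n" for y
    using word_ball_Suc_left[OF W_subset assms(1) that] sc in_carrier_of_ball[OF that]
    by (simp add: m_assoc[symmetric] del: word_ball.simps)
qed (rule assms(2))

lemma sum_right_translate_ball:
  assumes "s \<in> W" "\<And>y. y \<in> carrier G \<Longrightarrow> y \<notin> ball n \<Longrightarrow> \<psi> y = 0"
  shows "(\<Sum>x\<in>ball (Suc n). \<psi> (x \<otimes> inv s)) = (\<Sum>y\<in>ball n. \<psi> y)"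
proof (rule sum_translate_ball[where \<tau>="\<lambda>y. y \<otimes> s"])
  have sc: "s \<in> carrier G" using assms(1) in_carrier_of_W by blast
  show "x \<otimes> inv s \<in> carrier G \<and> x \<otimes> inv s \<otimes> s = x" if "x \<in> carrier G" for x
    using that sc by (simp add: m_assoc)
  show "y \<otimes> s \<otimes> inv s = y \<and> y \<otimes> s \<in> ball (Suc n)" if "y \<in> ball n" for y
    using word_ball_SucI[OF that assms(1)] sc in_carrier_of_ball[OF that]
    by (simp add: m_assoc del: word_ball.simps)
qed (rule assms(2))

lemma expect_Suc_first:
  "expect (Suc n) \<phi> = (\<Sum>s\<in>W. expect n (\<lambda>y. \<phi> (s \<otimes> y))) / real (card W)"
proof -
  have "expect (Suc n) \<phi> = (\<Sum>x\<in>ball (Suc n). \<Sum>s\<in>W. walk n (inv s \<otimes> x) * \<phi> x) / real (card W)"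
    by (simp only: expect_def walk.simps sum_distrib_right sum_divide_distrib times_divide_eq_left)
  also have "(\<Sum>x\<in>ball (Suc n). \<Sum>s\<in>W. walk n (inv s \<otimes> x) * \<phi> x)
      = (\<Sum>s\<in>W. \<Sum>x\<in>ball (Suc n). walk n (inv s \<otimes> x) * \<phi> x)"
    by (rule sum.swap)
  also have "\<dots> = (\<Sum>s\<in>W. expect n (\<lambda>y. \<phi> (s \<otimes> y)))"
  proof (rule sum.cong[OF refl])
    fix s assume s: "s \<in> W"
    have sc: "s \<in> carrier G" using s in_carrier_of_W by blast
    have "(\<Sum>x\<in>ball (Suc n). walk n (inv s \<otimes> x) * \<phi> x)
        = (\<Sum>x\<in>ball (Suc n). walk n (inv s \<otimes> x) * \<phi> (s \<otimes> (inv s \<otimes> x)))"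
    proof (rule sum.cong[OF refl])
      fix x assume "x \<in> ball (Suc n)"
      then have "s \<otimes> (inv s \<otimes> x) = x" by (intro mult_inv_mult[OF sc] in_carrier_of_ball)
      then show "walk n (inv s \<otimes> x) * \<phi> x = walk n (inv s \<otimes> x) * \<phi> (s \<otimes> (inv s \<otimes> x))" by simp
    qed
    also have "\<dots> = (\<Sum>y\<in>ball n. walk n y * \<phi> (s \<otimes> y))"
      by (rule sum_left_translate_ball[OF s, where \<psi>="\<lambda>y. walk n y * \<phi> (s \<otimes> y)"])
        (simp add: walk_zero)
    finally show "(\<Sum>x\<in>ball (Suc n). walk n (inv s \<otimes> x) * \<phi> x) = expect n (\<lambda>y. \<phi> (s \<otimes> y))"
      by (simp add: expect_def)
  qed
  finally show ?thesis .
qed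

lemma walk_Suc_last: "x \<in> carrier G \<Longrightarrow> walk (Suc n) x = (\<Sum>s\<in>W. walk n (x \<otimes> inv s)) / real (card W)"
proof (induction n arbitrary: x)
  case 0
  have "walk 0 (inv s \<otimes> x) = walk 0 (x \<otimes> inv s)" if s: "s \<in> W" for s
  proof -
    have sc: "s \<in> carrier G" using s in_carrier_of_W by blast
    have "inv s \<otimes> x = \<one> \<longleftrightarrow> x \<otimes> inv s = \<one>"
      using sc 0 by (metis inv_closed inv_comm)
    then show ?thesis by simp
  qed
  then show ?case by simp
next
  case (Suc n)
  have "walk (Suc (Suc n)) x = (\<Sum>s\<in>W. (\<Sum>t\<in>W. walk n (inv s \<otimes> x \<otimes> inv t)) / real (card W)) / real (card W)"
    unfolding walk.simps(2)[of "Suc n"]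
    by (intro arg_cong2[where f="(/)"] sum.cong refl Suc.IH) (use Suc.prems in_carrier_of_W in auto)
  also have "\<dots> = (\<Sum>t\<in>W. (\<Sum>s\<in>W. walk n (inv s \<otimes> (x \<otimes> inv t))) / real (card W)) / real (card W)"
    unfolding sum_divide_distrib[symmetric]
    by (subst sum.swap) (use Suc.prems in_carrier_of_W in \<open>simp add: m_assoc cong: sum.cong\<close>)
  also have "\<dots> = (\<Sum>t\<in>W. walk (Suc n) (x \<otimes> inv t)) / real (card W)" by simp
  finally show ?case .
qed

lemma expect_Suc_last:
  "expect (Suc n) \<phi> = expect n (\<lambda>y. (\<Sum>s\<in>W. \<phi> (y \<otimes> s)) / real (card W))"
proof -
  have "expect (Suc n) \<phi> = (\<Sum>x\<in>ball (Suc n). (\<Sum>s\<in>W. walk n (x \<otimes> inv s)) / real (card W) * \<phi> x)"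
    unfolding expect_def
    by (rule sum.cong[OF refl]) (simp only: walk_Suc_last[OF in_carrier_of_ball])
  also have "\<dots> = (\<Sum>x\<in>ball (Suc n). \<Sum>s\<in>W. walk n (x \<otimes> inv s) * \<phi> x) / real (card W)"
    by (simp only: sum_distrib_right sum_divide_distrib times_divide_eq_left)
  also have "(\<Sum>x\<in>ball (Suc n). \<Sum>s\<in>W. walk n (x \<otimes> inv s) * \<phi> x)
      = (\<Sum>s\<in>W. \<Sum>x\<in>ball (Suc n). walk n (x \<otimes> inv s) * \<phi> x)"
    by (rule sum.swap)
  also have "\<dots> = (\<Sum>s\<in>W. \<Sum>y\<in>ball n. walk n y * \<phi> (y \<otimes> s))"
  proof (rule sum.cong[OF refl])
    fix s assume s: "s \<in> W"
    have sc: "s \<in> carrier G" using s in_carrier_of_W by blast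
    have "(\<Sum>x\<in>ball (Suc n). walk n (x \<otimes> inv s) * \<phi> x)
        = (\<Sum>x\<in>ball (Suc n). walk n (x \<otimes> inv s) * \<phi> (x \<otimes> inv s \<otimes> s))"
    proof (rule sum.cong[OF refl])
      fix x assume "x \<in> ball (Suc n)"
      then have "x \<in> carrier G" by (rule in_carrier_of_ball)
      then have "x \<otimes> inv s \<otimes> s = x" using sc by (simp add: m_assoc)
      then show "walk n (x \<otimes> inv s) * \<phi> x = walk n (x \<otimes> inv s) * \<phi> (x \<otimes> inv s \<otimes> s)" by simp
    qed
    also have "\<dots> = (\<Sum>y\<in>ball n. walk n y * \<phi> (y \<otimes> s))"
      by (rule sum_right_translate_ball[OF s, where \<psi>="\<lambda>y. walk n y * \<phi> (y \<otimes> s)"])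
        (simp add: walk_zero)
    finally show "(\<Sum>x\<in>ball (Suc n). walk n (x \<otimes> inv s) * \<phi> x) = (\<Sum>y\<in>ball n. walk n y * \<phi> (y \<otimes> s))" .
  qed
  also have "\<dots> = (\<Sum>y\<in>ball n. \<Sum>s\<in>W. walk n y * \<phi> (y \<otimes> s))" by (rule sum.swap)
  finally show ?thesis
    by (simp add: expect_def sum_distrib_left[symmetric] sum_divide_distrib[symmetric])
qed

lemma expect_one: "expect n (\<lambda>_. 1) = 1"
proof (induction n)
  case 0
  then show ?case by (simp add: expect_def)
next
  case (Suc n)
  then show ?case using card_W_pos by (simp add: expect_Suc_last)
qed

lemma walk_sum_le_one:
  assumes "finite X" "X \<subseteq> carrier G"
  shows "(\<Sum>x\<in>X. walk n x) \<le> 1"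
proof -
  have "(\<Sum>x\<in>X. walk n x) = (\<Sum>x\<in>X \<inter> ball n. walk n x)"
    by (rule sum.mono_neutral_right) (use assms walk_zero in auto)
  also have "\<dots> \<le> (\<Sum>x\<in>ball n. walk n x)"
    by (rule sum_mono2) (auto simp: finite_ball walk_nonneg)
  also have "\<dots> = 1" using expect_one[of n] by (simp add: expect_def)
  finally show ?thesis .
qed

lemma walk_le_one: "x \<in> carrier G \<Longrightarrow> walk n x \<le> 1"
  using walk_sum_le_one[of "{x}" n] by simp

text \<open>
  One way of reaching a point of the ball is along a word that represents it.
\<close>

lemma walk_lower_bound: "x \<in> ball n \<Longrightarrow> (1 / real (card W)) ^ n \<le> walk n x"
proof (induction n arbitrary: x)
  case 0
  then show ?case by simp
next
  case (Suc n)
  then obtain z s where z: "z \<in> ball n" "s \<in> W" "x = z \<otimes> s" by auto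
  have c: "z \<in> carrier G" "s \<in> carrier G" using z in_carrier_of_ball in_carrier_of_W by blast+
  have "walk n (x \<otimes> inv s) \<le> (\<Sum>s\<in>W. walk n (x \<otimes> inv s))"
    by (rule member_le_sum[OF z(2)]) (auto simp: walk_nonneg finite_W)
  then have "walk n z \<le> (\<Sum>s\<in>W. walk n (x \<otimes> inv s))" using z c by (simp add: m_assoc)
  then have "(1 / real (card W)) ^ n \<le> (\<Sum>s\<in>W. walk n (x \<otimes> inv s))" using Suc.IH[OF z(1)] by linarith
  then have "(1 / real (card W)) ^ n / real (card W) \<le> (\<Sum>s\<in>W. walk n (x \<otimes> inv s)) / real (card W)"
    by (rule divide_right_mono) simp
  also have "\<dots> = walk (Suc n) x" using z(3) c by (subst walk_Suc_last) auto
  finally show ?case by (simp add: power_divide divide_simps mult.commute)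
qed

lemma walk_add: "x \<in> carrier G \<Longrightarrow> walk (n + k) x = expect k (\<lambda>w. walk n (inv w \<otimes> x))"
proof (induction k arbitrary: x)
  case 0
  then show ?case by (simp add: expect_def)
next
  case (Suc k)
  have "walk (n + Suc k) x = (\<Sum>s\<in>W. walk (n + k) (inv s \<otimes> x)) / real (card W)" by simp
  also have "(\<Sum>s\<in>W. walk (n + k) (inv s \<otimes> x)) = (\<Sum>s\<in>W. expect k (\<lambda>w. walk n (inv (s \<otimes> w) \<otimes> x)))"
  proof (rule sum.cong[OF refl])
    fix s assume s: "s \<in> W"
    have sc: "s \<in> carrier G" using s in_carrier_of_W by blast
    have "walk (n + k) (inv s \<otimes> x) = expect k (\<lambda>w. walk n (inv w \<otimes> (inv s \<otimes> x)))"
      by (rule Suc.IH) (use Suc.prems sc in simp)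
    also have "\<dots> = expect k (\<lambda>w. walk n (inv (s \<otimes> w) \<otimes> x))"
      unfolding expect_def
      by (rule sum.cong[OF refl])
        (use sc Suc.prems in_carrier_of_ball in \<open>simp add: inv_mult_group m_assoc\<close>)
    finally show "walk (n + k) (inv s \<otimes> x) = expect k (\<lambda>w. walk n (inv (s \<otimes> w) \<otimes> x))" .
  qed
  also have "\<dots> / real (card W) = expect (Suc k) (\<lambda>w. walk n (inv w \<otimes> x))"
    by (rule expect_Suc_first[symmetric])
  finally show ?case .
qed

definition walk_sup :: "nat \<Rightarrow> real" where
  "walk_sup n = Max (walk n ` ball n)"

lemma walk_le_sup: "x \<in> carrier G \<Longrightarrow> walk n x \<le> walk_sup n"
proof (cases "x \<in> ball n")
  case True
  then show ?thesis by (simp add: walk_sup_def finite_ball)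
next
  case False
  assume "x \<in> carrier G"
  have "0 \<le> walk n \<one>" by (rule walk_nonneg)
  also have "walk n \<one> \<le> walk_sup n" by (simp add: walk_sup_def finite_ball one_in_ball)
  finally show ?thesis using walk_zero[OF \<open>x \<in> carrier G\<close> False] by simp
qed

lemma walk_sup_attained: obtains x where "x \<in> carrier G" "walk n x = walk_sup n"
proof -
  have "walk_sup n \<in> walk n ` ball n"
    unfolding walk_sup_def by (rule Max_in) (simp_all add: finite_ball ball_nonempty)
  then obtain x where "x \<in> ball n" "walk n x = walk_sup n" by (metis imageE)
  then show ?thesis by (intro that[of x] in_carrier_of_ball)
qed

lemma walk_sup_Suc_le: "walk_sup (Suc n) \<le> walk_sup n"
proof -
  obtain x where x: "x \<in> carrier G" "walk (Suc n) x = walk_sup (Suc n)" by (rule walk_sup_attained)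
  have "(\<Sum>s\<in>W. walk n (inv s \<otimes> x)) \<le> (\<Sum>s\<in>W. walk_sup n)"
    by (intro sum_mono walk_le_sup) (use x in_carrier_of_W in auto)
  then have "walk (Suc n) x \<le> walk_sup n" using card_W_pos by (simp add: field_simps)
  then show ?thesis using x by simp
qed

text \<open>
  The largest point mass decreases with time, to a limit \<open>m\<close>.  If \<open>m > 0\<close>, then at a late time the
  mass of \<open>walk (n + k)\<close> at a maximum point \<open>x\<close>, a weighted mean of the masses of \<open>walk n\<close> at the
  points \<open>inv w \<otimes> x\<close> with \<open>w \<in> ball k\<close>, is almost the largest value that these can take.  As the
  weights are bounded below by a number that does not depend on \<open>n\<close>, all of these masses are at least
  \<open>m / 2\<close>.  For large \<open>k\<close> the total mass would exceed 1.
\<close>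

lemma walk_sup_tendsto_0:
  assumes "infinite (carrier G)"
  shows "walk_sup \<longlonglongrightarrow> 0"
proof -
  have dec: "decseq walk_sup" by (rule decseq_SucI) (rule walk_sup_Suc_le)
  have nonneg: "0 \<le> walk_sup n" for n
    using walk_nonneg[of n \<one>] walk_le_sup[of \<one> n] by simp
  obtain m where m: "walk_sup \<longlonglongrightarrow> m" "\<And>n. m \<le> walk_sup n"
    using decseq_convergent[OF dec, of 0] nonneg by blast
  have m0: "m \<ge> 0" by (rule LIMSEQ_le_const[OF m(1)]) (use nonneg in auto)
  have "\<not> m > 0"
  proof
    assume mpos: "m > 0"
    obtain k where k: "card (ball k) \<ge> nat \<lceil>2 / m\<rceil> + 1" using card_ball_unbounded[OF assms] by blast
    define \<delta> where "\<delta> = (1 / real (card W)) ^ k"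
    have \<delta>: "\<delta> > 0" using card_W_pos by (simp add: \<delta>_def)
    have "\<forall>\<^sub>F n in sequentially. walk_sup n < m + \<delta> * m / 2"
      using order_tendstoD(2)[OF m(1), of "m + \<delta> * m / 2"] \<delta> mpos by simp
    then obtain n where n: "walk_sup n < m + \<delta> * m / 2" unfolding eventually_sequentially by blast
    obtain x where x: "x \<in> carrier G" "walk (n + k) x = walk_sup (n + k)" by (rule walk_sup_attained)
    have big: "walk n (inv w \<otimes> x) \<ge> m / 2" if w: "w \<in> ball k" for w
    proof -
      have c: "inv v \<otimes> x \<in> carrier G" if "v \<in> ball k" for v
        using that x(1) in_carrier_of_ball by simp
      let ?d = "\<lambda>v. walk k v * (walk_sup n - walk n (inv v \<otimes> x))"
      have "?d w \<le> (\<Sum>v\<in>ball k. ?d v)"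
        by (rule member_le_sum[OF w]) (use walk_le_sup c walk_nonneg finite_ball in auto)
      also have "\<dots> = walk_sup n * expect k (\<lambda>_. 1) - expect k (\<lambda>v. walk n (inv v \<otimes> x))"
        by (simp add: expect_def sum_subtractf right_diff_distrib sum_distrib_left mult.commute)
      also have "\<dots> = walk_sup n - walk_sup (n + k)"
        using x by (simp add: expect_one walk_add[symmetric])
      also have "\<dots> \<le> \<delta> * m / 2" using n m(2)[of "n + k"] by linarith
      finally have "?d w \<le> \<delta> * m / 2" .
      moreover have "\<delta> * (walk_sup n - walk n (inv w \<otimes> x)) \<le> ?d w"
        unfolding \<delta>_def by (intro mult_right_mono walk_lower_bound w) (use walk_le_sup c w in simp)
      ultimately have "\<delta> * (walk_sup n - walk n (inv w \<otimes> x)) \<le> \<delta> * (m / 2)" by simp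
      then have "walk_sup n - walk n (inv w \<otimes> x) \<le> m / 2" using \<delta> by simp
      then show ?thesis using m(2)[of n] by linarith
    qed
    have inj: "inj_on (\<lambda>w. inv w \<otimes> x) (ball k)"
    proof (rule inj_onI)
      fix v w assume vw: "v \<in> ball k" "w \<in> ball k" "inv v \<otimes> x = inv w \<otimes> x"
      then have c: "v \<in> carrier G" "w \<in> carrier G" using in_carrier_of_ball by blast+
      then have "inv v = inv w" using vw(3) x(1) by simp
      then show "v = w" using c by (metis inv_inv)
    qed
    have "vol k * (m / 2) \<le> (\<Sum>w\<in>ball k. walk n (inv w \<otimes> x))"
      using sum_mono[OF big] by simp
    also have "\<dots> = (\<Sum>y\<in>(\<lambda>w. inv w \<otimes> x) ` ball k. walk n y)"
      by (simp add: sum.reindex[OF inj])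
    also have "\<dots> \<le> 1"
      by (rule walk_sum_le_one) (use finite_ball x(1) in_carrier_of_ball in auto)
    finally have "vol k \<le> 2 / m" using mpos by (simp add: field_simps)
    moreover have "2 / m \<le> real (nat \<lceil>2 / m\<rceil>)" by (rule real_nat_ceiling_ge)
    ultimately show False using k by linarith
  qed
  then have "m = 0" using m0 by linarith
  then show ?thesis using m(1) by simp
qed

lemma expect_vanishing_tendsto_0:
  assumes "infinite (carrier G)" "vanishes_at_infinity (carrier G) \<phi>"
  shows "(\<lambda>n. expect n \<phi>) \<longlonglongrightarrow> 0"
proof (rule LIMSEQ_I)
  fix e :: real assume e: "e > 0"
  define Z where "Z = {x\<in>carrier G. e/2 \<le> \<bar>\<phi> x\<bar>}"
  have Z: "finite Z" unfolding Z_def by (rule vanishes_at_infinityD[OF assms(2)]) (use e in simp)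
  define M where "M = (\<Sum>x\<in>Z. \<bar>\<phi> x\<bar>)"
  have "(\<lambda>n. walk_sup n * M) \<longlonglongrightarrow> 0 * M"
    by (intro tendsto_intros walk_sup_tendsto_0 assms)
  then have "\<forall>\<^sub>F n in sequentially. walk_sup n * M < e / 2"
    using e by (intro order_tendstoD(2)) auto
  then obtain N where N: "\<And>n. n \<ge> N \<Longrightarrow> walk_sup n * M < e / 2"
    unfolding eventually_sequentially by blast
  show "\<exists>no. \<forall>n\<ge>no. norm (expect n \<phi> - 0) < e"
  proof (intro exI[of _ N] allI impI)
    fix n assume n: "n \<ge> N"
    have "\<bar>expect n \<phi>\<bar> \<le> (\<Sum>x\<in>ball n. walk n x * \<bar>\<phi> x\<bar>)"
      unfolding expect_def
      by (rule order_trans[OF sum_abs]) (simp add: abs_mult walk_nonneg)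
    also have "\<dots> \<le> (\<Sum>x\<in>ball n. walk n x * (e/2) + (if x \<in> Z then walk_sup n * \<bar>\<phi> x\<bar> else 0))"
    proof (rule sum_mono)
      fix x assume x: "x \<in> ball n"
      have xc: "x \<in> carrier G" using x in_carrier_of_ball by blast
      show "walk n x * \<bar>\<phi> x\<bar> \<le> walk n x * (e/2) + (if x \<in> Z then walk_sup n * \<bar>\<phi> x\<bar> else 0)"
      proof (cases "x \<in> Z")
        case True
        have "walk n x * \<bar>\<phi> x\<bar> \<le> walk_sup n * \<bar>\<phi> x\<bar>"
          by (intro mult_right_mono walk_le_sup xc) simp
        moreover have "walk n x * (e/2) \<ge> 0" using walk_nonneg[of n x] e by simp
        ultimately show ?thesis using True by simp
      next
        case False
        then have "\<bar>\<phi> x\<bar> \<le> e/2" using xc by (auto simp: Z_def)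
        then have "walk n x * \<bar>\<phi> x\<bar> \<le> walk n x * (e/2)" by (rule mult_left_mono[OF _ walk_nonneg])
        then show ?thesis using False by simp
      qed
    qed
    also have "\<dots> = (e/2) * expect n (\<lambda>_. 1) + (\<Sum>x\<in>ball n \<inter> Z. walk_sup n * \<bar>\<phi> x\<bar>)"
      unfolding expect_def sum_distrib_left sum.inter_restrict[OF finite_ball] sum.distrib
      by (intro arg_cong2[where f="(+)"] sum.cong) auto
    also have "\<dots> \<le> e/2 + walk_sup n * M"
    proof -
      have "(\<Sum>x\<in>ball n \<inter> Z. walk_sup n * \<bar>\<phi> x\<bar>) \<le> (\<Sum>x\<in>Z. walk_sup n * \<bar>\<phi> x\<bar>)"
      proof (rule sum_mono2[OF Z])
        have "0 \<le> walk_sup n" using walk_nonneg[of n \<one>] walk_le_sup[of \<one> n] by simp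
        then show "0 \<le> walk_sup n * \<bar>\<phi> x\<bar>" for x by simp
      qed auto
      then show ?thesis by (simp add: M_def expect_one sum_distrib_left)
    qed
    also have "\<dots> < e" using N[OF n] by linarith
    finally show "norm (expect n \<phi> - 0) < e" by simp
  qed
qed

end

section \<open>Entropy of the random walk\<close>

text \<open>
  The estimate \<open>ln t \<le> t - 1\<close> at \<open>t = sqrt (b / a)\<close>.  Summed over two probability distributions, it
  says that relative entropy dominates the squared Hellinger distance.
\<close>

lemma entropy_pointwise:
  fixes a b :: real
  assumes "a \<ge> 0" "b \<ge> 0" "a > 0 \<Longrightarrow> b > 0"
  shows "a - b + (sqrt a - sqrt b)\<^sup>2 \<le> a * ln a - a * ln b"
proof (cases "a = 0")
  case True
  then show ?thesis using assms(2) by (simp add: real_sqrt_pow2)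
next
  case False
  then have a: "a > 0" and b: "b > 0" using assms by auto
  have "ln (sqrt b / sqrt a) \<le> sqrt b / sqrt a - 1"
    using a b by (intro ln_le_minus_one) auto
  moreover have "ln (sqrt b / sqrt a) = (ln b - ln a) / 2"
    using a b by (simp add: ln_div ln_sqrt diff_divide_distrib)
  ultimately have "(ln b - ln a) / 2 \<le> sqrt b / sqrt a - 1" by simp
  then have "ln b - ln a \<le> 2 * (sqrt b / sqrt a - 1)" by (simp only: divide_le_eq_numeral1 mult.commute)
  then have "ln b - ln a \<le> 2 * (sqrt b / sqrt a) - 2" by (simp only: right_diff_distrib mult_1_right)
  then have "a * (ln b - ln a) \<le> a * (2 * (sqrt b / sqrt a) - 2)"
    using a by (intro mult_left_mono) auto
  also have "a * (2 * (sqrt b / sqrt a) - 2) = 2 * (sqrt a * sqrt b) - 2 * a"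
    using a by (simp add: field_simps)
  finally have "a * ln b - a * ln a \<le> 2 * (sqrt a * sqrt b) - 2 * a" by (simp add: right_diff_distrib)
  moreover have "(sqrt a - sqrt b)\<^sup>2 = a + b - 2 * (sqrt a * sqrt b)"
    using a b by (simp add: power2_diff)
  ultimately show ?thesis by linarith
qed

lemma ln_Suc_diff_le:
  fixes m :: real
  assumes "m > 0"
  shows "ln (m + 1) - ln m \<le> 1 / m"
proof -
  have "ln (m + 1) - ln m = ln ((m + 1) / m)" using assms by (simp add: ln_div)
  also have "(m + 1) / m = 1 + 1 / m" using assms by (simp add: add_divide_distrib)
  also have "ln (1 + 1 / m) \<le> 1 / m" by (rule ln_add_one_self_le_self) (use assms in simp)
  finally show ?thesis .
qed

context cayley
begin

definition entropy :: "nat \<Rightarrow> real" where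
  "entropy n = - (\<Sum>x\<in>ball n. walk n x * ln (walk n x))"

lemma entropy_nonneg: "entropy n \<ge> 0"
proof -
  have "walk n x * ln (walk n x) \<le> 0" if "x \<in> ball n" for x
  proof (cases "walk n x = 0")
    case False
    then have "walk n x > 0" using walk_nonneg[of n x] by simp
    then have "ln (walk n x) \<le> 0" using walk_le_one[OF in_carrier_of_ball[OF that]] by simp
    then show ?thesis using walk_nonneg[of n x] by (simp add: mult_nonneg_nonpos)
  qed simp
  then show ?thesis unfolding entropy_def by (simp add: sum_nonpos)
qed

text \<open>
  The uniform distribution has the largest entropy among those supported on the ball.
\<close>

lemma entropy_le: "entropy n \<le> ln (vol n)"
proof -
  let ?V = "vol n"
  have V: "?V > 0" by (rule card_ball_pos_real)
  have "- (walk n x * ln (walk n x)) \<le> walk n x * ln ?V + (1 / ?V - walk n x)" for x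
  proof (cases "walk n x = 0")
    case True
    then show ?thesis by simp
  next
    case False
    then have w: "walk n x > 0" using walk_nonneg[of n x] by simp
    have "ln (1 / (?V * walk n x)) \<le> 1 / (?V * walk n x) - 1"
      by (rule ln_le_minus_one) (use w V in simp)
    moreover have "ln (1 / (?V * walk n x)) = - ln ?V - ln (walk n x)"
      using w V by (simp add: ln_div ln_mult)
    ultimately have "walk n x * (- ln ?V - ln (walk n x)) \<le> walk n x * (1 / (?V * walk n x) - 1)"
      using w by (intro mult_left_mono) auto
    also have "\<dots> = 1 / ?V - walk n x" using w V by (simp add: field_simps)
    finally show ?thesis by (simp add: algebra_simps)
  qed
  then have "(\<Sum>x\<in>ball n. - (walk n x * ln (walk n x)))
      \<le> (\<Sum>x\<in>ball n. walk n x * ln ?V + (1 / ?V - walk n x))"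
    by (intro sum_mono)
  also have "\<dots> = ln ?V * (\<Sum>x\<in>ball n. walk n x) + (1 - (\<Sum>x\<in>ball n. walk n x))"
    using V by (simp add: sum.distrib sum_subtractf sum_distrib_left mult.commute)
  also have "(\<Sum>x\<in>ball n. walk n x) = 1" using expect_one[of n] by (simp add: expect_def)
  finally show ?thesis by (simp add: entropy_def sum_negf)
qed

text \<open>
  Up to normalization, the squared Hellinger distance between the walk at time \<open>Suc n\<close> and the same walk
  conditioned on its first step being \<open>s\<close>.
\<close>

definition hellinger :: "nat \<Rightarrow> 'a \<Rightarrow> real" where
  "hellinger n s = (\<Sum>x\<in>ball (Suc n). (sqrt (walk n (inv s \<otimes> x)) - sqrt (walk (Suc n) x))\<^sup>2)"

lemma walk_le_walk_Suc:
  assumes "s \<in> W"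
  shows "walk n (inv s \<otimes> x) \<le> real (card W) * walk (Suc n) x"
proof -
  have "walk n (inv s \<otimes> x) \<le> (\<Sum>s\<in>W. walk n (inv s \<otimes> x))"
    by (rule member_le_sum[OF assms]) (auto simp: walk_nonneg finite_W)
  also have "\<dots> = real (card W) * walk (Suc n) x" using card_W_pos by simp
  finally show ?thesis .
qed

text \<open>
  The increment of entropy is the mutual information of the first step and the position at time
  \<open>Suc n\<close>, that is, the mean over \<open>s\<close> of the relative entropies between the conditioned and the
  unconditioned walk.
\<close>

lemma entropy_increment: "(\<Sum>s\<in>W. hellinger n s) / real (card W) \<le> entropy (Suc n) - entropy n"
proof -
  let ?a = "\<lambda>s x. walk n (inv s \<otimes> x)" and ?b = "walk (Suc n)" and ?N = "real (card W)"
  have "hellinger n s \<le> (\<Sum>x\<in>ball (Suc n). ?a s x * ln (?a s x)) - (\<Sum>x\<in>ball (Suc n). ?a s x * ln (?b x))"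
    if s: "s \<in> W" for s
  proof -
    have "(\<Sum>x\<in>ball (Suc n). ?a s x - ?b x + (sqrt (?a s x) - sqrt (?b x))\<^sup>2)
        \<le> (\<Sum>x\<in>ball (Suc n). ?a s x * ln (?a s x) - ?a s x * ln (?b x))"
    proof (intro sum_mono entropy_pointwise walk_nonneg)
      fix x assume "0 < ?a s x"
      then have "0 < ?N * ?b x" using walk_le_walk_Suc[OF s, of n x] by linarith
      then show "0 < ?b x" using card_W_pos by (simp add: zero_less_mult_iff)
    qed
    moreover have "(\<Sum>x\<in>ball (Suc n). ?a s x) = 1"
      using sum_left_translate_ball[OF s, of n "walk n"] walk_zero expect_one[of n]
      by (simp add: expect_def)
    moreover have "(\<Sum>x\<in>ball (Suc n). ?b x) = 1"
      using expect_one[of "Suc n"] by (simp add: expect_def)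
    ultimately show ?thesis
      by (simp only: hellinger_def sum.distrib sum_subtractf)
  qed
  then have "(\<Sum>s\<in>W. hellinger n s)
      \<le> (\<Sum>s\<in>W. (\<Sum>x\<in>ball (Suc n). ?a s x * ln (?a s x)) - (\<Sum>x\<in>ball (Suc n). ?a s x * ln (?b x)))"
    by (intro sum_mono)
  also have "\<dots> = (\<Sum>s\<in>W. - entropy n) - (\<Sum>s\<in>W. \<Sum>x\<in>ball (Suc n). ?a s x * ln (?b x))"
  proof -
    have "(\<Sum>x\<in>ball (Suc n). ?a s x * ln (?a s x)) = - entropy n" if s: "s \<in> W" for s
      unfolding entropy_def
      by (subst sum_left_translate_ball[OF s, where \<psi>="\<lambda>y. walk n y * ln (walk n y)"])
        (simp_all add: walk_zero)
    then show ?thesis by (simp add: sum_subtractf)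
  qed
  also have "(\<Sum>s\<in>W. \<Sum>x\<in>ball (Suc n). ?a s x * ln (?b x)) = - ?N * entropy (Suc n)"
  proof -
    have "(\<Sum>s\<in>W. \<Sum>x\<in>ball (Suc n). ?a s x * ln (?b x)) = (\<Sum>x\<in>ball (Suc n). \<Sum>s\<in>W. ?a s x * ln (?b x))"
      by (rule sum.swap)
    also have "\<dots> = (\<Sum>x\<in>ball (Suc n). ?N * (?b x * ln (?b x)))"
      by (rule sum.cong[OF refl]) (use card_W_pos in \<open>simp add: sum_distrib_right\<close>)
    also have "\<dots> = ?N * (\<Sum>x\<in>ball (Suc n). ?b x * ln (?b x))" by (rule sum_distrib_left[symmetric])
    also have "\<dots> = - ?N * entropy (Suc n)"
      by (simp only: entropy_def mult_minus_left mult_minus_right minus_minus)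
    finally show ?thesis .
  qed
  finally have "(\<Sum>s\<in>W. hellinger n s) \<le> ?N * (entropy (Suc n) - entropy n)"
    by (simp add: algebra_simps)
  then show ?thesis using card_W_pos by (simp add: pos_divide_le_eq mult.commute)
qed

section \<open>Slow growth: harmonic functions\<close>

lemma expect_mean_value:
  assumes "mean_value_property f" "g \<in> carrier G"
  shows "expect n (\<lambda>x. f (g \<otimes> x)) = f g"
proof (induction n)
  case 0
  then show ?case using assms(2) by (simp add: expect_def)
next
  case (Suc n)
  have "(\<Sum>s\<in>W. f (g \<otimes> (y \<otimes> s))) / real (card W) = f (g \<otimes> y)" if y: "y \<in> ball n" for y
  proof -
    have yc: "y \<in> carrier G" using y in_carrier_of_ball by blast
    have "(\<Sum>s\<in>W. f (g \<otimes> (y \<otimes> s))) = (\<Sum>s\<in>W. f (g \<otimes> y \<otimes> s))"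
      by (rule sum.cong[OF refl]) (use yc assms(2) in_carrier_of_W in \<open>simp add: m_assoc\<close>)
    also have "\<dots> = real (card W) * f (g \<otimes> y)"
      using assms yc by (simp add: mean_value_property_def)
    finally show ?thesis using card_W_pos by simp
  qed
  then have "expect (Suc n) (\<lambda>x. f (g \<otimes> x)) = expect n (\<lambda>x. f (g \<otimes> x))"
    unfolding expect_Suc_last unfolding expect_def by (intro sum.cong) simp_all
  then show ?case using Suc.IH by simp
qed

definition local_energy :: "('a \<Rightarrow> real) \<Rightarrow> 'a \<Rightarrow> real" where
  "local_energy f x = (\<Sum>s\<in>W. (increment G f s x)\<^sup>2) / real (card W)"

definition second_moment :: "('a \<Rightarrow> real) \<Rightarrow> nat \<Rightarrow> real" where
  "second_moment f n = expect n (\<lambda>x. (f x - f \<one>)\<^sup>2)"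

text \<open>
  Along the walk \<open>f\<close> is a martingale, so its increments are orthogonal.
\<close>

lemma second_moment_Suc:
  assumes "mean_value_property f"
  shows "second_moment f (Suc n) = second_moment f n + expect n (local_energy f)"
proof -
  have "(\<Sum>s\<in>W. (f (y \<otimes> s) - f \<one>)\<^sup>2) / real (card W) = (f y - f \<one>)\<^sup>2 + local_energy f y"
    if y: "y \<in> ball n" for y
  proof -
    have "(\<Sum>s\<in>W. increment G f s y) = 0"
      using assms in_carrier_of_ball[OF y]
      by (simp add: increment_def sum_subtractf mean_value_property_def)
    moreover have "(f (y \<otimes> s) - f \<one>)\<^sup>2
        = (f y - f \<one>)\<^sup>2 + 2 * (f y - f \<one>) * increment G f s y + (increment G f s y)\<^sup>2" for s
      by (simp add: increment_def power2_eq_square algebra_simps)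
    then have "(\<Sum>s\<in>W. (f (y \<otimes> s) - f \<one>)\<^sup>2)
        = real (card W) * (f y - f \<one>)\<^sup>2 + 2 * (f y - f \<one>) * (\<Sum>s\<in>W. increment G f s y)
          + (\<Sum>s\<in>W. (increment G f s y)\<^sup>2)"
      by (simp add: sum.distrib sum_distrib_left)
    ultimately show ?thesis using card_W_pos by (simp add: local_energy_def add_divide_distrib)
  qed
  then have "second_moment f (Suc n) = expect n (\<lambda>y. (f y - f \<one>)\<^sup>2 + local_energy f y)"
    unfolding second_moment_def expect_Suc_last unfolding expect_def by (intro sum.cong) simp_all
  then show ?thesis by (simp add: second_moment_def expect_def sum.distrib distrib_left)
qed

lemma vanishes_local_energy:
  assumes "\<And>s. s \<in> W \<Longrightarrow> vanishes_at_infinity (carrier G) (increment G f s)"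
  shows "vanishes_at_infinity (carrier G) (local_energy f)"
  unfolding local_energy_def
proof (intro vanishes_at_infinity_divide vanishes_at_infinity_sum card_W_pos)
  fix s assume s: "s \<in> W"
  show "vanishes_at_infinity (carrier G) (\<lambda>x. (increment G f s x)\<^sup>2)"
    unfolding vanishes_at_infinity_def
  proof (intro allI impI)
    fix \<epsilon> :: real assume e: "\<epsilon> > 0"
    have "finite {x\<in>carrier G. sqrt \<epsilon> \<le> \<bar>increment G f s x\<bar>}"
      by (rule vanishes_at_infinityD[OF assms[OF s]]) (use e in simp)
    moreover have "sqrt \<epsilon> \<le> \<bar>increment G f s x\<bar> \<longleftrightarrow> \<epsilon> \<le> \<bar>(increment G f s x)\<^sup>2\<bar>" for x
      using real_sqrt_le_iff[of \<epsilon> "(increment G f s x)\<^sup>2"] by simp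
    ultimately show "finite {x\<in>carrier G. \<epsilon> \<le> \<bar>(increment G f s x)\<^sup>2\<bar>}" by simp
  qed
qed

text \<open>
  The expected squared increment tends to 0 with time, since the walk leaves every finite set.
\<close>

lemma second_moment_sublinear:
  assumes "infinite (carrier G)" "mean_value_property f"
    "\<And>s. s \<in> W \<Longrightarrow> vanishes_at_infinity (carrier G) (increment G f s)" "\<epsilon> > 0"
  obtains C where "C \<ge> 0" "\<And>n. second_moment f n \<le> C + \<epsilon> * real n"
proof -
  have "(\<lambda>n. expect n (local_energy f)) \<longlonglongrightarrow> 0"
    by (intro expect_vanishing_tendsto_0 vanishes_local_energy assms)
  then have "\<forall>\<^sub>F n in sequentially. expect n (local_energy f) < \<epsilon>"
    using assms(4) by (rule order_tendstoD(2))
  then obtain N where N: "\<And>n. n \<ge> N \<Longrightarrow> expect n (local_energy f) < \<epsilon>"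
    unfolding eventually_sequentially by blast
  have nonneg: "second_moment f n \<ge> 0" for n
    unfolding second_moment_def expect_def by (intro sum_nonneg mult_nonneg_nonneg walk_nonneg) simp
  have le0: "expect n (local_energy f) \<ge> 0" for n
    unfolding local_energy_def expect_def
    by (intro sum_nonneg mult_nonneg_nonneg divide_nonneg_nonneg walk_nonneg) auto
  have "second_moment f n \<le> second_moment f N + \<epsilon> * real n" for n
  proof (cases "n \<le> N")
    case True
    have "second_moment f n \<le> second_moment f N"
      by (rule lift_Suc_mono_le[of "second_moment f", OF _ True])
        (use second_moment_Suc[OF assms(2)] le0 in simp)
    moreover have "\<epsilon> * real n \<ge> 0" using assms(4) by simp
    ultimately show ?thesis by linarith
  next
    case False
    have "second_moment f (N + d) \<le> second_moment f N + \<epsilon> * real d" for d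
    proof (induction d)
      case (Suc d)
      have "second_moment f (N + Suc d) \<le> second_moment f (N + d) + \<epsilon>"
        using second_moment_Suc[OF assms(2), of "N + d"] N[of "N + d"] by simp
      then show ?case using Suc by (simp add: algebra_simps)
    qed simp
    from this[of "n - N"] have "second_moment f n \<le> second_moment f N + \<epsilon> * real (n - N)"
      using False by simp
    also have "\<epsilon> * real (n - N) \<le> \<epsilon> * real n" using assms(4) by (intro mult_left_mono) auto
    finally show ?thesis by simp
  qed
  then show ?thesis using that nonneg by blast
qed

text \<open>
  By the mean value property, \<open>f s - f \<one>\<close> is the difference of the means of \<open>f\<close> under the walk
  conditioned on the first step \<open>s\<close> and the unconditioned walk, with masses \<open>a\<close> and \<open>b\<close>.  Both have
  mass 1, so \<open>f \<one>\<close> may be subtracted from \<open>f\<close>.  Factor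
  \<open>a - b = (sqrt a - sqrt b) * (sqrt a + sqrt b)\<close>, bound \<open>a\<close> by \<open>card W * b\<close> in the second factor,
  and apply the Cauchy-Schwarz inequality: the first factor gives the Hellinger distance and the
  second one the second moment.
\<close>

lemma gradient_le_entropy:
  assumes "mean_value_property f" "s \<in> W"
  shows "(f s - f \<one>)\<^sup>2 \<le> (1 + sqrt (real (card W)))\<^sup>2 * real (card W)
      * (entropy (Suc n) - entropy n) * second_moment f (Suc n)"
proof -
  let ?N = "real (card W)" and ?B = "ball (Suc n)"
  let ?a = "\<lambda>x. walk n (inv s \<otimes> x)" and ?b = "walk (Suc n)" and ?F = "\<lambda>x. f x - f \<one>"
  have sc: "s \<in> carrier G" using assms(2) in_carrier_of_W by blast
  have "f s = expect n (\<lambda>y. f (s \<otimes> y))" using expect_mean_value[OF assms(1) sc] by simp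
  also have "\<dots> = (\<Sum>x\<in>?B. ?a x * f (s \<otimes> (inv s \<otimes> x)))"
    unfolding expect_def
    by (rule sum_left_translate_ball[OF assms(2), where \<psi>="\<lambda>y. walk n y * f (s \<otimes> y)", symmetric])
      (simp add: walk_zero)
  also have "\<dots> = (\<Sum>x\<in>?B. ?a x * f x)"
  proof (rule sum.cong[OF refl])
    fix x assume "x \<in> ?B"
    then have "s \<otimes> (inv s \<otimes> x) = x" by (intro mult_inv_mult[OF sc] in_carrier_of_ball)
    then show "?a x * f (s \<otimes> (inv s \<otimes> x)) = ?a x * f x" by simp
  qed
  finally have fs: "f s = (\<Sum>x\<in>?B. ?a x * f x)" .
  have f1: "f \<one> = (\<Sum>x\<in>?B. ?b x * f x)"
  proof -
    have "expect (Suc n) (\<lambda>x. f (\<one> \<otimes> x)) = f \<one>" by (rule expect_mean_value[OF assms(1)]) simp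
    moreover have "expect (Suc n) (\<lambda>x. f (\<one> \<otimes> x)) = (\<Sum>x\<in>?B. ?b x * f x)"
      unfolding expect_def
    proof (rule sum.cong[OF refl])
      fix x assume "x \<in> ?B"
      then have "\<one> \<otimes> x = x" by (intro l_one in_carrier_of_ball)
      then show "?b x * f (\<one> \<otimes> x) = ?b x * f x" by (simp only:)
    qed
    ultimately show ?thesis by simp
  qed
  have mass: "(\<Sum>x\<in>?B. ?a x) = 1" "(\<Sum>x\<in>?B. ?b x) = 1"
    using sum_left_translate_ball[OF assms(2), of n "walk n"] walk_zero expect_one[of n]
      expect_one[of "Suc n"] by (simp_all add: expect_def)
  have "f s - f \<one> = (\<Sum>x\<in>?B. (?a x - ?b x) * ?F x)"
  proof -
    have "(\<Sum>x\<in>?B. (?a x - ?b x) * ?F x)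
        = (\<Sum>x\<in>?B. ?a x * f x) - (\<Sum>x\<in>?B. ?b x * f x) - ((\<Sum>x\<in>?B. ?a x) - (\<Sum>x\<in>?B. ?b x)) * f \<one>"
      by (simp only: algebra_simps sum.distrib sum_subtractf sum_distrib_left sum_distrib_right)
    then show ?thesis unfolding fs[symmetric] f1[symmetric] mass by simp
  qed
  also have "\<bar>\<dots>\<bar> \<le> (\<Sum>x\<in>?B. (1 + sqrt ?N) * (\<bar>sqrt (?a x) - sqrt (?b x)\<bar> * (sqrt (?b x) * \<bar>?F x\<bar>)))"
  proof (rule order_trans[OF sum_abs sum_mono])
    fix x assume "x \<in> ?B"
    have "?a x - ?b x = (sqrt (?a x) - sqrt (?b x)) * (sqrt (?a x) + sqrt (?b x))"
      using real_sqrt_pow2[OF walk_nonneg[of n "inv s \<otimes> x"]] real_sqrt_pow2[OF walk_nonneg[of "Suc n" x]]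
      by (simp only: power2_eq_square) (simp only: algebra_simps)
    then have "\<bar>(?a x - ?b x) * ?F x\<bar>
        = \<bar>sqrt (?a x) - sqrt (?b x)\<bar> * (sqrt (?a x) + sqrt (?b x)) * \<bar>?F x\<bar>"
      using real_sqrt_ge_zero[OF walk_nonneg[of n "inv s \<otimes> x"]]
        real_sqrt_ge_zero[OF walk_nonneg[of "Suc n" x]]
      by (simp only: abs_mult abs_of_nonneg[OF add_nonneg_nonneg])
    also have "\<dots> \<le> \<bar>sqrt (?a x) - sqrt (?b x)\<bar> * ((1 + sqrt ?N) * sqrt (?b x)) * \<bar>?F x\<bar>"
    proof (intro mult_right_mono mult_left_mono)
      have "sqrt (?a x) \<le> sqrt (?N * ?b x)" using walk_le_walk_Suc[OF assms(2)] by (rule real_sqrt_le_mono)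
      then show "sqrt (?a x) + sqrt (?b x) \<le> (1 + sqrt ?N) * sqrt (?b x)"
        by (simp only: real_sqrt_mult distrib_right)
    qed auto
    finally show "\<bar>(?a x - ?b x) * ?F x\<bar>
        \<le> (1 + sqrt ?N) * (\<bar>sqrt (?a x) - sqrt (?b x)\<bar> * (sqrt (?b x) * \<bar>?F x\<bar>))"
      by (simp only: ac_simps)
  qed
  also have "\<dots> = (1 + sqrt ?N) * (\<Sum>x\<in>?B. \<bar>sqrt (?a x) - sqrt (?b x)\<bar> * (sqrt (?b x) * \<bar>?F x\<bar>))"
    by (rule sum_distrib_left[symmetric])
  finally have "\<bar>f s - f \<one>\<bar> \<le> (1 + sqrt ?N) * (\<Sum>x\<in>?B. \<bar>sqrt (?a x) - sqrt (?b x)\<bar> * (sqrt (?b x) * \<bar>?F x\<bar>))" .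
  then have "\<bar>f s - f \<one>\<bar>\<^sup>2 \<le> ((1 + sqrt ?N) * (\<Sum>x\<in>?B. \<bar>sqrt (?a x) - sqrt (?b x)\<bar> * (sqrt (?b x) * \<bar>?F x\<bar>)))\<^sup>2"
    by (rule power_mono) simp
  also have "\<dots> = (1 + sqrt ?N)\<^sup>2 * (\<Sum>x\<in>?B. \<bar>sqrt (?a x) - sqrt (?b x)\<bar> * (sqrt (?b x) * \<bar>?F x\<bar>))\<^sup>2"
    by (rule power_mult_distrib)
  also have "\<dots> \<le> (1 + sqrt ?N)\<^sup>2 * ((?N * (entropy (Suc n) - entropy n)) * second_moment f (Suc n))"
  proof (rule mult_left_mono)
    have "(\<Sum>x\<in>?B. \<bar>sqrt (?a x) - sqrt (?b x)\<bar> * (sqrt (?b x) * \<bar>?F x\<bar>))\<^sup>2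
        \<le> (\<Sum>x\<in>?B. \<bar>sqrt (?a x) - sqrt (?b x)\<bar>\<^sup>2) * (\<Sum>x\<in>?B. (sqrt (?b x) * \<bar>?F x\<bar>)\<^sup>2)"
      by (rule Cauchy_Schwarz_ineq_sum)
    also have "(\<Sum>x\<in>?B. \<bar>sqrt (?a x) - sqrt (?b x)\<bar>\<^sup>2) = hellinger n s"
      by (simp only: hellinger_def power2_abs)
    also have "(\<Sum>x\<in>?B. (sqrt (?b x) * \<bar>?F x\<bar>)\<^sup>2) = second_moment f (Suc n)"
      by (simp only: second_moment_def expect_def power_mult_distrib power2_abs
          real_sqrt_pow2[OF walk_nonneg])
    also have "hellinger n s * second_moment f (Suc n)
        \<le> (?N * (entropy (Suc n) - entropy n)) * second_moment f (Suc n)"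
    proof (rule mult_right_mono)
      have "hellinger n s \<le> (\<Sum>s\<in>W. hellinger n s)"
        by (rule member_le_sum[OF assms(2)]) (auto simp: hellinger_def finite_W intro: sum_nonneg)
      also have "\<dots> \<le> ?N * (entropy (Suc n) - entropy n)"
        using entropy_increment[of n] card_W_pos by (simp add: pos_divide_le_eq mult.commute)
      finally show "hellinger n s \<le> ?N * (entropy (Suc n) - entropy n)" .
      show "0 \<le> second_moment f (Suc n)"
        unfolding second_moment_def expect_def by (intro sum_nonneg mult_nonneg_nonneg walk_nonneg) simp
    qed
    finally show "(\<Sum>x\<in>?B. \<bar>sqrt (?a x) - sqrt (?b x)\<bar> * (sqrt (?b x) * \<bar>?F x\<bar>))\<^sup>2
        \<le> (?N * (entropy (Suc n) - entropy n)) * second_moment f (Suc n)" .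
  qed simp
  finally show ?thesis by (simp only: power2_abs ac_simps)
qed

text \<open>
  Otherwise the entropy would grow at least like \<open>(D + 1) * ln n\<close>, but it is at most \<open>D * ln n\<close> for
  infinitely many \<open>n\<close>, namely for \<open>n = 2 ^ k\<close> with a small ball of that radius.
\<close>

lemma entropy_increment_small_infinitely_often:
  assumes "\<And>N. \<exists>k\<ge>N. vol (2 ^ k) \<le> (2 powr real k) powr D" "D \<ge> 0"
  shows "\<exists>n\<ge>N. (entropy (Suc n) - entropy n) * real (Suc n) \<le> D + 1"
proof (rule ccontr)
  assume "\<not> ?thesis"
  then have no: "D + 1 < (entropy (Suc n) - entropy n) * real (Suc n)" if "n \<ge> N" for n
    using that by (meson not_le)
  have grow: "(D + 1) * (ln (real (N + d + 1)) - ln (real (N + 1))) \<le> entropy (N + d)" for d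
  proof (induction d)
    case 0
    then show ?case using entropy_nonneg by simp
  next
    case (Suc d)
    let ?m = "real (N + d + 1)"
    have "ln (?m + 1) - ln ?m \<le> 1 / ?m" by (rule ln_Suc_diff_le) simp
    then have "(D + 1) * (ln (?m + 1) - ln ?m) \<le> (D + 1) * (1 / ?m)"
      using assms(2) by (intro mult_left_mono) auto
    also have "\<dots> \<le> entropy (Suc (N + d)) - entropy (N + d)"
      using no[of "N + d"] by (simp add: pos_divide_le_eq add_ac)
    finally have "(D + 1) * (ln (?m + 1) - ln ?m) \<le> entropy (Suc (N + d)) - entropy (N + d)" .
    moreover have "(D + 1) * (ln (?m + 1) - ln (real (N + 1)))
        = (D + 1) * (ln (?m + 1) - ln ?m) + (D + 1) * (ln ?m - ln (real (N + 1)))"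
      by (simp add: algebra_simps)
    ultimately have "(D + 1) * (ln (?m + 1) - ln (real (N + 1))) \<le> entropy (Suc (N + d))"
      using Suc.IH by linarith
    then show ?case by (simp add: add_ac)
  qed
  obtain M :: nat where M: "(D + 1) * ln (real (N + 1)) / ln 2 < real M" using reals_Archimedean2 by blast
  obtain k where k: "k \<ge> M + N" "vol (2 ^ k) \<le> (2 powr real k) powr D"
    using assms(1) by blast
  have "(D + 1) * ln (real (N + 1)) < real M * ln 2" using M by (simp add: pos_divide_less_eq)
  also have "\<dots> \<le> real k * ln 2" using k(1) by (intro mult_right_mono) auto
  finally have *: "(D + 1) * ln (real (N + 1)) < real k * ln 2" .
  have "k < 2 ^ k" by (rule less_exp)
  then have "N \<le> 2 ^ k" using k(1) by linarith
  then obtain d where d: "2 ^ k = N + d" using le_Suc_ex by blast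
  have "real k * ln 2 = ln (2 powr real k)" by (simp add: ln_powr)
  also have "2 powr real k = real (N + d)" using d by (simp add: powr_realpow) (metis of_nat_add of_nat_numeral of_nat_power)
  also have "ln (real (N + d)) \<le> ln (real (N + d + 1))"
  proof (rule ln_mono)
    have "0 < N + d" unfolding d[symmetric] by simp
    then show "0 < real (N + d)" by (simp only: of_nat_0_less_iff)
  qed auto
  finally have "(D + 1) * (real k * ln 2 - ln (real (N + 1))) \<le> (D + 1) * (ln (real (N + d + 1)) - ln (real (N + 1)))"
    using assms(2) by (intro mult_left_mono) auto
  also have "\<dots> \<le> entropy (N + d)" by (rule grow)
  also have "\<dots> \<le> ln (vol (2 ^ k))" unfolding d[symmetric] by (rule entropy_le)
  also have "\<dots> \<le> ln ((2 powr real k) powr D)"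
    by (rule ln_mono) (use k(2) card_ball_pos_real in auto)
  also have "\<dots> = D * (real k * ln 2)" by (simp add: ln_powr)
  finally have "real k * ln 2 \<le> (D + 1) * ln (real (N + 1))" by (simp add: algebra_simps)
  then show False using * by linarith
qed

text \<open>
  In \<open>gradient_le_entropy\<close> the entropy increment is \<open>O(1 / n)\<close> infinitely often and the second moment
  is \<open>o(n)\<close>.
\<close>

lemma slow_growth_gradient_zero:
  assumes "infinite (carrier G)" "mean_value_property f"
    "\<And>s. s \<in> W \<Longrightarrow> vanishes_at_infinity (carrier G) (increment G f s)"
    "\<And>N. \<exists>k\<ge>N. vol (2 ^ k) \<le> (2 powr real k) powr D" "D \<ge> 0" "s \<in> W"
  shows "f s = f \<one>"
proof -
  define K where "K = (1 + sqrt (real (card W)))\<^sup>2 * real (card W)"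
  have K: "K \<ge> 0" by (simp add: K_def)
  have "(f s - f \<one>)\<^sup>2 \<le> K * (D + 1) * (2 * \<epsilon>)" if e: "\<epsilon> > 0" for \<epsilon>
  proof -
    obtain C where C: "C \<ge> 0" "\<And>n. second_moment f n \<le> C + \<epsilon> * real n"
      using second_moment_sublinear[OF assms(1,2,3) e] by blast
    obtain N :: nat where N: "C / \<epsilon> < real N" using reals_Archimedean2 by blast
    obtain n where n: "n \<ge> N" "(entropy (Suc n) - entropy n) * real (Suc n) \<le> D + 1"
      using entropy_increment_small_infinitely_often[OF assms(4,5)] by blast
    have "C < \<epsilon> * real N" using N e by (simp add: pos_divide_less_eq mult.commute)
    also have "\<dots> \<le> \<epsilon> * real (Suc n)" using n(1) e by (intro mult_left_mono) auto
    finally have "second_moment f (Suc n) \<le> (2 * \<epsilon>) * real (Suc n)" using C(2)[of "Suc n"] by linarith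
    moreover have inc: "entropy (Suc n) - entropy n \<ge> 0"
    proof -
      have "0 \<le> (\<Sum>s\<in>W. hellinger n s) / real (card W)"
        by (intro divide_nonneg_nonneg sum_nonneg) (auto simp: hellinger_def intro: sum_nonneg)
      then show ?thesis using entropy_increment[of n] by linarith
    qed
    ultimately have "K * (entropy (Suc n) - entropy n) * second_moment f (Suc n)
        \<le> K * (entropy (Suc n) - entropy n) * ((2 * \<epsilon>) * real (Suc n))"
      using K by (intro mult_left_mono mult_nonneg_nonneg)
    also have "\<dots> = K * ((entropy (Suc n) - entropy n) * real (Suc n)) * (2 * \<epsilon>)" by (simp only: ac_simps)
    also have "\<dots> \<le> K * (D + 1) * (2 * \<epsilon>)"
      using K e n(2) by (intro mult_left_mono mult_right_mono) auto
    finally show ?thesis using gradient_le_entropy[OF assms(2,6), of n] unfolding K_def by linarith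
  qed
  then have small: "(f s - f \<one>)\<^sup>2 \<le> (K * (D + 1) * 2) * \<epsilon>" if "\<epsilon> > 0" for \<epsilon>
    using that by (simp only: mult.assoc)
  have "(f s - f \<one>)\<^sup>2 \<le> 0"
  proof (rule ccontr)
    assume "\<not> (f s - f \<one>)\<^sup>2 \<le> 0"
    then have pos: "(f s - f \<one>)\<^sup>2 > 0" by simp
    define L where "L = K * (D + 1) * 2"
    have L: "L \<ge> 0" using K assms(5) by (simp add: L_def)
    have "(f s - f \<one>)\<^sup>2 \<le> L * ((f s - f \<one>)\<^sup>2 / (2 * (L + 1)))"
      unfolding L_def by (rule small) (use pos L in \<open>simp add: L_def\<close>)
    also have "\<dots> = (f s - f \<one>)\<^sup>2 * (L / (2 * (L + 1)))" by simp
    also have "\<dots> < (f s - f \<one>)\<^sup>2 * 1"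
      by (intro mult_strict_left_mono pos) (use L in \<open>simp add: divide_less_eq\<close>)
    finally show False by simp
  qed
  then show ?thesis by simp
qed

text \<open>
  Left translates of \<open>f\<close> satisfy the same hypotheses, so the gradient vanishes at each point.
\<close>

lemma slow_growth_mean_value_constant:
  assumes "infinite (carrier G)" "mean_value_property f"
    "\<And>s. s \<in> W \<Longrightarrow> vanishes_at_infinity (carrier G) (increment G f s)"
    "\<And>N. \<exists>k\<ge>N. vol (2 ^ k) \<le> (2 powr real k) powr D" "D \<ge> 0"
  shows "f constant_on carrier G"
proof -
  have step: "f (g \<otimes> s) = f g" if g: "g \<in> carrier G" and s: "s \<in> W" for g s
  proof -
    let ?f = "\<lambda>x. f (g \<otimes> x)"
    have "mean_value_property ?f"
      unfolding mean_value_property_def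
    proof
      fix x assume x: "x \<in> carrier G"
      have "(\<Sum>s\<in>W. f (g \<otimes> (x \<otimes> s))) = (\<Sum>s\<in>W. f (g \<otimes> x \<otimes> s))"
        by (rule sum.cong[OF refl]) (use x g in_carrier_of_W in \<open>simp add: m_assoc\<close>)
      then show "real (card W) * f (g \<otimes> x) = (\<Sum>s\<in>W. f (g \<otimes> (x \<otimes> s)))"
        using assms(2) x g by (simp add: mean_value_property_def)
    qed
    moreover have "vanishes_at_infinity (carrier G) (increment G ?f t)" if t: "t \<in> W" for t
    proof (rule vanishes_at_infinity_abs_mono)
      show "vanishes_at_infinity (carrier G) (\<lambda>x. increment G f t (g \<otimes> x))"
        by (rule vanishes_at_infinity_reindex[OF assms(3)[OF t]])
          (use g in \<open>auto intro!: inj_on_left_mult\<close>)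
      show "\<bar>increment G ?f t x\<bar> \<le> \<bar>increment G f t (g \<otimes> x)\<bar>" if "x \<in> carrier G" for x
        using that g in_carrier_of_W[OF t] by (simp add: increment_def m_assoc)
    qed
    ultimately have "f (g \<otimes> s) = f (g \<otimes> \<one>)"
      by (rule slow_growth_gradient_zero[OF assms(1) _ _ assms(4,5) s])
    then show ?thesis using g by simp
  qed
  have "f x = f \<one>" if "x \<in> ball n" for x n
    using that
  proof (induction n arbitrary: x)
    case (Suc n)
    then obtain z s where z: "z \<in> ball n" "s \<in> W" "x = z \<otimes> s" by auto
    then show ?case using Suc.IH[OF z(1)] step[OF in_carrier_of_ball[OF z(1)] z(2)] by simp
  qed simp
  then show ?thesis using word_balls_exhaust unfolding constant_on_def by blast
qed

end

section \<open>Both cases together\<close>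

context commuting_factors
begin

text \<open>
  Growth is measured with the product generating set \<open>U\<close>, whereas \<open>W\<close> is the generating set of the
  graph under consideration.  Slow growth passes from \<open>U\<close> to the smaller set \<open>W\<close>.
\<close>

lemma finite_energy_dichotomy:
  assumes "cayley G W" "W \<subseteq> U" "finite_energy p G f" "p \<ge> 1"
  shows "constant_at_infinity (carrier G) f \<or>
    p > 1 \<and> (\<forall>N. \<exists>k\<ge>N. real (card (word_ball G W (2 ^ k))) \<le> (2 powr real k) powr (4 * p))"
proof -
  interpret U: cayley G U by (rule cayley_U)
  have sub: "word_ball G W n \<subseteq> word_ball G U n" for n
    using assms(2) by (induction n) auto
  consider "p = 1" | c where "c > 0"
      "\<And>k. c * (2 powr real k) powr (4 * p) \<le> real (card (word_ball G U (2 ^ k)))"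
    | "p > 1" "\<And>c. c > 0 \<Longrightarrow> \<exists>k. real (card (word_ball G U (2 ^ k))) < c * (2 powr real k) powr (4 * p)"
    using assms(4) by (meson not_le order_le_less)
  then show ?thesis
  proof cases
    case 1
    then show ?thesis using summable_gradient_constant_at_infinity assms(3) by blast
  next
    case 2
    then show ?thesis using fast_growth_constant_at_infinity[OF assms(3,4)] by blast
  next
    case 3
    have "\<exists>k\<ge>N. real (card (word_ball G W (2 ^ k))) \<le> (2 powr real k) powr (4 * p)" for N
    proof -
      obtain k where k: "k \<ge> N" "real (card (word_ball G U (2 ^ k))) \<le> (2 powr real k) powr (4 * p)"
        using U.slow_growth_infinitely_often[OF 3(2)] assms(4) by force
      have "card (word_ball G W (2 ^ k)) \<le> card (word_ball G U (2 ^ k))"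
        by (rule card_mono[OF U.finite_ball sub])
      then show ?thesis using k by (intro exI[of _ k]) linarith
    qed
    then show ?thesis using 3(1) by blast
  qed
qed

lemma finite_energy_mean_value_constant:
  assumes "cayley G W" "W \<subseteq> U" "finite_energy p G f" "p \<ge> 1" "cayley.mean_value_property G W f"
  shows "f constant_on carrier G"
proof -
  interpret W: cayley G W by (rule assms(1))
  consider "constant_at_infinity (carrier G) f"
    | "\<And>N. \<exists>k\<ge>N. real (card (word_ball G W (2 ^ k))) \<le> (2 powr real k) powr (4 * p)"
    using finite_energy_dichotomy[OF assms(1-4)] by blast
  then show ?thesis
  proof cases
    case 1
    then show ?thesis
      by (rule W.mean_value_property_constant_at_infinity[OF infinite_carrier assms(5)])
  next
    case 2
    show ?thesis
    proof (rule W.slow_growth_mean_value_constant[OF infinite_carrier assms(5) _ 2])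
      show "vanishes_at_infinity (carrier G) (increment G f s)" if "s \<in> W" for s
        by (rule finite_energy_vanishes[OF assms(3,4) W.in_carrier_of_W[OF that]])
    qed (use assms(4) in simp)
  qed
qed

lemma finite_energy_lp_approximable:
  assumes "cayley G W" "W \<subseteq> U" "finite_energy p G f" "p \<ge> 1"
  shows "cayley.lp_approximable G W p f"
proof -
  interpret W: cayley G W by (rule assms(1))
  show ?thesis
    using finite_energy_dichotomy[OF assms] W.lp_approximable_constant_at_infinity[OF assms(3) _ assms(4)]
      W.slow_growth_lp_approximable[OF assms(3)] by blast
qed

end

section \<open>Cayley graphs\<close>

text \<open>
  The nontrivial elements are the steps to the neighbours in the Cayley graph; the identity is added
  for the sake of \<^locale>\<open>cayley\<close>.
\<close>

definition symmetrized :: "('a, 'b) monoid_scheme \<Rightarrow> 'a set \<Rightarrow> 'a set" where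
  "symmetrized G S = insert \<one>\<^bsub>G\<^esub> (S \<union> (\<lambda>s. inv\<^bsub>G\<^esub> s) ` S)"

lemma cayley_symmetrized:
  assumes "group G" "finite_generating_set G S"
  shows "cayley G (symmetrized G S)"
proof -
  interpret group G by fact
  have S: "finite S" "S \<subseteq> carrier G" "generate G S = carrier G"
    using assms(2) by (auto simp: finite_generating_set_def)
  have W: "symmetrized G S \<subseteq> carrier G" "\<one>\<^bsub>G\<^esub> \<in> symmetrized G S" "S \<subseteq> symmetrized G S"
    using S by (auto simp: symmetrized_def)
  have inv: "inv\<^bsub>G\<^esub> s \<in> symmetrized G S" if "s \<in> symmetrized G S" for s
    using that S(2) by (auto simp: symmetrized_def)
  show ?thesis
  proof
    show "finite (symmetrized G S)" using S by (simp add: symmetrized_def)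
    show "carrier G = (\<Union>n. word_ball G (symmetrized G S) n)"
      using generate_subset_word_balls[OF W(1,2) inv W(3)] S(3) word_ball_subset_carrier[OF W(1)]
      by blast
  qed (use W inv in auto)
qed

lemma parcs_cayley_graph:
  assumes "group G" "S \<subseteq> carrier G"
  shows "parcs (cayley_graph G S)
    = (\<lambda>(g, s). (g, g \<otimes>\<^bsub>G\<^esub> s)) ` (carrier G \<times> (symmetrized G S - {\<one>\<^bsub>G\<^esub>}))"
proof -
  interpret group G by fact
  show ?thesis
  proof (rule subset_antisym; rule subsetI)
    fix e assume "e \<in> parcs (cayley_graph G S)"
    then obtain g h s where e: "e = (g, h)" "g \<in> carrier G" "h \<in> carrier G" "g \<noteq> h" "s \<in> S"
      "h = g \<otimes>\<^bsub>G\<^esub> s \<or> g = h \<otimes>\<^bsub>G\<^esub> s"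
      by (auto simp: cayley_graph_def)
    have sc: "s \<in> carrier G" using e assms(2) by blast
    from e(6) obtain t where t: "t \<in> symmetrized G S" "h = g \<otimes>\<^bsub>G\<^esub> t" "t \<in> carrier G"
    proof
      assume "h = g \<otimes>\<^bsub>G\<^esub> s"
      then show ?thesis using that[of s] e(5) sc by (simp add: symmetrized_def)
    next
      assume "g = h \<otimes>\<^bsub>G\<^esub> s"
      then have "h = g \<otimes>\<^bsub>G\<^esub> inv\<^bsub>G\<^esub> s" using e(3) sc by (simp add: m_assoc)
      then show ?thesis using that[of "inv\<^bsub>G\<^esub> s"] e(5) sc by (simp add: symmetrized_def)
    qed
    have "t \<noteq> \<one>\<^bsub>G\<^esub>" using t(2) e(2,4) by auto
    then show "e \<in> (\<lambda>(g, s). (g, g \<otimes>\<^bsub>G\<^esub> s)) ` (carrier G \<times> (symmetrized G S - {\<one>\<^bsub>G\<^esub>}))"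
      using e(1,2) t by (intro image_eqI[of _ _ "(g, t)"]) auto
  next
    fix e assume "e \<in> (\<lambda>(g, s). (g, g \<otimes>\<^bsub>G\<^esub> s)) ` (carrier G \<times> (symmetrized G S - {\<one>\<^bsub>G\<^esub>}))"
    then obtain g t where e: "e = (g, g \<otimes>\<^bsub>G\<^esub> t)" "g \<in> carrier G" "t \<in> symmetrized G S" "t \<noteq> \<one>\<^bsub>G\<^esub>" by auto
    then have "t \<in> S \<or> (\<exists>s\<in>S. t = inv\<^bsub>G\<^esub> s)" by (auto simp: symmetrized_def)
    then have *: "t \<in> carrier G \<and> (\<exists>s\<in>S. g \<otimes>\<^bsub>G\<^esub> t = g \<otimes>\<^bsub>G\<^esub> s \<or> g = g \<otimes>\<^bsub>G\<^esub> t \<otimes>\<^bsub>G\<^esub> s)"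
    proof
      assume "t \<in> S"
      then show ?thesis using assms(2) by blast
    next
      assume "\<exists>s\<in>S. t = inv\<^bsub>G\<^esub> s"
      then obtain s where s: "s \<in> S" "t = inv\<^bsub>G\<^esub> s" by blast
      have sc: "s \<in> carrier G" using s assms(2) by blast
      have "g = g \<otimes>\<^bsub>G\<^esub> t \<otimes>\<^bsub>G\<^esub> s" using s(2) sc e(2) by (simp add: m_assoc)
      then show ?thesis using s sc by auto
    qed
    then have "g \<noteq> g \<otimes>\<^bsub>G\<^esub> t" using e(2,4) l_cancel_one' by metis
    then show "e \<in> parcs (cayley_graph G S)" using e(1,2) * by (auto simp: cayley_graph_def)
  qed
qed

context
  fixes G :: "('a, 'b) monoid_scheme" (structure) and S :: "'a set"
  assumes G: "group G" and S: "finite_generating_set G S"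
begin

interpretation cayley G "symmetrized G S" by (rule cayley_symmetrized[OF G S])

lemma S_subset_carrier: "S \<subseteq> carrier G"
  using S by (simp add: finite_generating_set_def)

lemma finite_neighbour_steps: "finite (symmetrized G S - {\<one>})"
  using finite_W by simp

lemma neighbours_cayley_graph:
  assumes "g \<in> carrier G"
  shows "{w. g \<rightarrow>\<^bsub>with_proj (cayley_graph G S)\<^esub> w} = (\<lambda>s. g \<otimes> s) ` (symmetrized G S - {\<one>})"
  using assms parcs_cayley_graph[OF G S_subset_carrier] by (auto simp: image_iff)

lemma out_degree_cayley_graph:
  assumes "g \<in> carrier G"
  shows "out_degree (with_proj (cayley_graph G S)) g = card (symmetrized G S - {\<one>})"
proof -
  have "out_arcs (with_proj (cayley_graph G S)) g = (\<lambda>s. (g, g \<otimes> s)) ` (symmetrized G S - {\<one>})"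
    using assms parcs_cayley_graph[OF G S_subset_carrier] by (auto simp: out_arcs_def image_iff)
  moreover have "inj_on (\<lambda>s. (g, g \<otimes> s)) (symmetrized G S - {\<one>})"
    using assms in_carrier_of_W by (auto simp: inj_on_def)
  ultimately show ?thesis unfolding out_degree_def by (simp add: card_image)
qed

text \<open>
  Adding the value at \<open>g\<close> itself to the values at the neighbours of \<open>g\<close> does not change their mean.
\<close>

lemma mean_value_property_of_harmonic:
  assumes "harmonic_on_graph (cayley_graph G S) f"
  shows "mean_value_property f"
  unfolding mean_value_property_def
proof
  fix g assume g: "g \<in> carrier G"
  let ?N = "symmetrized G S - {\<one>}"
  have inj: "inj_on (\<lambda>s. g \<otimes> s) ?N" using g in_carrier_of_W by (auto simp: inj_on_def)
  have "g \<in> pverts (cayley_graph G S)" using g by (simp add: cayley_graph_def)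
  then have "f g = 1 / real (card ?N) * (\<Sum>w\<in>(\<lambda>s. g \<otimes> s) ` ?N. f w)"
    using assms out_degree_cayley_graph[OF g] neighbours_cayley_graph[OF g]
    unfolding harmonic_on_graph_def by metis
  then have fg: "f g = (\<Sum>s\<in>?N. f (g \<otimes> s)) / real (card ?N)" by (simp add: sum.reindex[OF inj])
  have "real (card ?N) * f g = (\<Sum>s\<in>?N. f (g \<otimes> s))"
  proof (cases "?N = {}")
    case False
    then have "card ?N > 0" using finite_neighbour_steps by (simp add: card_gt_0_iff)
    then show ?thesis using fg by (simp add: field_simps)
  next
    case True
    show ?thesis by (simp only: True card.empty sum.empty of_nat_0 mult_zero_left)
  qed
  moreover have "(\<Sum>s\<in>symmetrized G S. f (g \<otimes> s)) = f (g \<otimes> \<one>) + (\<Sum>s\<in>?N. f (g \<otimes> s))"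
    by (rule sum.remove[OF finite_W one_in_W])
  moreover have "real (card (symmetrized G S)) = 1 + real (card ?N)"
    using card.remove[OF finite_W one_in_W] by simp
  ultimately show "real (card (symmetrized G S)) * f g = (\<Sum>s\<in>symmetrized G S. f (g \<otimes> s))"
    using g by (simp add: distrib_right)
qed

lemma lp_le_increment_of_gradient:
  assumes "lp_le p (parcs (cayley_graph G S)) (gradient f) C" "s \<in> symmetrized G S" "p \<ge> 1"
  shows "lp_le p (carrier G) (increment G f s) C"
proof (cases "s = \<one>")
  case True
  have C: "C \<ge> 0" by (rule lp_le_nonneg[OF assms(1)])
  show ?thesis
  proof (rule lp_leI)
    fix X assume "X \<subseteq> carrier G"
    then have "(\<Sum>x\<in>X. \<bar>increment G f s x\<bar> powr p) = (\<Sum>x\<in>X. 0)"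
      by (intro sum.cong) (auto simp: increment_def True subset_iff)
    then show "(\<Sum>x\<in>X. \<bar>increment G f s x\<bar> powr p) \<le> C" using C by simp
  qed
next
  case False
  have "lp_le p (carrier G) (\<lambda>g. gradient f (g, g \<otimes> s)) C"
    by (rule lp_le_reindex[OF assms(1)])
      (use assms(2) False parcs_cayley_graph[OF G S_subset_carrier] in \<open>auto simp: inj_on_def\<close>)
  then show ?thesis by (simp add: gradient_def increment_def)
qed

lemma finite_energy_of_gradient:
  assumes "gradient f \<in> lp_space p (parcs (cayley_graph G S))" "p \<ge> 1"
  shows "finite_energy p G f"
  unfolding finite_energy_iff_generators[OF assms(2)]
  using lp_le_increment_of_gradient[OF lp_space_imp_lp_le[OF assms(1)] _ assms(2)] by blast

lemma lp_le_gradient_of_increments: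
  assumes "\<And>s. s \<in> symmetrized G S \<Longrightarrow> lp_le p (carrier G) (increment G f s) \<epsilon>"
  shows "lp_le p (parcs (cayley_graph G S)) (gradient f) (real (card (symmetrized G S)) * \<epsilon>)"
proof (rule lp_leI)
  fix X assume X: "finite X" "X \<subseteq> parcs (cayley_graph G S)"
  let ?h = "\<lambda>(g, s). (g, g \<otimes> s)" and ?N = "symmetrized G S - {\<one>}"
  have fX: "fst ` X \<subseteq> carrier G" using X(2) parcs_cayley_graph[OF G S_subset_carrier] by auto
  have sub: "X \<subseteq> ?h ` (fst ` X \<times> ?N)"
  proof
    fix e assume e: "e \<in> X"
    then have "e \<in> ?h ` (carrier G \<times> ?N)"
      using X(2) parcs_cayley_graph[OF G S_subset_carrier] by blast
    then obtain g s where gs: "e = (g, g \<otimes> s)" "s \<in> ?N" by auto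
    have "g \<in> fst ` X" using e gs(1) by force
    then show "e \<in> ?h ` (fst ` X \<times> ?N)" using gs by (intro image_eqI[of _ _ "(g, s)"]) auto
  qed
  have inj: "inj_on ?h (fst ` X \<times> ?N)"
    using fX in_carrier_of_W by (auto simp: inj_on_def)
  have "(\<Sum>e\<in>X. \<bar>gradient f e\<bar> powr p) \<le> (\<Sum>e\<in>?h ` (fst ` X \<times> ?N). \<bar>gradient f e\<bar> powr p)"
    by (rule sum_mono2[OF _ sub]) (use X(1) finite_neighbour_steps in auto)
  also have "\<dots> = (\<Sum>(g, s)\<in>fst ` X \<times> ?N. \<bar>increment G f s g\<bar> powr p)"
    by (subst sum.reindex[OF inj]) (simp add: gradient_def increment_def case_prod_unfold)
  also have "\<dots> = (\<Sum>g\<in>fst ` X. \<Sum>s\<in>?N. \<bar>increment G f s g\<bar> powr p)"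
    by (rule sum.cartesian_product[symmetric])
  also have "\<dots> = (\<Sum>s\<in>?N. \<Sum>g\<in>fst ` X. \<bar>increment G f s g\<bar> powr p)" by (rule sum.swap)
  also have "\<dots> \<le> (\<Sum>s\<in>?N. \<epsilon>)"
    by (intro sum_mono lp_leD[OF assms]) (use X(1) fX in auto)
  also have "\<dots> \<le> real (card (symmetrized G S)) * \<epsilon>"
  proof -
    have "card ?N \<le> card (symmetrized G S)" by (rule card_mono[OF finite_W]) auto
    then show ?thesis using lp_le_nonneg[OF assms[OF one_in_W]] by (simp add: mult_right_mono)
  qed
  finally show "(\<Sum>e\<in>X. \<bar>gradient f e\<bar> powr p) \<le> real (card (symmetrized G S)) * \<epsilon>" .
qed

text \<open>
  The approximants at accuracy \<open>1 / (n + 1)\<close> converge in the seminorm; they have finite seminorm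
  themselves, being differences of two functions of finite seminorm.
\<close>

lemma Dp_closure_of_lp_approximable:
  assumes "f \<in> Dp_space p (cayley_graph G S)" "lp_approximable p f" "p \<ge> 1"
  shows "f \<in> Dp_closure p (cayley_graph G S) (lp_plus_const p (cayley_graph G S))"
proof -
  let ?g = "cayley_graph G S" and ?N = "real (card (symmetrized G S))"
  have N: "?N > 0" using finite_W one_in_W by (auto simp: card_gt_0_iff)
  have verts: "pverts ?g = carrier G" by (simp add: cayley_graph_def)
  have "\<exists>u. (\<exists>C. lp_le p (carrier G) u C) \<and>
      lp_le p (parcs ?g) (gradient (\<lambda>g. f g - u g)) (inverse (real (Suc n)))" for n
  proof -
    have "inverse (real (Suc n)) / ?N > 0" using N by simp
    then obtain u where u: "\<exists>C. lp_le p (carrier G) u C"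
      "\<And>s. s \<in> symmetrized G S \<Longrightarrow>
        lp_le p (carrier G) (increment G (\<lambda>g. f g - u g) s) (inverse (real (Suc n)) / ?N)"
      using assms(2) unfolding lp_approximable_def by meson
    have "lp_le p (parcs ?g) (gradient (\<lambda>g. f g - u g)) (?N * (inverse (real (Suc n)) / ?N))"
      by (rule lp_le_gradient_of_increments[OF u(2)])
    then show ?thesis using u(1) N by (intro exI[of _ u]) simp
  qed
  then obtain u where u: "\<And>n. \<exists>C. lp_le p (carrier G) (u n) C"
    "\<And>n. lp_le p (parcs ?g) (gradient (\<lambda>g. f g - u n g)) (inverse (real (Suc n)))"
    by metis
  have "u n \<in> lp_plus_const p ?g \<inter> Dp_space p ?g" for n
  proof
    have "u n \<in> lp_space p (pverts ?g)" using u(1)[of n] lp_le_imp_lp_space verts by auto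
    then have "(\<lambda>v. u n v + 0) \<in> lp_plus_const p ?g" unfolding lp_plus_const_def by blast
    then show "u n \<in> lp_plus_const p ?g" by simp
    obtain C where "lp_le p (parcs ?g) (gradient f) C"
      using assms(1) lp_space_imp_lp_le unfolding Dp_space_def by blast
    from lp_le_diff[OF this u(2)[of n] assms(3)]
    have "lp_le p (parcs ?g) (gradient (u n)) (2 powr p * (C + inverse (real (Suc n))))"
      by (subst lp_le_cong[where v="\<lambda>e. gradient f e - gradient (\<lambda>g. f g - u n g) e"])
        (auto simp: gradient_def)
    then show "u n \<in> Dp_space p ?g" unfolding Dp_space_def using lp_le_imp_lp_space by blast
  qed
  moreover have "(\<lambda>n. Dp_seminorm p ?g (\<lambda>v. f v - u n v)) \<longlonglongrightarrow> 0"
  proof (rule tendsto_sandwich[OF _ _ tendsto_const])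
    show "\<forall>\<^sub>F n in sequentially. 0 \<le> Dp_seminorm p ?g (\<lambda>v. f v - u n v)"
      by (simp add: Dp_seminorm_def lp_norm_def)
    show "\<forall>\<^sub>F n in sequentially. Dp_seminorm p ?g (\<lambda>v. f v - u n v) \<le> inverse (real (Suc n)) powr (1/p)"
      unfolding Dp_seminorm_def by (intro always_eventually allI lp_norm_le u(2) assms(3))
    have "(\<lambda>n. inverse (real (Suc n)) powr (1/p)) \<longlonglongrightarrow> 0 powr (1/p)"
      by (intro tendsto_powr' LIMSEQ_inverse_real_of_nat tendsto_const) (use assms(3) in auto)
    then show "(\<lambda>n. inverse (real (Suc n)) powr (1/p)) \<longlonglongrightarrow> 0" by simp
  qed
  ultimately show ?thesis unfolding Dp_closure_def using assms(1) by blast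
qed

end

section \<open>Direct products\<close>

lemma word_ball_fst:
  "x \<in> word_ball (G \<times>\<times> H) W n \<Longrightarrow> fst x \<in> word_ball G (fst ` W) n"
proof (induction n arbitrary: x)
  case (Suc n)
  then obtain z w where z: "z \<in> word_ball (G \<times>\<times> H) W n" "w \<in> W" "x = z \<otimes>\<^bsub>G \<times>\<times> H\<^esub> w" by auto
  have "fst x = fst z \<otimes>\<^bsub>G\<^esub> fst w" unfolding z(3) DirProd_def by (simp add: case_prod_unfold)
  then show ?case using Suc.IH[OF z(1)] z(2) by force
qed (simp add: DirProd_def)

lemma word_ball_snd:
  "x \<in> word_ball (G \<times>\<times> H) W n \<Longrightarrow> snd x \<in> word_ball H (snd ` W) n"
proof (induction n arbitrary: x)
  case (Suc n)
  then obtain z w where z: "z \<in> word_ball (G \<times>\<times> H) W n" "w \<in> W" "x = z \<otimes>\<^bsub>G \<times>\<times> H\<^esub> w" by auto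
  have "snd x = snd z \<otimes>\<^bsub>H\<^esub> snd w" unfolding z(3) DirProd_def by (simp add: case_prod_unfold)
  then show ?case using Suc.IH[OF z(1)] z(2) by force
qed (simp add: DirProd_def)

lemma word_ball_left_factor:
  assumes "group H"
  shows "word_ball (G \<times>\<times> H) ((\<lambda>a. (a, \<one>\<^bsub>H\<^esub>)) ` A) n = (\<lambda>a. (a, \<one>\<^bsub>H\<^esub>)) ` word_ball G A n"
proof (induction n)
  case (Suc n)
  interpret H: group H by fact
  show ?case unfolding word_ball.simps(2) Suc.IH by (force simp: DirProd_def image_iff)
qed (simp add: DirProd_def)

lemma word_ball_right_factor:
  assumes "group G"
  shows "word_ball (G \<times>\<times> H) ((\<lambda>b. (\<one>\<^bsub>G\<^esub>, b)) ` B) n = (\<lambda>b. (\<one>\<^bsub>G\<^esub>, b)) ` word_ball H B n"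
proof (induction n)
  case (Suc n)
  interpret G: group G by fact
  show ?case unfolding word_ball.simps(2) Suc.IH by (force simp: DirProd_def image_iff)
qed (simp add: DirProd_def)

lemma word_balls_fst_exhaust:
  assumes "group G" "group H" "cayley (G \<times>\<times> H) W"
  shows "(\<Union>n. word_ball G (fst ` W) n) = carrier G"
proof -
  interpret G: group G by fact
  interpret H: group H by fact
  interpret cayley "G \<times>\<times> H" W by fact
  have sub: "fst ` W \<subseteq> carrier G" using W_subset by auto
  show ?thesis
  proof
    show "(\<Union>n. word_ball G (fst ` W) n) \<subseteq> carrier G" using G.word_ball_subset_carrier[OF sub] by blast
    show "carrier G \<subseteq> (\<Union>n. word_ball G (fst ` W) n)"
    proof
      fix g assume "g \<in> carrier G"
      then have "(g, \<one>\<^bsub>H\<^esub>) \<in> carrier (G \<times>\<times> H)" by simp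
      then obtain n where "(g, \<one>\<^bsub>H\<^esub>) \<in> ball n" using word_balls_exhaust by blast
      from word_ball_fst[OF this] show "g \<in> (\<Union>n. word_ball G (fst ` W) n)" by auto
    qed
  qed
qed

lemma word_balls_snd_exhaust:
  assumes "group G" "group H" "cayley (G \<times>\<times> H) W"
  shows "(\<Union>n. word_ball H (snd ` W) n) = carrier H"
proof -
  interpret G: group G by fact
  interpret H: group H by fact
  interpret cayley "G \<times>\<times> H" W by fact
  have sub: "snd ` W \<subseteq> carrier H" using W_subset by auto
  show ?thesis
  proof
    show "(\<Union>n. word_ball H (snd ` W) n) \<subseteq> carrier H" using H.word_ball_subset_carrier[OF sub] by blast
    show "carrier H \<subseteq> (\<Union>n. word_ball H (snd ` W) n)"
    proof
      fix h assume "h \<in> carrier H"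
      then have "(\<one>\<^bsub>G\<^esub>, h) \<in> carrier (G \<times>\<times> H)" by simp
      then obtain n where "(\<one>\<^bsub>G\<^esub>, h) \<in> ball n" using word_balls_exhaust by blast
      from word_ball_snd[OF this] show "h \<in> (\<Union>n. word_ball H (snd ` W) n)" by auto
    qed
  qed
qed

text \<open>
  The projections of a generating set of the product generate the factors.
\<close>

lemma commuting_factors_DirProd:
  assumes "group G" "group H" "cayley (G \<times>\<times> H) W" "infinite (carrier G)" "infinite (carrier H)"
  shows "commuting_factors (G \<times>\<times> H) ((\<lambda>a. (a, \<one>\<^bsub>H\<^esub>)) ` fst ` W) ((\<lambda>b. (\<one>\<^bsub>G\<^esub>, b)) ` snd ` W)"
    (is "commuting_factors ?P ?A ?B")
proof -
  interpret G: group G by fact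
  interpret H: group H by fact
  interpret P: cayley ?P W by fact
  have W: "w \<in> W \<Longrightarrow> fst w \<in> carrier G \<and> snd w \<in> carrier H" for w
    using P.W_subset by auto
  have inv: "w \<in> W \<Longrightarrow> (inv\<^bsub>G\<^esub> fst w, inv\<^bsub>H\<^esub> snd w) \<in> W" for w
    using P.inv_in_W[of w] W[of w] inv_DirProd[OF assms(1,2), of "fst w" "snd w"] by simp
  have one: "(\<one>\<^bsub>G\<^esub>, \<one>\<^bsub>H\<^esub>) \<in> W" using P.one_in_W by simp
  have A: "(\<Union>n. word_ball ?P ?A n) = (\<lambda>a. (a, \<one>\<^bsub>H\<^esub>)) ` carrier G"
    unfolding word_ball_left_factor[OF assms(2)] image_UN[symmetric] word_balls_fst_exhaust[OF assms(1-3)] ..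
  have B: "(\<Union>n. word_ball ?P ?B n) = (\<lambda>b. (\<one>\<^bsub>G\<^esub>, b)) ` carrier H"
    unfolding word_ball_right_factor[OF assms(1)] image_UN[symmetric] word_balls_snd_exhaust[OF assms(1-3)] ..
  show ?thesis
  proof (intro commuting_factors.intro commuting_factors_axioms.intro, unfold A B)
    show "group ?P" by (rule P.is_group)
    show "finite ?A" "finite ?B" using P.finite_W by auto
    show "?A \<subseteq> carrier ?P" "?B \<subseteq> carrier ?P" using W by auto
    show "\<one>\<^bsub>?P\<^esub> \<in> ?A" using one by force
    show "\<one>\<^bsub>?P\<^esub> \<in> ?B" using one by force
    show "inv\<^bsub>?P\<^esub> a \<in> ?A" if a: "a \<in> ?A" for a
    proof -
      obtain w where w: "w \<in> W" "a = (fst w, \<one>\<^bsub>H\<^esub>)" using a by auto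
      have "inv\<^bsub>?P\<^esub> a = (inv\<^bsub>G\<^esub> fst w, \<one>\<^bsub>H\<^esub>)" using W[OF w(1)] w(2) assms(1,2) by (simp add: inv_DirProd)
      then show ?thesis using inv[OF w(1)] by force
    qed
    show "inv\<^bsub>?P\<^esub> b \<in> ?B" if b: "b \<in> ?B" for b
    proof -
      obtain w where w: "w \<in> W" "b = (\<one>\<^bsub>G\<^esub>, snd w)" using b by auto
      have "inv\<^bsub>?P\<^esub> b = (\<one>\<^bsub>G\<^esub>, inv\<^bsub>H\<^esub> snd w)" using W[OF w(1)] w(2) assms(1,2) by (simp add: inv_DirProd)
      then show ?thesis using inv[OF w(1)] by force
    qed
    show "a \<otimes>\<^bsub>?P\<^esub> b = b \<otimes>\<^bsub>?P\<^esub> a" if "a \<in> ?A" "b \<in> ?B" for a b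
      using that W by auto
    show "infinite ((\<lambda>a. (a, \<one>\<^bsub>H\<^esub>)) ` carrier G)"
      using assms(4) by (subst finite_image_iff) (auto simp: inj_on_def)
    show "infinite ((\<lambda>b. (\<one>\<^bsub>G\<^esub>, b)) ` carrier H)"
      using assms(5) by (subst finite_image_iff) (auto simp: inj_on_def)
    show "(\<lambda>a. (a, \<one>\<^bsub>H\<^esub>)) ` carrier G \<inter> (\<lambda>b. (\<one>\<^bsub>G\<^esub>, b)) ` carrier H = {\<one>\<^bsub>?P\<^esub>}" by auto
    show "\<exists>h\<in>(\<lambda>a. (a, \<one>\<^bsub>H\<^esub>)) ` carrier G. \<exists>k\<in>(\<lambda>b. (\<one>\<^bsub>G\<^esub>, b)) ` carrier H. g = h \<otimes>\<^bsub>?P\<^esub> k"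
      if g: "g \<in> carrier ?P" for g
    proof (intro bexI)
      show "g = (fst g, \<one>\<^bsub>H\<^esub>) \<otimes>\<^bsub>?P\<^esub> (\<one>\<^bsub>G\<^esub>, snd g)" using g by auto
    qed (use g in auto)
  qed
qed

theorem corollary3:
  fixes \<Gamma>1 :: "('a, 'c) monoid_scheme" and \<Gamma>2 :: "('b, 'd) monoid_scheme"
    and S :: "('a \<times> 'b) set"
  assumes "finitely_generated_group \<Gamma>1" and "infinite (carrier \<Gamma>1)"
    and "finitely_generated_group \<Gamma>2" and "infinite (carrier \<Gamma>2)"
    and "finite_generating_set (\<Gamma>1 \<times>\<times> \<Gamma>2) S"
  shows "(\<forall>p\<ge>1. \<forall>f. harmonic_on_graph (cayley_graph (\<Gamma>1 \<times>\<times> \<Gamma>2) S) f \<and>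
             gradient f \<in> lp_space p (parcs (cayley_graph (\<Gamma>1 \<times>\<times> \<Gamma>2) S)) \<longrightarrow>
             f constant_on pverts (cayley_graph (\<Gamma>1 \<times>\<times> \<Gamma>2) S)) \<and>
         (\<forall>p\<ge>1. reduced_lp_cohomology_trivial p (cayley_graph (\<Gamma>1 \<times>\<times> \<Gamma>2) S))"
proof -
  let ?P = "\<Gamma>1 \<times>\<times> \<Gamma>2"
  let ?W = "symmetrized ?P S"
  have groups: "group \<Gamma>1" "group \<Gamma>2" using assms by (auto simp: finitely_generated_group_def)
  have P: "group ?P" by (rule DirProd_group[OF groups])
  have W: "cayley ?P ?W" by (rule cayley_symmetrized[OF P assms(5)])
  let ?A = "(\<lambda>a. (a, \<one>\<^bsub>\<Gamma>2\<^esub>)) ` fst ` ?W" and ?B = "(\<lambda>b. (\<one>\<^bsub>\<Gamma>1\<^esub>, b)) ` snd ` ?W"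
  interpret commuting_factors ?P ?A ?B
    by (rule commuting_factors_DirProd[OF groups W assms(2,4)])
  have WU: "?W \<subseteq> U"
  proof
    fix w assume w: "w \<in> ?W"
    then have "w \<in> carrier ?P" using cayley.W_subset[OF W] by blast
    then have prod: "w = (fst w, \<one>\<^bsub>\<Gamma>2\<^esub>) \<otimes>\<^bsub>?P\<^esub> (\<one>\<^bsub>\<Gamma>1\<^esub>, snd w)"
      using groups by (auto simp: group.is_monoid)
    have "((fst w, \<one>\<^bsub>\<Gamma>2\<^esub>), (\<one>\<^bsub>\<Gamma>1\<^esub>, snd w)) \<in> ?A \<times> ?B" using w by blast
    from imageI[OF this, of "\<lambda>(a, b). a \<otimes>\<^bsub>?P\<^esub> b"] show "w \<in> U"
      unfolding U_def by (simp only: prod.case prod[symmetric])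
  qed
  have verts: "pverts (cayley_graph ?P S) = carrier ?P" by (simp add: cayley_graph_def)
  show ?thesis
  proof (intro conjI allI impI)
    fix p :: real and f assume p: "p \<ge> 1"
      and "harmonic_on_graph (cayley_graph ?P S) f \<and> gradient f \<in> lp_space p (parcs (cayley_graph ?P S))"
    then have "finite_energy p ?P f" "cayley.mean_value_property ?P ?W f"
      using finite_energy_of_gradient[OF P assms(5)] mean_value_property_of_harmonic[OF P assms(5)]
      by auto
    then show "f constant_on pverts (cayley_graph ?P S)"
      unfolding verts by (intro finite_energy_mean_value_constant[OF W WU _ p])
  next
    fix p :: real assume p: "p \<ge> 1"
    show "reduced_lp_cohomology_trivial p (cayley_graph ?P S)"
      unfolding reduced_lp_cohomology_trivial_def
    proof
      fix f assume f: "f \<in> Dp_space p (cayley_graph ?P S)"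
      then have "finite_energy p ?P f"
        using finite_energy_of_gradient[OF P assms(5) _ p] by (simp add: Dp_space_def)
      then have "cayley.lp_approximable ?P ?W p f" by (rule finite_energy_lp_approximable[OF W WU _ p])
      then show "f \<in> Dp_closure p (cayley_graph ?P S) (lp_plus_const p (cayley_graph ?P S))"
        by (rule Dp_closure_of_lp_approximable[OF P assms(5) f _ p])
    qed
  qed
qed

end
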